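(* Let $\Omega\subset\mathbb R^d$ be a domain satisfying condition (M), and let $0<\Lambda_1\le\Lambda_2\le\dots$ be the eigenvalues of the Dirichlet Bilaplacian on $\Omega$. Then $$\lim_{z\to+\infty}z^{-2-\frac d2}\sum_j(z^2-\Lambda_j)_+=\frac{4}{d+4}(2\pi)^{-d}B_d|\Omega|.$$
   Context: The Dirichlet Bilaplacian eigenvalues $\Lambda_j$ (with multiplicity) are the eigenvalues of: $U\in H^2_0(\Omega)\setminus\{0\}$, $\int_\Omega\Delta U\Delta\phi=\Lambda\int_\Omega U\phi$ for all $\phi\in H^2_0(\Omega)$, where $H^2_0(\Omega)$ is the closure of $C_c^\infty(\Omega)$ in the norm $(\|f\|_2^2+\|\Delta f\|_2^2)^{1/2}$. Condition (M): with $\omega_h=\{x\in\Omega:\operatorname{dist}(x,\partial\Omega)<h\}$, $|\Omega|<\infty$ and $\limsup_{h\to0^+}|\omega_h|/h^\gamma<\infty$ for some $\gamma\in(0,1]$. $B_d$ is the volume of the unit ball in $\mathbb R^d$; $a_+=\max\{a,0\}$. *)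

theory Defs
  imports "HOL-Analysis.Analysis"
begin

coinductive smooth_fun :: "('a::euclidean_space \<Rightarrow> real) \<Rightarrow> bool" where
  "continuous_on UNIV f \<Longrightarrow> f differentiable_on UNIV \<Longrightarrow>
   (\<forall>i\<in>Basis. smooth_fun (\<lambda>x. frechet_derivative f (at x) i)) \<Longrightarrow> smooth_fun f"

definition Cc_inf :: "'a::euclidean_space set \<Rightarrow> ('a \<Rightarrow> real) set" where
  "Cc_inf \<Omega> = {f. smooth_fun f \<and> compact (closure {x. f x \<noteq> 0}) \<and> closure {x. f x \<noteq> 0} \<subseteq> \<Omega>}"

definition laplacian :: "('a::euclidean_space \<Rightarrow> real) \<Rightarrow> 'a \<Rightarrow> real" where
  "laplacian f x = (\<Sum>i\<in>Basis. frechet_derivative (\<lambda>y. frechet_derivative f (at y) i) (at x) i)"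

definition L2fun :: "('a::euclidean_space \<Rightarrow> real) \<Rightarrow> bool" where
  "L2fun U \<longleftrightarrow> U \<in> borel_measurable lebesgue \<and> integrable lebesgue (\<lambda>x. (U x)\<^sup>2)"

text \<open>H20 Omega U V: U lies in H^2_0(Omega), the closure of C_c^infinity(Omega) in the norm
  (||f||_2^2 + ||Delta f||_2^2)^(1/2), and V is its (extended) Laplacian, i.e. there is a sequence
  phi_n in C_c^infinity(Omega) with phi_n to U and Delta phi_n to V in L^2.\<close>
definition H20 :: "'a::euclidean_space set \<Rightarrow> ('a \<Rightarrow> real) \<Rightarrow> ('a \<Rightarrow> real) \<Rightarrow> bool" where
  "H20 \<Omega> U V \<longleftrightarrow> L2fun U \<and> L2fun V \<and>
     (\<exists>\<phi>::nat \<Rightarrow> 'a \<Rightarrow> real. (\<forall>n. \<phi> n \<in> Cc_inf \<Omega>) \<and>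
        (\<lambda>n. \<integral>x. (\<phi> n x - U x)\<^sup>2 \<partial>lebesgue) \<longlonglongrightarrow> 0 \<and>
        (\<lambda>n. \<integral>x. (laplacian (\<phi> n) x - V x)\<^sup>2 \<partial>lebesgue) \<longlonglongrightarrow> 0)"

definition bilap_eigen :: "'a::euclidean_space set \<Rightarrow> real \<Rightarrow> ('a \<Rightarrow> real) \<Rightarrow> bool" where
  "bilap_eigen \<Omega> \<Lambda> U \<longleftrightarrow> (\<exists>V. H20 \<Omega> U V \<and>
     (\<forall>\<phi> \<psi>. H20 \<Omega> \<phi> \<psi> \<longrightarrow> (\<integral>x. V x * \<psi> x \<partial>lebesgue) = \<Lambda> * (\<integral>x. U x * \<phi> x \<partial>lebesgue)))"

text \<open>Multiplicity of Lambda: dimension of the eigenspace (as a subspace of L^2),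
  i.e. the supremum of sizes of L^2-orthonormal families of eigenfunctions.\<close>
definition bilap_mult :: "'a::euclidean_space set \<Rightarrow> real \<Rightarrow> enat" where
  "bilap_mult \<Omega> \<Lambda> = Sup {enat n | n. \<exists>U::nat \<Rightarrow> 'a \<Rightarrow> real.
      (\<forall>i<n. bilap_eigen \<Omega> \<Lambda> (U i)) \<and>
      (\<forall>i<n. \<forall>j<n. (\<integral>x. U i x * U j x \<partial>lebesgue) = (if i = j then 1 else 0))}"

definition riesz_sum :: "'a::euclidean_space set \<Rightarrow> real \<Rightarrow> ennreal" where
  "riesz_sum \<Omega> z = (\<integral>\<^sup>+ \<Lambda>. ennreal_of_enat (bilap_mult \<Omega> \<Lambda>) * ennreal (max (z\<^sup>2 - \<Lambda>) 0)
      \<partial>count_space UNIV)"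

definition boundary_layer :: "'a::euclidean_space set \<Rightarrow> real \<Rightarrow> 'a set" where
  "boundary_layer \<Omega> h = {x\<in>\<Omega>. infdist x (frontier \<Omega>) < h}"

definition condition_M :: "'a::euclidean_space set \<Rightarrow> bool" where
  "condition_M \<Omega> \<longleftrightarrow> emeasure lebesgue \<Omega> < \<infinity> \<and>
     (\<exists>\<gamma> C. 0 < \<gamma> \<and> \<gamma> \<le> 1 \<and>
        eventually (\<lambda>h. measure lebesgue (boundary_layer \<Omega> h) \<le> C * h powr \<gamma>) (at_right 0))"

end

(*
Write f^ for the Fourier transform of f (zero outside Omega) and take R = z^2. For (U, Delta U)
in the closed graph G of the Laplacian on test functions, Plancherel gives
  (2 pi)^d (R |U|^2 - |Delta U|^2) = int (R - |xi|^4) |U^(xi)|^2 dxi <= int (R - |xi|^4)_+ |U^(xi)|^2 dxi.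
Upper bound: sum this over orthonormal eigenfunctions u_j. Since u_j^(xi) is the inner product of u_j with
1_Omega e_xi, where e_xi(x) = exp(i x.xi), Bessel's inequality bounds sum_j |u_j^(xi)|^2 by |Omega|, and the
phase space integral of (R - |xi|^4)_+ is the Weyl term.
The same inequality yields compactness: for a bounded sequence in G the transforms converge pointwise along
a subsequence, hence the right-hand side for differences tends to 0, and R is arbitrary. So eigenfunctions
are obtained by minimisation, and if u_1, ..., u_N is a maximal orthonormal family with eigenvalues below R,
then R |f|^2 - |Delta f|^2 <= sum_j (R - Lambda_j) <f, u_j>^2 for all f in the form domain.
Lower bound: apply this to f = phi e_xi with a test function 0 <= phi <= 1 on Omega and integrate over xi; by
Plancherel the right-hand side is at most (2 pi)^d sum_j (R - Lambda_j), and the left-hand side is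
(R - |xi|^4) |phi|^2 up to an error O(1 + |xi|^2). Finally let phi tend to 1_Omega.
*)
theory Submission
  imports Defs "HOL-Computational_Algebra.Polynomial" "HOL-Probability.Characteristic_Functions"
    "HOL-Complex_Analysis.Great_Picard"
begin

section \<open>Smooth functions\<close>

text \<open>For each \<open>z\<close> only finitely many eigenvalues count, so no full spectral
  decomposition is built. A maximal orthonormal family below \<open>R\<close> exists because the
  upper bound already limits its size; if the inequality failed on its orthogonal complement,
  minimisation there would add one more eigenvector below \<open>R\<close>. Plancherel is proved for
  test functions only; elements of the closed graph are reached by dominated convergence or Fatou.
  As \<Omega> has finite measure, the transform at each frequency is a pairing with an L^2 vector
  that depends continuously on the frequency. This gives Bessel, a uniform bound on transforms, and
  a reduction to countably many frequencies in the diagonal argument. In the lower bound, pairing u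
  with phi e_xi gives the transform of phi u, of mass at most that of u. The error O(1 + |xi|^2) is
  not small against R - |xi|^4 near the edge |xi|^4 = R. Hence the well is lowered to height (1 -
  \<delta>) R, inside which the error, of order sqrt R, is absorbed by \<delta> R; \<delta> tends to
  0 at the end. Transforms are split into cosine and sine parts to stay in a real Hilbert
  space.\<close>

definition pd :: "'a::euclidean_space \<Rightarrow> ('a \<Rightarrow> real) \<Rightarrow> 'a \<Rightarrow> real" where
  "pd i f x = frechet_derivative f (at x) i"

lemma pd_eqI: "(f has_derivative f') (at x) \<Longrightarrow> pd i f x = f' i"
  unfolding pd_def by (metis frechet_derivative_at)

lemma has_derivative_pd:
  "f differentiable at x \<Longrightarrow> (f has_derivative (\<lambda>i. pd i f x)) (at x)"
  unfolding pd_def by (metis frechet_derivative_works)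

lemma pd_const [simp]: "pd i (\<lambda>x. c) x = 0"
  by (rule pd_eqI[of _ "\<lambda>_. 0"]) simp

lemma pd_inner: "pd i (\<lambda>x. inner x a) x = inner i a"
  by (rule pd_eqI[of _ "\<lambda>y. inner y a"]) (auto intro!: derivative_eq_intros)

lemma pd_add:
  assumes "f differentiable at x" "g differentiable at x"
  shows "pd i (\<lambda>x. f x + g x) x = pd i f x + pd i g x"
  by (rule pd_eqI) (intro has_derivative_add has_derivative_pd assms)

lemma pd_mult:
  assumes "f differentiable at x" "g differentiable at x"
  shows "pd i (\<lambda>x. f x * g x) x = f x * pd i g x + pd i f x * g x"
  by (rule pd_eqI[of _ "\<lambda>i. f x * pd i g x + pd i f x * g x"])
     (intro has_derivative_mult has_derivative_pd assms)

lemma pd_compose: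
  assumes "f differentiable at x" "(h has_real_derivative d) (at (f x))"
  shows "pd i (\<lambda>x. h (f x)) x = d * pd i f x"
    and "(\<lambda>x. h (f x)) differentiable at x"
proof -
  have *: "((\<lambda>x. h (f x)) has_derivative (\<lambda>i. d * pd i f x)) (at x)"
    using has_derivative_compose[OF has_derivative_pd[OF assms(1)]] assms(2)
    unfolding has_field_derivative_def by blast
  show "pd i (\<lambda>x. h (f x)) x = d * pd i f x"
    by (rule pd_eqI[OF *])
  show "(\<lambda>x. h (f x)) differentiable at x"
    using * by (auto simp: differentiable_def)
qed

lemma smooth_fun_iff:
  "smooth_fun f \<longleftrightarrow> (\<forall>x. f differentiable at x) \<and> (\<forall>i\<in>Basis. smooth_fun (pd i f))"
proof -
  have "continuous_on UNIV f" if "\<forall>x. f differentiable at x"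
    using that by (auto intro!: continuous_at_imp_continuous_on differentiable_imp_continuous_within)
  then show ?thesis
    by (subst smooth_fun.simps) (auto simp: differentiable_on_def pd_def[abs_def])
qed

text \<open>Continuity is demanded at every level of \<open>smooth_fun\<close>; it follows from
  differentiability, so an invariant \<open>X\<close> only has to consist of differentiable
  functions and be stable under \<open>pd\<close>.\<close>

lemma smooth_fun_coinduct:
  assumes "X f" "\<And>f x. X f \<Longrightarrow> f differentiable at x"
    "\<And>f i. X f \<Longrightarrow> i \<in> Basis \<Longrightarrow> X (pd i f)"
  shows "smooth_fun f"
  using assms(1)
proof (coinduct rule: smooth_fun.coinduct)
  case (smooth_fun f)
  then show ?case
    using assms(2,3)
    by (auto intro!: continuous_at_imp_continuous_on differentiable_imp_continuous_within
        simp: differentiable_on_def pd_def[abs_def])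
qed

lemma smooth_fun_differentiable: "smooth_fun f \<Longrightarrow> f differentiable at x"
  by (subst (asm) smooth_fun_iff) blast

lemma smooth_fun_pd: "smooth_fun f \<Longrightarrow> i \<in> Basis \<Longrightarrow> smooth_fun (pd i f)"
  by (subst (asm) smooth_fun_iff) blast

lemma smooth_fun_continuous: "smooth_fun f \<Longrightarrow> continuous_on UNIV f"
  by (auto elim: smooth_fun.cases)

lemma smooth_fun_const: "smooth_fun (\<lambda>x. c)"
  by (rule smooth_fun_coinduct[of "\<lambda>f. \<exists>c. f = (\<lambda>x. c)"]) (auto intro!: ext)

lemma smooth_fun_inner: "smooth_fun (\<lambda>x. inner x a)"
proof (subst smooth_fun_iff, intro conjI ballI allI)
  have "pd i (\<lambda>x. inner x a) = (\<lambda>x. inner i a)" for i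
    by (rule ext) (rule pd_inner)
  then show "smooth_fun (pd i (\<lambda>x. inner x a))" for i
    by (simp add: smooth_fun_const)
qed simp

text \<open>Smooth functions are closed under sums, products and composition with smooth functions of
  one variable. A direct coinduction does not go through, since derivatives of products are sums
  of products; the closure under all three operations is itself closed under differentiation.\<close>

inductive smooth_alg :: "('a::euclidean_space \<Rightarrow> real) \<Rightarrow> bool" where
  base: "smooth_fun f \<Longrightarrow> smooth_alg f"
| add: "smooth_alg f \<Longrightarrow> smooth_alg g \<Longrightarrow> smooth_alg (\<lambda>x. f x + g x)"
| mult: "smooth_alg f \<Longrightarrow> smooth_alg g \<Longrightarrow> smooth_alg (\<lambda>x. f x * g x)"
| compose: "smooth_alg f \<Longrightarrow> (\<And>k t. (h k has_real_derivative h (Suc k) t) (at t)) \<Longrightarrow>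
    smooth_alg (\<lambda>x. h (0::nat) (f x))"

lemma smooth_alg_derivative:
  assumes "smooth_alg f"
  shows "(\<forall>x. f differentiable at x) \<and> (\<forall>i\<in>Basis. smooth_alg (pd i f))"
  using assms
proof induction
  case (base f)
  then show ?case by (auto intro: smooth_alg.base smooth_fun_differentiable smooth_fun_pd)
next
  case (add f g)
  then have "pd i (\<lambda>x. f x + g x) = (\<lambda>x. pd i f x + pd i g x)" for i
    by (auto intro!: ext pd_add)
  then show ?case using add by (auto intro: smooth_alg.add)
next
  case (mult f g)
  then have "pd i (\<lambda>x. f x * g x) = (\<lambda>x. f x * pd i g x + pd i f x * g x)" for i
    by (auto intro!: ext pd_mult)
  then show ?case using mult by (auto intro!: smooth_alg.add smooth_alg.mult)
next
  case (compose f h)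
  then have f: "f differentiable at x" for x by blast
  have "pd i (\<lambda>x. h 0 (f x)) = (\<lambda>x. h (Suc 0) (f x) * pd i f x)" for i
    by (rule ext) (rule pd_compose(1)[OF f compose(2)])
  \<comment> \<open>The shifted chain \<open>\<lambda>k. h (Suc k)\<close> is again a chain of
    successive derivatives, so the outer derivative is one more application of
    \<open>compose\<close>.\<close>
  moreover have "smooth_alg (\<lambda>x. h (Suc 0) (f x))"
    using smooth_alg.compose[of f "\<lambda>k. h (Suc k)"] compose by simp
  moreover have "(\<lambda>x. h 0 (f x)) differentiable at x" for x
    by (rule pd_compose(2)[OF f compose(2)])
  ultimately show ?case using compose.IH by (simp add: smooth_alg.mult)
qed

lemma smooth_alg_smooth: "smooth_alg f \<Longrightarrow> smooth_fun f"
  by (rule smooth_fun_coinduct[of smooth_alg]) (auto dest: smooth_alg_derivative)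

lemma smooth_fun_add: "smooth_fun f \<Longrightarrow> smooth_fun g \<Longrightarrow> smooth_fun (\<lambda>x. f x + g x)"
  by (rule smooth_alg_smooth[OF smooth_alg.add[OF smooth_alg.base smooth_alg.base]])

lemma smooth_fun_mult: "smooth_fun f \<Longrightarrow> smooth_fun g \<Longrightarrow> smooth_fun (\<lambda>x. f x * g x)"
  by (rule smooth_alg_smooth[OF smooth_alg.mult[OF smooth_alg.base smooth_alg.base]])

text \<open>The sequence \<open>h\<close> lists the outer function and all its derivatives, a
  concrete certificate of smoothness in one variable.\<close>

lemma smooth_fun_compose:
  assumes "smooth_fun f" "\<And>k t. (h k has_real_derivative h (Suc k) t) (at t)"
  shows "smooth_fun (\<lambda>x. h (0::nat) (f x))"
  by (rule smooth_alg_smooth[OF smooth_alg.compose[where h = h, OF smooth_alg.base[OF assms(1)] assms(2)]])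

lemma smooth_fun_diff: "smooth_fun f \<Longrightarrow> smooth_fun g \<Longrightarrow> smooth_fun (\<lambda>x. f x - g x)"
  using smooth_fun_add[of f "\<lambda>x. -1 * g x"] smooth_fun_mult[OF smooth_fun_const, of g "-1"] by simp

lemma smooth_fun_sum: "finite A \<Longrightarrow> (\<And>a. a \<in> A \<Longrightarrow> smooth_fun (f a)) \<Longrightarrow> smooth_fun (\<lambda>x. \<Sum>a\<in>A. f a x)"
  by (induction A rule: finite_induct) (auto intro: smooth_fun_const smooth_fun_add)

lemma smooth_fun_exp:
  assumes "smooth_fun f" shows "smooth_fun (\<lambda>x. exp (f x))"
  by (rule smooth_fun_compose[OF assms, of "\<lambda>k. exp"]) (rule DERIV_exp)

text \<open>Differentiation shifts the sine by a quarter period, so sin (t + k pi / 2) is one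
  formula for the whole chain of derivatives.\<close>

lemma smooth_fun_sin:
  assumes "smooth_fun f" shows "smooth_fun (\<lambda>x. sin (f x))"
proof -
  have "((\<lambda>t. sin (t + real k * (pi / 2))) has_real_derivative sin (t + real (Suc k) * (pi / 2))) (at t)" for k t
  proof -
    have "((\<lambda>t. sin (t + real k * (pi / 2))) has_real_derivative cos (t + real k * (pi / 2))) (at t)"
      by (auto intro!: derivative_eq_intros)
    moreover have "sin (t + real (Suc k) * (pi / 2)) = sin ((t + real k * (pi / 2)) + pi / 2)"
      by (simp add: algebra_simps add_divide_distrib)
    ultimately show ?thesis by (simp add: sin_add)
  qed
  from smooth_fun_compose[where h = "\<lambda>k t. sin (t + real k * (pi / 2))", OF assms this]
  show ?thesis by simp
qed

lemma smooth_fun_cos: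
  assumes "smooth_fun f" shows "smooth_fun (\<lambda>x. cos (f x))"
proof -
  have "smooth_fun (\<lambda>x. sin (f x + pi / 2))"
    by (intro smooth_fun_sin smooth_fun_add assms smooth_fun_const)
  then show ?thesis by (simp add: sin_add)
qed

section \<open>Bump functions\<close>

text \<open>\<open>flat k\<close> is the \<open>k\<close>-th derivative of \<open>t \<mapsto> exp (- 1 / t)\<close> for \<open>t > 0\<close>, extended by zero.\<close>

fun flat_poly :: "nat \<Rightarrow> real poly" where
  "flat_poly 0 = 1"
| "flat_poly (Suc k) = [:0, 0, 1:] * (flat_poly k - pderiv (flat_poly k))"

definition flat :: "nat \<Rightarrow> real \<Rightarrow> real" where
  "flat k t = (if t > 0 then poly (flat_poly k) (1 / t) * exp (- (1 / t)) else 0)"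

lemma poly_exp_minus_tendsto_0: "((\<lambda>s. poly p s * exp (- s)) \<longlongrightarrow> (0::real)) at_top"
proof -
  have "((\<lambda>s. \<Sum>i\<le>degree p. coeff p i * (s ^ i / exp s)) \<longlongrightarrow> (\<Sum>i\<le>degree p. coeff p i * 0)) at_top"
    by (intro tendsto_sum tendsto_mult tendsto_const tendsto_power_div_exp_0)
  then show ?thesis
    by (simp add: poly_altdef sum_divide_distrib exp_minus field_simps)
qed

text \<open>Away from 0 this is the product rule. At 0 the difference quotient
  \<open>flat k s / s\<close> is, for s > 0, a polynomial in 1 / s times exp (- 1 / s), which the
  exponential forces to 0.\<close>

lemma flat_has_derivative: "(flat k has_real_derivative flat (Suc k) t) (at t)"
proof -
  consider "t < 0" | "t = 0" | "t > 0" by linarith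
  then show ?thesis
  proof cases
    case 1
    have "((\<lambda>_. 0) has_real_derivative 0) (at t)" by simp
    moreover have "\<forall>\<^sub>F s in nhds t. flat k s = 0"
      using eventually_nhds_in_open[of "{..<0}" t] 1 by (auto elim!: eventually_mono simp: flat_def)
    ultimately show ?thesis
      using 1 DERIV_cong_ev[OF refl, of "flat k" "\<lambda>_. 0" t "flat (Suc k) t" 0] by (simp add: flat_def)
  next
    case 3
    have inv: "((\<lambda>t. 1 / t) has_real_derivative - (1 / t * (1 / t))) (at t)"
      using 3 by (auto intro!: derivative_eq_intros simp: field_simps)
    \<comment> \<open>The derivative of 1 / t is - (1 / t)^2, so the product rule gives (1 / t)^2 (p
      - p')(1 / t) exp (- 1 / t). This is the recursion of \<open>flat_poly\<close>, whose factor
      \<open>[:0, 0, 1:]\<close> is X^2.\<close>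
    have "((\<lambda>t. poly (flat_poly k) (1 / t) * exp (- (1 / t))) has_real_derivative flat (Suc k) t) (at t)"
      using DERIV_mult[OF DERIV_chain2[OF poly_DERIV inv] DERIV_chain2[OF DERIV_exp DERIV_minus[OF inv]], of "flat_poly k"] 3
      by (simp add: flat_def algebra_simps)
    moreover have "\<forall>\<^sub>F s in nhds t. flat k s = poly (flat_poly k) (1 / s) * exp (- (1 / s))"
      using eventually_nhds_in_open[of "{0<..}" t] 3 by (auto elim!: eventually_mono simp: flat_def)
    ultimately show ?thesis
      by (subst DERIV_cong_ev[OF refl _ refl])
  next
    case 2
    have "((\<lambda>s. flat k s / s) \<longlongrightarrow> 0) (at 0)"
    proof (rule filterlim_split_at)
      have "\<forall>\<^sub>F s in at_left 0. flat k s / s = 0"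
        by (auto simp: eventually_at_filter flat_def)
      then show "((\<lambda>s. flat k s / s) \<longlongrightarrow> 0) (at_left 0)"
        by (rule tendsto_eventually)
      have "((\<lambda>t. poly ([:0, 1:] * flat_poly k) (inverse t) * exp (- inverse t)) \<longlongrightarrow> 0) (at_right 0)"
        by (rule filterlim_compose[OF poly_exp_minus_tendsto_0 filterlim_inverse_at_top_right])
      moreover have "\<forall>\<^sub>F s in at_right 0. poly ([:0, 1:] * flat_poly k) (inverse s) * exp (- inverse s) = flat k s / s"
        by (auto simp: eventually_at_filter flat_def field_simps)
      ultimately show "((\<lambda>s. flat k s / s) \<longlongrightarrow> 0) (at_right 0)"
        by (rule Lim_transform_eventually)
    qed
    then show ?thesis
      using 2 by (simp add: has_field_derivative_iff flat_def)
  qed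
qed

lemma smooth_fun_flat: "smooth_fun f \<Longrightarrow> smooth_fun (\<lambda>x. flat 0 (f x))"
  by (rule smooth_fun_compose[where h = flat]) (auto intro: flat_has_derivative)

lemma flat_0_pos_iff: "flat 0 t > 0 \<longleftrightarrow> t > 0" and flat_0_nonneg: "flat 0 t \<ge> 0"
  by (auto simp: flat_def)

text \<open>For r > 0 it is positive exactly on \<open>ball a r\<close>. The squared distance is
  spelled out in coordinates so that smoothness follows from closure under sums and products of the
  functions \<open>inner x i\<close>.\<close>

definition bump :: "'a::euclidean_space \<Rightarrow> real \<Rightarrow> 'a \<Rightarrow> real" where
  "bump a r x = flat 0 (r\<^sup>2 - (\<Sum>i\<in>Basis. (inner x i - inner a i) * (inner x i - inner a i)))"

lemma smooth_fun_bump: "smooth_fun (bump a r)"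
  unfolding bump_def[abs_def]
  by (intro smooth_fun_flat smooth_fun_diff smooth_fun_const smooth_fun_sum smooth_fun_mult smooth_fun_inner finite_Basis)

lemma bump_pos_iff:
  assumes "r > 0" shows "bump a r x > 0 \<longleftrightarrow> x \<in> ball a r"
proof -
  have "(\<Sum>i\<in>Basis. (inner x i - inner a i) * (inner x i - inner a i)) = (dist a x)\<^sup>2"
    unfolding dist_commute[of a x] unfolding dist_norm power2_norm_eq_inner
    by (subst euclidean_inner) (simp only: inner_diff_left)
  then show ?thesis
    using assms by (auto simp: bump_def flat_0_pos_iff power2_less_imp_less intro: power_strict_mono)
qed

lemma bump_nonneg: "bump a r x \<ge> 0"
  by (simp add: bump_def flat_0_nonneg)

text \<open>Lindelof gives countably many balls covering \<Omega> whose closed versions lie in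
  \<Omega>. With \<open>s n\<close> the sum of the first n bumps, 1 - exp (- n s_n) lies in [0, 1],
  vanishes off finitely many of the closed balls, and tends to 1 wherever some bump is positive,
  since n s_n tends to infinity there.\<close>

lemma Cc_inf_cutoffs:
  fixes \<Omega> :: "'a::euclidean_space set"
  assumes "open \<Omega>" "\<Omega> \<noteq> {}"
  obtains \<phi> :: "nat \<Rightarrow> 'a \<Rightarrow> real" where "\<And>n. \<phi> n \<in> Cc_inf \<Omega>" "\<And>n x. 0 \<le> \<phi> n x" "\<And>n x. \<phi> n x \<le> 1"
    "\<And>x. x \<in> \<Omega> \<Longrightarrow> (\<lambda>n. \<phi> n x) \<longlonglongrightarrow> 1"
proof -
  define F where "F = {ball x r | x r. r > 0 \<and> cball x r \<subseteq> \<Omega>}"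
  have UF: "\<Union>F = \<Omega>"
  proof
    show "\<Union>F \<subseteq> \<Omega>" by (force simp: F_def)
    show "\<Omega> \<subseteq> \<Union>F"
    proof
      fix x assume "x \<in> \<Omega>"
      then obtain e where "e > 0" "cball x e \<subseteq> \<Omega>"
        using assms(1) open_contains_cball by blast
      then have "ball x e \<in> F" "x \<in> ball x e" by (auto simp: F_def)
      then show "x \<in> \<Union>F" by blast
    qed
  qed
  obtain F' where F': "F' \<subseteq> F" "countable F'" "\<Union>F' = \<Union>F"
    by (rule Lindelof[of F]) (auto simp: F_def)
  have ne: "F' \<noteq> {}" using F'(3) UF assms(2) by auto
  have "\<forall>n. \<exists>a r. from_nat_into F' n = ball a r \<and> r > 0 \<and> cball a r \<subseteq> \<Omega>"
  proof
    fix n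
    have "from_nat_into F' n \<in> F" using from_nat_into[OF ne] F'(1) by blast
    then show "\<exists>a r. from_nat_into F' n = ball a r \<and> r > 0 \<and> cball a r \<subseteq> \<Omega>"
      unfolding F_def by blast
  qed
  then obtain a r where ar: "\<And>n. from_nat_into F' n = ball (a n) (r n)" "\<And>n. r n > 0"
    "\<And>n. cball (a n) (r n) \<subseteq> \<Omega>" by metis
  have cover: "\<exists>n. x \<in> ball (a n) (r n)" if "x \<in> \<Omega>" for x
  proof -
    have "x \<in> \<Union>F'" using that unfolding F'(3) UF .
    then obtain B where B: "B \<in> F'" "x \<in> B" by (rule UnionE)
    have "ball (a (to_nat_on F' B)) (r (to_nat_on F' B)) = B"
      using from_nat_into_to_nat_on[OF F'(2) B(1)] ar(1)[of "to_nat_on F' B"] by simp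
    with B(2) show ?thesis by blast
  qed
  define s where "s n x = (\<Sum>k<n. bump (a k) (r k) x)" for n x
  define \<phi> where "\<phi> n x = 1 - exp (- real n * s n x)" for n x
  have s0: "s n x \<ge> 0" for n x by (simp add: s_def sum_nonneg bump_nonneg)
  have sm: "smooth_fun (\<phi> n)" for n
    unfolding \<phi>_def[abs_def] s_def
    by (intro smooth_fun_diff smooth_fun_exp smooth_fun_mult smooth_fun_const smooth_fun_sum smooth_fun_bump) auto
  define K where "K n = (\<Union>k<n. cball (a k) (r k))" for n
  have K: "compact (K n)" "K n \<subseteq> \<Omega>" for n
    using ar(3) by (auto simp: K_def)
  have supp: "{x. \<phi> n x \<noteq> 0} \<subseteq> K n" for n
  proof
    fix x assume "x \<in> {x. \<phi> n x \<noteq> 0}"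
    then have "s n x \<noteq> 0" by (auto simp: \<phi>_def)
    then obtain k where k: "k < n" "bump (a k) (r k) x \<noteq> 0"
      unfolding s_def by (meson lessThan_iff sum.not_neutral_contains_not_neutral)
    then have "bump (a k) (r k) x > 0"
      using bump_nonneg[of "a k" "r k" x] by linarith
    then show "x \<in> K n"
      using k(1) bump_pos_iff[OF ar(2)] by (force simp: K_def)
  qed
  have cl: "closure {x. \<phi> n x \<noteq> 0} \<subseteq> K n" for n
    by (rule closure_minimal[OF supp]) (simp add: K compact_imp_closed)
  have mem: "\<phi> n \<in> Cc_inf \<Omega>" for n
    unfolding Cc_inf_def
    using sm cl[of n] K(2)[of n] compact_Int_closed[OF K(1)[of n], of "closure {x. \<phi> n x \<noteq> 0}"]
    by (auto simp: Int_absorb1)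
  have lim: "(\<lambda>n. \<phi> n x) \<longlonglongrightarrow> 1" if "x \<in> \<Omega>" for x
  proof -
    from cover[OF that] obtain k where "x \<in> ball (a k) (r k)" by blast
    then have b: "bump (a k) (r k) x > 0" using bump_pos_iff[OF ar(2)] by blast
    have "filterlim (\<lambda>n. real n * s n x) at_top sequentially"
    proof (rule filterlim_at_top_mono)
      show "filterlim (\<lambda>n. real n * bump (a k) (r k) x) at_top sequentially"
        using filterlim_tendsto_pos_mult_at_top[OF tendsto_const b filterlim_real_sequentially]
        by (simp add: mult.commute)
      have "bump (a k) (r k) x \<le> s n x" if "n > k" for n
        unfolding s_def using that bump_nonneg by (intro member_le_sum) auto
      then show "\<forall>\<^sub>F n in sequentially. real n * bump (a k) (r k) x \<le> real n * s n x"
        by (intro eventually_sequentiallyI[of "Suc k"]) (auto intro: mult_left_mono)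
    qed
    then have "(\<lambda>n. exp (- (real n * s n x))) \<longlonglongrightarrow> 0"
      by (intro filterlim_compose[OF exp_at_bot] filterlim_uminus_at_top[THEN iffD1]) auto
    from tendsto_diff[OF tendsto_const this, of 1] show ?thesis
      by (simp add: \<phi>_def)
  qed
  show ?thesis
    by (rule that[OF mem _ _ lim]) (auto simp: \<phi>_def s0)
qed

section \<open>Test functions and integration by parts\<close>

lemma Cc_inf_smooth: "f \<in> Cc_inf \<Omega> \<Longrightarrow> smooth_fun f"
  by (simp add: Cc_inf_def)

lemma Cc_infI:
  assumes "smooth_fun f" "compact K" "K \<subseteq> \<Omega>" "\<forall>x. x \<notin> K \<longrightarrow> f x = 0"
  shows "f \<in> Cc_inf \<Omega>"
proof -
  have "closure {x. f x \<noteq> 0} \<subseteq> K"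
    using assms(2,4) by (intro closure_minimal compact_imp_closed) auto
  moreover from this have "compact (closure {x. f x \<noteq> 0})"
    using compact_Int_closed[OF assms(2), of "closure {x. f x \<noteq> 0}"] by (simp add: Int_absorb1)
  ultimately show ?thesis using assms(1,3) by (auto simp: Cc_inf_def)
qed

lemma Cc_infE:
  assumes "f \<in> Cc_inf \<Omega>"
  obtains K where "compact K" "K \<subseteq> \<Omega>" "\<forall>x. x \<notin> K \<longrightarrow> f x = 0"
proof (rule that)
  show "compact (closure {x. f x \<noteq> 0})" "closure {x. f x \<noteq> 0} \<subseteq> \<Omega>"
    using assms by (auto simp: Cc_inf_def)
  show "\<forall>x. x \<notin> closure {x. f x \<noteq> 0} \<longrightarrow> f x = 0"
    using closure_subset[of "{x. f x \<noteq> 0}"] by blast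
qed

lemma Cc_inf_zero: "f \<in> Cc_inf \<Omega> \<Longrightarrow> x \<notin> \<Omega> \<Longrightarrow> f x = 0"
  by (auto elim: Cc_infE)

lemma Cc_inf_mult:
  assumes "f \<in> Cc_inf \<Omega>" "smooth_fun g"
  shows "(\<lambda>x. f x * g x) \<in> Cc_inf \<Omega>"
proof -
  obtain K where "compact K" "K \<subseteq> \<Omega>" "\<forall>x. x \<notin> K \<longrightarrow> f x = 0"
    using assms(1) by (rule Cc_infE)
  then show ?thesis
    using assms by (intro Cc_infI[of _ K]) (auto intro: smooth_fun_mult Cc_inf_smooth)
qed

lemma Cc_inf_scale: "f \<in> Cc_inf \<Omega> \<Longrightarrow> (\<lambda>x. c * f x) \<in> Cc_inf \<Omega>"
  using Cc_inf_mult[OF _ smooth_fun_const[of c]] by (simp add: mult.commute)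

lemma Cc_inf_add:
  assumes "f \<in> Cc_inf \<Omega>" "g \<in> Cc_inf \<Omega>"
  shows "(\<lambda>x. f x + g x) \<in> Cc_inf \<Omega>"
proof -
  obtain K where K: "compact K" "K \<subseteq> \<Omega>" "\<forall>x. x \<notin> K \<longrightarrow> f x = 0"
    using assms(1) by (rule Cc_infE)
  obtain L where L: "compact L" "L \<subseteq> \<Omega>" "\<forall>x. x \<notin> L \<longrightarrow> g x = 0"
    using assms(2) by (rule Cc_infE)
  show ?thesis
    by (rule Cc_infI[of _ "K \<union> L"])
       (use K L assms in \<open>auto intro: smooth_fun_add Cc_inf_smooth\<close>)
qed

lemma Cc_inf_pd:
  assumes "f \<in> Cc_inf \<Omega>" "i \<in> Basis"
  shows "pd i f \<in> Cc_inf \<Omega>"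
proof -
  obtain K where K: "compact K" "K \<subseteq> \<Omega>" "\<forall>x. x \<notin> K \<longrightarrow> f x = 0"
    using assms(1) by (rule Cc_infE)
  have "pd i f x = 0" if x: "x \<notin> K" for x
  proof (rule pd_eqI[of _ "\<lambda>_. 0"])
    have "open (- K)" using K(1) by (simp add: compact_imp_closed open_Compl)
    show "(f has_derivative (\<lambda>_. 0)) (at x)"
      by (rule has_derivative_transform_within_open[of "\<lambda>_. 0", OF _ \<open>open (- K)\<close>])
         (use x K(3) in auto)
  qed
  then show ?thesis
    using K assms by (intro Cc_infI[of _ K]) (auto intro: smooth_fun_pd Cc_inf_smooth)
qed

lemma laplacian_pd: "laplacian f x = (\<Sum>i\<in>Basis. pd i (pd i f) x)"
  by (simp add: laplacian_def pd_def[abs_def])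

lemma Cc_inf_sum:
  "finite A \<Longrightarrow> A \<noteq> {} \<Longrightarrow> (\<And>a. a \<in> A \<Longrightarrow> f a \<in> Cc_inf \<Omega>) \<Longrightarrow> (\<lambda>x. \<Sum>a\<in>A. f a x) \<in> Cc_inf \<Omega>"
  by (induction A rule: finite_ne_induct) (auto intro: Cc_inf_add)

lemma Cc_inf_laplacian: "f \<in> Cc_inf \<Omega> \<Longrightarrow> laplacian f \<in> Cc_inf \<Omega>"
  unfolding laplacian_pd[abs_def] by (intro Cc_inf_sum Cc_inf_pd) auto

lemma Cc_inf_continuous: "f \<in> Cc_inf \<Omega> \<Longrightarrow> continuous_on UNIV f"
  by (intro smooth_fun_continuous Cc_inf_smooth)

lemma Cc_inf_measurable [measurable_dest]: "f \<in> Cc_inf \<Omega> \<Longrightarrow> f \<in> borel_measurable borel"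
  by (intro borel_measurable_continuous_onI Cc_inf_continuous)

lemma Cc_inf_bounded:
  assumes "f \<in> Cc_inf \<Omega>"
  obtains B R where "0 < R" "0 < B" "\<forall>x. \<bar>f x\<bar> \<le> B" "\<forall>x. norm x > R \<longrightarrow> f x = 0"
proof -
  obtain K where K: "compact K" "K \<subseteq> \<Omega>" "\<forall>x. x \<notin> K \<longrightarrow> f x = 0"
    using assms(1) by (rule Cc_infE)
  obtain R where R: "R > 0" "\<And>x. x \<in> K \<Longrightarrow> norm x \<le> R"
    using compact_imp_bounded[OF K(1)] by (auto simp: bounded_pos)
  have "compact (f ` K)"
    by (intro compact_continuous_image K continuous_on_subset[OF Cc_inf_continuous[OF assms]]) auto
  then have "bounded (f ` K)" by (rule compact_imp_bounded)
  then obtain B where B: "B > 0" "\<And>x. x \<in> K \<Longrightarrow> \<bar>f x\<bar> \<le> B"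
    by (auto simp: bounded_pos)
  have "\<bar>f x\<bar> \<le> B" for x using B K(3) by (cases "x \<in> K") auto
  moreover have "f x = 0" if "norm x > R" for x using R(2)[of x] K(3) that by fastforce
  ultimately show ?thesis using that R(1) B(1) by blast
qed

lemma Cc_inf_integrable:
  assumes "f \<in> Cc_inf \<Omega>" shows "integrable lborel f"
proof -
  obtain K where K: "compact K" "K \<subseteq> \<Omega>" "\<forall>x. x \<notin> K \<longrightarrow> f x = 0"
    using assms(1) by (rule Cc_infE)
  have "integrable lborel (\<lambda>x. indicator K x *\<^sub>R f x)"
    by (intro borel_integrable_compact K continuous_on_subset[OF Cc_inf_continuous[OF assms]]) auto
  also have "(\<lambda>x. indicator K x *\<^sub>R f x) = f"
    using K(3) by (auto simp: fun_eq_iff indicator_def)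
  finally show ?thesis .
qed

text \<open>The definitions integrate over \<open>lebesgue\<close>, while translation, scaling and
  Fubini are used over \<open>lborel\<close>; Borel integrands may move between the two.\<close>

lemma integral_lebesgue_borel:
  fixes f :: "'a::euclidean_space \<Rightarrow> real"
  assumes "f \<in> borel_measurable borel"
  shows "integral\<^sup>L lebesgue f = integral\<^sup>L lborel f" "integrable lebesgue f = integrable lborel f"
  using assms by (simp_all add: integral_completion integrable_completion)

lemma Cc_inf_L2fun:
  assumes "f \<in> Cc_inf \<Omega>" shows "L2fun f"
proof -
  have [measurable]: "f \<in> borel_measurable borel" by (rule Cc_inf_measurable[OF assms])
  have "integrable lborel (\<lambda>x. f x * f x)"
    by (rule Cc_inf_integrable[OF Cc_inf_mult[OF assms Cc_inf_smooth[OF assms]]])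
  then have "integrable lebesgue (\<lambda>x. (f x)\<^sup>2)"
    by (subst integral_lebesgue_borel) (auto simp: power2_eq_square)
  then show ?thesis
    by (simp add: L2fun_def measurable_completion)
qed

lemma integral_translation:
  fixes f :: "'a::euclidean_space \<Rightarrow> real"
  assumes [measurable]: "f \<in> borel_measurable borel"
  shows "(\<integral>x. f (c + x) \<partial>lborel) = integral\<^sup>L lborel f"
    and "integrable lborel f \<Longrightarrow> integrable lborel (\<lambda>x. f (c + x))"
proof -
  have "integral\<^sup>L lborel f = integral\<^sup>L (distr lborel borel ((+) c)) f"
    by (simp add: lborel_distr_plus)
  also have "\<dots> = (\<integral>x. f (c + x) \<partial>lborel)"
    by (rule integral_distr) auto
  finally show "(\<integral>x. f (c + x) \<partial>lborel) = integral\<^sup>L lborel f" ..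
  assume "integrable lborel f"
  then have "integrable (distr lborel borel ((+) c)) f"
    by (simp add: lborel_distr_plus)
  then show "integrable lborel (\<lambda>x. f (c + x))"
    by (subst (asm) integrable_distr_eq) auto
qed

lemma DERIV_along_line:
  assumes "smooth_fun f"
  shows "((\<lambda>t. f (t *\<^sub>R i + x)) has_real_derivative pd i f (t *\<^sub>R i + x)) (at t)"
proof -
  have d: "f differentiable at (t *\<^sub>R i + x)" by (rule smooth_fun_differentiable[OF assms])
  have "((\<lambda>t. f (t *\<^sub>R i + x)) has_derivative (\<lambda>h. pd (h *\<^sub>R i) f (t *\<^sub>R i + x))) (at t)"
    by (rule has_derivative_compose[where f = "\<lambda>t. t *\<^sub>R i + x" and g = f, OF _ has_derivative_pd[OF d]])
       (auto intro!: derivative_eq_intros)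
  moreover have "pd (h *\<^sub>R i) f y = pd i f y * h" if "f differentiable at y" for h y
    using linear_scale[OF has_derivative_linear[OF has_derivative_pd[OF that]], of h i] by simp
  ultimately show ?thesis
    using d by (simp add: has_field_derivative_def)
qed

text \<open>The difference quotients have integral 0 by translation invariance, the mean value
  theorem bounds them by a bound for \<open>pd i f\<close>, and dominated convergence passes to the
  derivative.\<close>

lemma integral_pd_zero:
  fixes \<Omega> :: "'a::euclidean_space set"
  assumes f: "f \<in> Cc_inf \<Omega>" and i: "i \<in> Basis"
  shows "integral\<^sup>L lborel (pd i f) = 0"
proof -
  note g = Cc_inf_pd[OF f i]
  have [measurable]: "f \<in> borel_measurable borel" "pd i f \<in> borel_measurable borel"
    using Cc_inf_measurable f g by auto
  obtain B R where BR: "0 < R" "0 < B" "\<forall>x. \<bar>pd i f x\<bar> \<le> B" "\<forall>x. norm x > R \<longrightarrow> pd i f x = 0"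
    using g by (rule Cc_inf_bounded)
  obtain B' R' where BR': "0 < R'" "0 < B'" "\<forall>x. \<bar>f x\<bar> \<le> B'" "\<forall>x. norm x > R' \<longrightarrow> f x = 0"
    using f by (rule Cc_inf_bounded)
  define t where "t n = 1 / real (Suc n)" for n
  \<comment> \<open>Steps of length at most 1 keep all shifted supports inside one ball, of radius
    \<open>R' + 1\<close>.\<close>
  have t: "0 < t n" "t n \<le> 1" for n by (auto simp: t_def)
  define q where "q n x = (f (t n *\<^sub>R i + x) - f x) / t n" for n x
  have q0: "integral\<^sup>L lborel (q n) = 0" for n
  proof -
    have "integral\<^sup>L lborel (q n) = ((\<integral>x. f (t n *\<^sub>R i + x) \<partial>lborel) - integral\<^sup>L lborel f) / t n"
      unfolding q_def using Cc_inf_integrable[OF f]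
      by (subst integral_divide_zero) (simp add: integral_translation)
    then show ?thesis by (simp add: integral_translation)
  qed
  have "(\<lambda>n. integral\<^sup>L lborel (q n)) \<longlonglongrightarrow> integral\<^sup>L lborel (pd i f)"
  proof (rule integral_dominated_convergence[where w = "\<lambda>x. B * indicator (cball 0 (R' + 1)) x"])
    show "AE x in lborel. (\<lambda>n. q n x) \<longlonglongrightarrow> pd i f x"
    proof (rule AE_I2)
      fix x
      have "((\<lambda>h. (f ((0 + h) *\<^sub>R i + x) - f (0 *\<^sub>R i + x)) / h) \<longlongrightarrow> pd i f (0 *\<^sub>R i + x)) (at 0)"
        using DERIV_along_line[OF Cc_inf_smooth[OF f], of i x 0] by (simp only: DERIV_def)
      moreover have "filterlim t (at 0) sequentially"
        unfolding t_def filterlim_at using LIMSEQ_Suc[OF lim_1_over_n] by auto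
      ultimately show "(\<lambda>n. q n x) \<longlonglongrightarrow> pd i f x"
        by (auto simp: q_def dest: filterlim_compose)
    qed
    show "AE x in lborel. norm (q n x) \<le> B * indicator (cball 0 (R' + 1)) x" for n
    proof (rule AE_I2)
      fix x
      have "\<exists>z>0. z < t n \<and> f (t n *\<^sub>R i + x) - f (0 *\<^sub>R i + x) = (t n - 0) * pd i f (z *\<^sub>R i + x)"
        by (rule MVT2[OF t(1) DERIV_along_line[OF Cc_inf_smooth[OF f]]])
      then obtain z where "q n x = pd i f (z *\<^sub>R i + x)"
        using t(1)[of n] by (auto simp: q_def)
      then have "\<bar>q n x\<bar> \<le> B" using BR(3) by simp
      moreover have "q n x = 0" if "norm x > R' + 1"
      proof -
        have "norm x \<le> norm (t n *\<^sub>R i + x) + norm (t n *\<^sub>R i)"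
          using norm_triangle_ineq4[of "t n *\<^sub>R i + x" "t n *\<^sub>R i"] by simp
        moreover have "norm (t n *\<^sub>R i) \<le> 1" using t[of n] i by simp
        ultimately have "norm (t n *\<^sub>R i + x) > R'" using that by linarith
        then show ?thesis using BR'(4) that by (simp add: q_def)
      qed
      ultimately show "norm (q n x) \<le> B * indicator (cball 0 (R' + 1)) x"
        by (cases "norm x > R' + 1") (auto simp: indicator_def)
    qed
    show "integrable lborel (\<lambda>x. B * indicator (cball (0::'a) (R' + 1)) x)"
      by (intro integrable_mult_right integrable_real_indicator) (use emeasure_bounded_finite[OF bounded_cball, of "0::'a" "R' + 1"] in auto)
    show "q n \<in> borel_measurable lborel" for n
      unfolding q_def[abs_def] by measurable
  qed simp
  then show ?thesis by (simp add: q0 LIMSEQ_const_iff)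
qed

text \<open>Stated for arbitrary smooth \<open>g\<close> because the second factor will be a cosine
  or sine wave.\<close>

lemma integration_by_parts:
  assumes f: "f \<in> Cc_inf \<Omega>" and g: "smooth_fun g" and i: "i \<in> Basis"
  shows "(\<integral>x. pd i f x * g x \<partial>lborel) = - (\<integral>x. f x * pd i g x \<partial>lborel)"
proof -
  have "pd i (\<lambda>x. f x * g x) = (\<lambda>x. f x * pd i g x + pd i f x * g x)"
    by (intro ext pd_mult smooth_fun_differentiable g Cc_inf_smooth[OF f])
  then have "(\<integral>x. f x * pd i g x + pd i f x * g x \<partial>lborel) = 0"
    using integral_pd_zero[OF Cc_inf_mult[OF f g] i] by simp
  moreover have "integrable lborel (\<lambda>x. f x * pd i g x)" "integrable lborel (\<lambda>x. pd i f x * g x)"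
    by (rule Cc_inf_integrable[of _ \<Omega>]; intro Cc_inf_mult Cc_inf_pd f i g smooth_fun_pd)+
  ultimately show ?thesis by simp
qed

lemma smooth_fun_cos_inner: "smooth_fun (\<lambda>x. cos (inner x a))"
  and smooth_fun_sin_inner: "smooth_fun (\<lambda>x. sin (inner x a))"
  by (intro smooth_fun_cos smooth_fun_sin smooth_fun_inner)+

lemma pd_cos_inner: "pd i (\<lambda>x. cos (inner x a)) = (\<lambda>x. - inner i a * sin (inner x a))"
  and pd_sin_inner: "pd i (\<lambda>x. sin (inner x a)) = (\<lambda>x. inner i a * cos (inner x a))"
  by (auto intro!: ext pd_eqI derivative_eq_intros)

lemma green_identity:
  assumes f: "f \<in> Cc_inf \<Omega>" and g: "smooth_fun g"
  shows "(\<integral>x. laplacian f x * g x \<partial>lborel) = (\<integral>x. f x * laplacian g x \<partial>lborel)"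
proof -
  have int: "integrable lborel (\<lambda>x. pd i (pd i f) x * g x)" "integrable lborel (\<lambda>x. f x * pd i (pd i g) x)"
    if i: "i \<in> Basis" for i
    by (rule Cc_inf_integrable[of _ \<Omega>]; intro Cc_inf_mult Cc_inf_pd smooth_fun_pd f g i)+
  have "(\<integral>x. laplacian f x * g x \<partial>lborel) = (\<Sum>i\<in>Basis. \<integral>x. pd i (pd i f) x * g x \<partial>lborel)"
    unfolding laplacian_pd sum_distrib_right by (rule Bochner_Integration.integral_sum) (rule int)
  also have "\<dots> = (\<Sum>i\<in>Basis. \<integral>x. f x * pd i (pd i g) x \<partial>lborel)"
    by (intro sum.cong refl)
       (simp add: integration_by_parts[OF Cc_inf_pd[OF f] g] integration_by_parts[OF f smooth_fun_pd[OF g]])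
  also have "\<dots> = (\<integral>x. f x * laplacian g x \<partial>lborel)"
    unfolding laplacian_pd sum_distrib_left
    by (rule Bochner_Integration.integral_sum[symmetric]) (rule int)
  finally show ?thesis .
qed

lemma laplacian_cos_inner: "laplacian (\<lambda>x. cos (inner x \<xi>)) x = - (norm \<xi>)\<^sup>2 * cos (inner x \<xi>)"
  and laplacian_sin_inner: "laplacian (\<lambda>x. sin (inner x \<xi>)) x = - (norm \<xi>)\<^sup>2 * sin (inner x \<xi>)"
proof -
  have n: "(norm \<xi>)\<^sup>2 = (\<Sum>i\<in>Basis. (inner i \<xi>)\<^sup>2)"
    unfolding power2_norm_eq_inner by (subst euclidean_inner) (simp add: power2_eq_square inner_commute)
  have "pd i (\<lambda>x. - inner i \<xi> * sin (inner x \<xi>)) x = - (inner i \<xi>)\<^sup>2 * cos (inner x \<xi>)"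
    "pd i (\<lambda>x. inner i \<xi> * cos (inner x \<xi>)) x = - (inner i \<xi>)\<^sup>2 * sin (inner x \<xi>)" for i
    by (rule pd_eqI[THEN trans], (auto intro!: derivative_eq_intros)[1], simp add: power2_eq_square)+
  then show "laplacian (\<lambda>x. cos (inner x \<xi>)) x = - (norm \<xi>)\<^sup>2 * cos (inner x \<xi>)"
    "laplacian (\<lambda>x. sin (inner x \<xi>)) x = - (norm \<xi>)\<^sup>2 * sin (inner x \<xi>)"
    by (simp_all add: laplacian_pd pd_cos_inner pd_sin_inner n sum_distrib_right sum_negf)
qed

lemma laplacian_mult:
  assumes f: "smooth_fun f" and g: "smooth_fun g"
  shows "laplacian (\<lambda>x. f x * g x) x =
    f x * laplacian g x + 2 * (\<Sum>i\<in>Basis. pd i f x * pd i g x) + laplacian f x * g x"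
proof -
  have "pd i (pd i (\<lambda>x. f x * g x)) x = f x * pd i (pd i g) x + 2 * (pd i f x * pd i g x) + pd i (pd i f) x * g x"
    if i: "i \<in> Basis" for i
  proof -
    note d = smooth_fun_differentiable
    have fi: "smooth_fun (pd i f)" and gi: "smooth_fun (pd i g)"
      using f g i by (auto intro: smooth_fun_pd)
    have 1: "pd i (\<lambda>x. f x * g x) = (\<lambda>x. f x * pd i g x + pd i f x * g x)"
      by (intro ext pd_mult d f g)
    show ?thesis
      unfolding 1
      by (simp add: pd_add[OF d d] pd_mult[OF d d] smooth_fun_mult f g fi gi)
  qed
  then show ?thesis
    by (simp add: laplacian_pd sum.distrib sum_distrib_left sum_distrib_right)
qed

section \<open>The Hilbert space of square integrable functions\<close>

lemma L2funD [dest]: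
  assumes "L2fun f"
  shows "f \<in> borel_measurable lebesgue" "integrable lebesgue (\<lambda>x. (f x)\<^sup>2)"
  using assms by (auto simp: L2fun_def)

lemma L2fun_integrable_mult:
  assumes "L2fun f" "L2fun g"
  shows "integrable lebesgue (\<lambda>x. f x * g x)"
proof (rule Bochner_Integration.integrable_bound)
  show "integrable lebesgue (\<lambda>x. (f x)\<^sup>2 + (g x)\<^sup>2)"
    using assms by (auto simp: L2fun_def)
  show "(\<lambda>x. f x * g x) \<in> borel_measurable lebesgue"
    using assms by (auto simp: L2fun_def)
  have "\<bar>a * b\<bar> \<le> a\<^sup>2 + b\<^sup>2" for a b :: real
  proof -
    have "0 \<le> (\<bar>a\<bar> - \<bar>b\<bar>)\<^sup>2" by simp
    then have "2 * (\<bar>a\<bar> * \<bar>b\<bar>) \<le> a\<^sup>2 + b\<^sup>2" by (simp add: power2_diff)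
    moreover have "0 \<le> \<bar>a\<bar> * \<bar>b\<bar>" by simp
    ultimately show ?thesis unfolding abs_mult by linarith
  qed
  then show "AE x in lebesgue. norm (f x * g x) \<le> norm ((f x)\<^sup>2 + (g x)\<^sup>2)"
    by simp
qed

lemma L2fun_add:
  assumes "L2fun f" "L2fun g"
  shows "L2fun (\<lambda>x. f x + g x)"
  unfolding L2fun_def
proof
  show "(\<lambda>x. f x + g x) \<in> borel_measurable lebesgue"
    using assms by (auto simp: L2fun_def)
  have "integrable lebesgue (\<lambda>x. (f x)\<^sup>2 + (g x)\<^sup>2 + 2 * (f x * g x))"
    using assms L2fun_integrable_mult[OF assms] by (auto simp: L2fun_def)
  then show "integrable lebesgue (\<lambda>x. (f x + g x)\<^sup>2)"
    by (simp add: power2_sum algebra_simps)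
qed

lemma L2fun_scale: "L2fun f \<Longrightarrow> L2fun (\<lambda>x. c * f x)"
  by (auto simp: L2fun_def power_mult_distrib)

lemma L2fun_uminus: "L2fun f \<Longrightarrow> L2fun (\<lambda>x. - f x)"
  using L2fun_scale[of f "-1"] by simp

lemma L2fun_diff: "L2fun f \<Longrightarrow> L2fun g \<Longrightarrow> L2fun (\<lambda>x. f x - g x)"
  using L2fun_add[of f "\<lambda>x. - g x"] L2fun_uminus[of g] by simp

lemma L2fun_zero: "L2fun (\<lambda>x. 0)"
  by (simp add: L2fun_def)

lemma L2fun_bound:
  assumes "L2fun f" "g \<in> borel_measurable lebesgue" "\<And>x. \<bar>g x\<bar> \<le> \<bar>f x\<bar>"
  shows "L2fun g"
  unfolding L2fun_def
proof
  show "integrable lebesgue (\<lambda>x. (g x)\<^sup>2)"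
    by (rule Bochner_Integration.integrable_bound[of _ "\<lambda>x. (f x)\<^sup>2"])
       (use assms in \<open>auto simp: L2fun_def abs_le_square_iff\<close>)
qed fact

text \<open>A partial equivalence relation: requiring \<open>L2fun\<close> on both sides makes a
  function outside L^2 unrelated even to itself, so the quotient consists of square integrable
  classes only.\<close>

definition L2rel :: "('a::euclidean_space \<Rightarrow> real) \<Rightarrow> ('a \<Rightarrow> real) \<Rightarrow> bool" where
  "L2rel f g \<longleftrightarrow> L2fun f \<and> L2fun g \<and> (AE x in lebesgue. f x = g x)"

quotient_type (overloaded) 'a L2 = "'a::euclidean_space \<Rightarrow> real" / partial: L2rel
  morphisms rep_L2 L2_class
proof (rule part_equivpI)
  show "\<exists>f::'a \<Rightarrow> real. L2rel f f"
    using L2fun_zero by (auto simp: L2rel_def)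
  show "symp L2rel"
    by (auto simp: symp_def L2rel_def)
  show "transp L2rel"
    by (auto simp: transp_def L2rel_def elim: AE_mp)
qed

lemma L2_class_cases: obtains f where "x = L2_class f" "L2fun f"
proof -
  obtain f where "L2rel f f" "x = L2_class f"
    using Quotient_rep_reflp[OF Quotient_L2] Quotient_abs_rep[OF Quotient_L2] by metis
  then show ?thesis using that by (auto simp: L2rel_def)
qed

instantiation L2 :: (euclidean_space) real_inner
begin

lift_definition zero_L2 :: "'a L2" is "\<lambda>x. 0"
  by (simp add: L2rel_def L2fun_zero)

lift_definition plus_L2 :: "'a L2 \<Rightarrow> 'a L2 \<Rightarrow> 'a L2" is "\<lambda>f g x. f x + g x"
  by (auto simp: L2rel_def L2fun_add)

lift_definition minus_L2 :: "'a L2 \<Rightarrow> 'a L2 \<Rightarrow> 'a L2" is "\<lambda>f g x. f x - g x"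
  by (auto simp: L2rel_def L2fun_diff)

lift_definition uminus_L2 :: "'a L2 \<Rightarrow> 'a L2" is "\<lambda>f x. - f x"
  by (auto simp: L2rel_def L2fun_uminus)

lift_definition scaleR_L2 :: "real \<Rightarrow> 'a L2 \<Rightarrow> 'a L2" is "\<lambda>c f x. c * f x"
  by (auto simp: L2rel_def L2fun_scale)

lift_definition inner_L2 :: "'a L2 \<Rightarrow> 'a L2 \<Rightarrow> real" is "\<lambda>f g. \<integral>x. f x * g x \<partial>lebesgue"
  by (auto simp: L2rel_def L2fun_def intro!: integral_cong_AE)

definition norm_L2 :: "'a L2 \<Rightarrow> real" where "norm_L2 x = sqrt (inner x x)"
definition sgn_L2 :: "'a L2 \<Rightarrow> 'a L2" where "sgn_L2 x = scaleR (inverse (norm x)) x"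
definition dist_L2 :: "'a L2 \<Rightarrow> 'a L2 \<Rightarrow> real" where "dist_L2 x y = norm (x - y)"
definition uniformity_L2 :: "('a L2 \<times> 'a L2) filter" where
  "uniformity_L2 = (INF e\<in>{0 <..}. principal {(x, y). dist x y < e})"
definition open_L2 :: "'a L2 set \<Rightarrow> bool" where
  "open_L2 U \<longleftrightarrow> (\<forall>x\<in>U. eventually (\<lambda>(x', y). x' = x \<longrightarrow> y \<in> U) uniformity)"

instance
proof
  fix x y z :: "'a L2" and r s :: real
  show "x + y + z = x + (y + z)"
    by transfer (auto simp: L2rel_def L2fun_add add.assoc)
  show "x + y = y + x"
    by transfer (auto simp: L2rel_def L2fun_add add.commute)
  show "0 + x = x"
    by transfer (auto simp: L2rel_def)
  show "- x + x = 0"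
    by transfer (auto simp: L2rel_def L2fun_zero)
  show "x - y = x + - y"
    by transfer (auto simp: L2rel_def L2fun_diff)
  show "r *\<^sub>R (x + y) = r *\<^sub>R x + r *\<^sub>R y"
    by transfer (auto simp: L2rel_def L2fun_add L2fun_scale distrib_left intro!: L2fun_add L2fun_scale)
  show "(r + s) *\<^sub>R x = r *\<^sub>R x + s *\<^sub>R x"
    by transfer (auto simp: L2rel_def distrib_right intro!: L2fun_add L2fun_scale)
  show "r *\<^sub>R s *\<^sub>R x = (r * s) *\<^sub>R x"
    by transfer (auto simp: L2rel_def mult.assoc intro!: L2fun_add L2fun_scale)
  show "1 *\<^sub>R x = x"
    by transfer (auto simp: L2rel_def)
  show "dist x y = norm (x - y)" by (simp add: dist_L2_def)
  show "sgn x = scaleR (inverse (norm x)) x" by (simp add: sgn_L2_def)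
  show "(uniformity :: ('a L2 \<times> 'a L2) filter) = (INF e\<in>{0 <..}. principal {(x, y). dist x y < e})"
    by (simp add: uniformity_L2_def)
  show "open U \<longleftrightarrow> (\<forall>x\<in>U. eventually (\<lambda>(x', y). x' = x \<longrightarrow> y \<in> U) uniformity)" for U :: "'a L2 set"
    by (simp add: open_L2_def)
  show "inner x y = inner y x"
    by transfer (simp add: mult.commute)
  show "inner (x + y) z = inner x z + inner y z"
    by transfer (simp add: L2rel_def distrib_right L2fun_integrable_mult)
  show "inner (r *\<^sub>R x) y = r * inner x y"
    by transfer (simp add: L2rel_def mult.assoc)
  show "0 \<le> inner x x"
    by transfer simp
  show "inner x x = 0 \<longleftrightarrow> x = 0"
  proof (transfer, goal_cases)
    case (1 f)
    then have f: "L2fun f" by (simp add: L2rel_def)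
    have "(\<integral>x. f x * f x \<partial>lebesgue) = 0 \<longleftrightarrow> (AE x in lebesgue. f x * f x = 0)"
      by (rule integral_nonneg_eq_0_iff_AE) (use L2fun_integrable_mult[OF f f] in auto)
    then show ?case using f by (simp add: L2rel_def L2fun_zero)
  qed
  show "norm x = sqrt (inner x x)" by (simp add: norm_L2_def)
qed

end

lemma L2_class_zero: "L2_class (\<lambda>x. 0) = 0"
  by (simp add: zero_L2.abs_eq)

lemma L2_class_add: "L2fun f \<Longrightarrow> L2fun g \<Longrightarrow> L2_class f + L2_class g = L2_class (\<lambda>x. f x + g x)"
  by (intro plus_L2.abs_eq) (simp_all add: L2rel_def)

lemma L2_class_diff: "L2fun f \<Longrightarrow> L2fun g \<Longrightarrow> L2_class f - L2_class g = L2_class (\<lambda>x. f x - g x)"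
  by (intro minus_L2.abs_eq) (simp_all add: L2rel_def)

lemma L2_class_scale: "L2fun f \<Longrightarrow> c *\<^sub>R L2_class f = L2_class (\<lambda>x. c * f x)"
  by (intro scaleR_L2.abs_eq) (simp_all add: L2rel_def)

lemma inner_L2_class: "L2fun f \<Longrightarrow> L2fun g \<Longrightarrow> inner (L2_class f) (L2_class g) = (\<integral>x. f x * g x \<partial>lebesgue)"
  by (intro inner_L2.abs_eq) (simp_all add: L2rel_def)

lemma norm_L2_class_sq: "L2fun f \<Longrightarrow> (norm (L2_class f))\<^sup>2 = (\<integral>x. (f x)\<^sup>2 \<partial>lebesgue)"
  by (simp add: power2_norm_eq_inner inner_L2_class) (simp add: power2_eq_square)

lemma dist_L2_class_sq: "L2fun f \<Longrightarrow> L2fun g \<Longrightarrow>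
    (dist (L2_class f) (L2_class g))\<^sup>2 = (\<integral>x. (f x - g x)\<^sup>2 \<partial>lebesgue)"
  by (simp add: dist_norm L2_class_diff norm_L2_class_sq L2fun_diff)

lemma tendsto_L2_class_iff:
  assumes "\<And>n. L2fun (f n)" "L2fun g"
  shows "(\<lambda>n. L2_class (f n)) \<longlonglongrightarrow> L2_class g \<longleftrightarrow> (\<lambda>n. \<integral>x. (f n x - g x)\<^sup>2 \<partial>lebesgue) \<longlonglongrightarrow> 0"
proof -
  have "(\<lambda>n. L2_class (f n)) \<longlonglongrightarrow> L2_class g \<longleftrightarrow> (\<lambda>n. dist (L2_class (f n)) (L2_class g)) \<longlonglongrightarrow> 0"
    by (rule tendsto_dist_iff)
  also have "\<dots> \<longleftrightarrow> (\<lambda>n. (dist (L2_class (f n)) (L2_class g))\<^sup>2) \<longlonglongrightarrow> 0"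
    using tendsto_power[of _ 0 sequentially 2] tendsto_real_sqrt[of "\<lambda>n. (dist (L2_class (f n)) (L2_class g))\<^sup>2" 0 sequentially]
    by fastforce
  finally show ?thesis by (simp add: dist_L2_class_sq assms)
qed

text \<open>Every summand is at most the total C, so consecutive differences are at most sqrt C
  times 2^(-n/2) and are summable against a geometric series. The weight 2^n provides this decay;
  the lemma is the pointwise half of Riesz--Fischer.\<close>

lemma summable_imp_converges:
  fixes f :: "nat \<Rightarrow> real"
  assumes "(\<Sum>n. ennreal (2 ^ n * (f (Suc n) - f n)\<^sup>2)) < \<infinity>"
  shows "convergent f"
proof -
  define c where "c n = 2 ^ n * (f (Suc n) - f n)\<^sup>2" for n
  have c0: "0 \<le> c n" for n by (simp add: c_def)
  have "(\<Sum>n. ennreal (c n)) \<noteq> top"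
    using assms unfolding c_def by auto
  then have sc: "summable c"
    by (rule summable_suminf_not_top[OF c0])
  define C where "C = suminf c"
  have cC: "c n \<le> C" for n
    using sum_le_suminf[OF sc, of "{n}"] c0 by (simp add: C_def)
  have "\<bar>f (Suc n) - f n\<bar> \<le> sqrt C * (1 / sqrt 2) ^ n" for n
  proof -
    have "(f (Suc n) - f n)\<^sup>2 \<le> C * (1/2)^n"
      using cC[of n] by (simp add: c_def field_simps)
    then have "sqrt ((f (Suc n) - f n)\<^sup>2) \<le> sqrt (C * (1/2)^n)"
      by (rule real_sqrt_le_mono)
    then show ?thesis
      unfolding real_sqrt_abs unfolding real_sqrt_mult real_sqrt_power real_sqrt_divide by simp
  qed
  then have b: "norm (f (Suc n) - f n) \<le> sqrt C * (1 / sqrt 2) ^ n" for n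
    by simp
  have "summable (\<lambda>n. sqrt C * (1 / sqrt 2) ^ n)"
    by (intro summable_mult summable_geometric) simp
  then have "summable (\<lambda>n. f (Suc n) - f n)"
    by (rule summable_comparison_test') (rule b)
  then have "(\<lambda>n. \<Sum>i<n. f (Suc i) - f i) \<longlonglongrightarrow> suminf (\<lambda>n. f (Suc n) - f n)"
    by (rule summable_LIMSEQ)
  then have "(\<lambda>n. f n - f 0) \<longlonglongrightarrow> suminf (\<lambda>n. f (Suc n) - f n)"
    by (simp add: sum_lessThan_telescope)
  from tendsto_add[OF this tendsto_const[of "f 0"]] show ?thesis
    by (auto simp: convergent_def)
qed

lemma nn_integral_eq_norm_L2_class:
  "L2fun f \<Longrightarrow> (\<integral>\<^sup>+x. ennreal ((f x)\<^sup>2) \<partial>lebesgue) = ennreal ((norm (L2_class f))\<^sup>2)"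
  by (simp add: norm_L2_class_sq nn_integral_eq_integral L2fun_def)

text \<open>With increments of norm at most 2^(-n), the weighted sum of squared increments has
  integral at most the sum of 2^n 4^(-n), hence is finite almost everywhere and yields a pointwise
  limit. Fatou then bounds the L^2 distance from \<open>f m\<close> to that limit by 2^(-m).\<close>

lemma L2_class_fast_Cauchy_convergent:
  fixes f :: "nat \<Rightarrow> 'a::euclidean_space \<Rightarrow> real"
  assumes f: "\<And>n. L2fun (f n)"
    and C: "\<And>m n. m \<le> n \<Longrightarrow> dist (L2_class (f n)) (L2_class (f m)) \<le> (1/2) ^ m"
  shows "\<exists>g. L2fun g \<and> (\<lambda>n. L2_class (f n)) \<longlonglongrightarrow> L2_class g"
proof -
  have meas[measurable]: "f n \<in> borel_measurable lebesgue" for n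
    using f by (auto simp: L2fun_def)
  have "(\<integral>\<^sup>+x. (\<Sum>n. ennreal (2 ^ n * (f (Suc n) x - f n x)\<^sup>2)) \<partial>lebesgue)
      = (\<Sum>n. \<integral>\<^sup>+x. ennreal (2 ^ n * (f (Suc n) x - f n x)\<^sup>2) \<partial>lebesgue)"
    by (rule nn_integral_suminf) measurable
  also have "\<dots> \<le> (\<Sum>n. ennreal ((1/2)^n))"
  proof (rule suminf_le)
    fix n
    have "(\<integral>\<^sup>+x. ennreal (2 ^ n * (f (Suc n) x - f n x)\<^sup>2) \<partial>lebesgue)
        = ennreal (2^n) * (\<integral>\<^sup>+x. ennreal ((f (Suc n) x - f n x)\<^sup>2) \<partial>lebesgue)"
      by (subst nn_integral_cmult[symmetric]) (auto simp: ennreal_mult')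
    also have "\<dots> = ennreal (2^n * (dist (L2_class (f (Suc n))) (L2_class (f n)))\<^sup>2)"
      by (simp add: nn_integral_eq_norm_L2_class L2fun_diff f dist_norm L2_class_diff ennreal_mult')
    also have "\<dots> \<le> ennreal (2^n * ((1/2)^n)\<^sup>2)"
      by (intro ennreal_leI mult_left_mono power_mono C) auto
    also have "2^n * ((1/2)^n)\<^sup>2 = ((1/2)^n :: real)"
      by (simp add: power2_eq_square field_simps)
    finally show "(\<integral>\<^sup>+x. ennreal (2 ^ n * (f (Suc n) x - f n x)\<^sup>2) \<partial>lebesgue) \<le> ennreal ((1/2)^n)" .
  qed auto
  also have "\<dots> < \<infinity>"
  proof -
    have "(\<Sum>n. ennreal ((1/2)^n)) = ennreal (\<Sum>n. (1/2)^n)"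
      by (intro suminf_ennreal2) (auto intro!: summable_geometric)
    then show ?thesis by simp
  qed
  finally have fin: "(\<integral>\<^sup>+x. (\<Sum>n. ennreal (2 ^ n * (f (Suc n) x - f n x)\<^sup>2)) \<partial>lebesgue) < \<infinity>" .
  have "AE x in lebesgue. (\<Sum>n. ennreal (2 ^ n * (f (Suc n) x - f n x)\<^sup>2)) \<noteq> \<infinity>"
    by (rule nn_integral_PInf_AE) (use fin in auto)
  then have conv: "AE x in lebesgue. (\<lambda>n. f n x) \<longlonglongrightarrow> lim (\<lambda>n. f n x)"
    by eventually_elim
       (intro convergent_LIMSEQ_iff[THEN iffD1] summable_imp_converges, auto simp: less_top)
  \<comment> \<open>Where the sequence diverges \<open>lim\<close> is some default value; this
    happens only on a null set.\<close>
  define g where "g x = lim (\<lambda>n. f n x)" for x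
  have g[measurable]: "g \<in> borel_measurable lebesgue"
    unfolding g_def[abs_def] by measurable
  have Fat: "(\<integral>\<^sup>+x. ennreal ((f m x - g x)\<^sup>2) \<partial>lebesgue) \<le> ennreal (((1/2)^m)\<^sup>2)" for m
  proof -
    have "(\<integral>\<^sup>+x. ennreal ((f m x - g x)\<^sup>2) \<partial>lebesgue)
        \<le> (\<integral>\<^sup>+x. liminf (\<lambda>n. ennreal ((f n x - f m x)\<^sup>2)) \<partial>lebesgue)"
    proof (rule nn_integral_mono_AE)
      show "AE x in lebesgue. ennreal ((f m x - g x)\<^sup>2) \<le> liminf (\<lambda>n. ennreal ((f n x - f m x)\<^sup>2))"
        using conv
      proof eventually_elim
        case (elim x)
        have "(\<lambda>n. ennreal ((f n x - f m x)\<^sup>2)) \<longlonglongrightarrow> ennreal ((g x - f m x)\<^sup>2)"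
          unfolding g_def by (intro tendsto_intros elim tendsto_ennrealI)
        then show ?case
          by (subst lim_imp_Liminf) (auto simp: power2_commute)
      qed
    qed
    also have "\<dots> \<le> liminf (\<lambda>n. \<integral>\<^sup>+x. ennreal ((f n x - f m x)\<^sup>2) \<partial>lebesgue)"
      by (rule nn_integral_liminf) measurable
    also have "\<dots> \<le> ennreal (((1/2)^m)\<^sup>2)"
    proof (rule Liminf_le)
      have "(\<integral>\<^sup>+x. ennreal ((f n x - f m x)\<^sup>2) \<partial>lebesgue) \<le> ennreal (((1/2)^m)\<^sup>2)" if "m \<le> n" for n
        using C[OF that]
        by (simp add: nn_integral_eq_norm_L2_class L2fun_diff f dist_norm L2_class_diff[symmetric]
            ennreal_leI power_mono del: power_divide)
      then show "\<forall>\<^sub>F n in sequentially. (\<integral>\<^sup>+x. ennreal ((f n x - f m x)\<^sup>2) \<partial>lebesgue) \<le> ennreal (((1/2)^m)\<^sup>2)"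
        by (auto simp: eventually_sequentially simp del: power_divide)
    qed simp
    finally show ?thesis .
  qed
  have dL2: "L2fun (\<lambda>x. f m x - g x)" for m
    unfolding L2fun_def
    by (auto intro!: integrableI_nonneg order.strict_trans1[OF Fat])
  then have gL2: "L2fun g"
    using L2fun_diff[OF f[of 0] dL2[of 0]] by simp
  have "dist (L2_class (f m)) (L2_class g) \<le> (1/2)^m" for m
  proof -
    have "ennreal ((norm (L2_class (\<lambda>x. f m x - g x)))\<^sup>2) \<le> ennreal (((1/2)^m)\<^sup>2)"
      using Fat[of m] by (simp add: nn_integral_eq_norm_L2_class dL2)
    then have "(norm (L2_class (\<lambda>x. f m x - g x)))\<^sup>2 \<le> ((1/2)^m)\<^sup>2"
      by (subst (asm) ennreal_le_iff) auto
    then have "norm (L2_class (\<lambda>x. f m x - g x)) \<le> (1/2)^m"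
      by (rule power2_le_imp_le) auto
    then show ?thesis by (simp add: dist_norm L2_class_diff f gL2)
  qed
  then have "(\<lambda>m. dist (L2_class (f m)) (L2_class g)) \<longlonglongrightarrow> 0"
    by (intro tendsto_sandwich[OF _ _ tendsto_const LIMSEQ_power_zero[of "1/2::real"]]) auto
  then show ?thesis using gL2 by (auto simp: tendsto_dist_iff[of _ "L2_class g"])
qed

lemma Cauchy_fast_subseq:
  fixes X :: "nat \<Rightarrow> 'b::metric_space"
  assumes "Cauchy X"
  shows "\<exists>r::nat \<Rightarrow> nat. strict_mono r \<and> (\<forall>m n. m \<le> n \<longrightarrow> dist (X (r n)) (X (r m)) \<le> (1/2) ^ m)"
proof -
  have ex: "\<exists>M. \<forall>p\<ge>M. \<forall>q\<ge>M. dist (X p) (X q) < (1/2)^k" for k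
    using metric_CauchyD[OF assms, of "(1/2)^k"] by auto
  then obtain N where N: "\<And>k p q. p \<ge> N k \<Longrightarrow> q \<ge> N k \<Longrightarrow> dist (X p) (X q) < (1/2)^k"
    by metis
  \<comment> \<open>Partial sums of \<open>Suc (N i)\<close> are strictly increasing and at least
    \<open>N k\<close>.\<close>
  define r where "r k = (\<Sum>i\<le>k. Suc (N i))" for k
  have sm: "strict_mono r"
    by (intro strict_monoI_Suc) (simp add: r_def)
  have "N k \<le> r k" for k
    unfolding r_def by (cases k) auto
  moreover have "r k \<le> r l" if "k \<le> l" for k l
    using sm that by (simp add: strict_mono_leD)
  ultimately have "dist (X (r n)) (X (r m)) \<le> (1/2)^m" if "m \<le> n" for m n
    using N[of m "r n" "r m"] that by (meson less_imp_le order_trans)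
  with sm show ?thesis by blast
qed

instance L2 :: (euclidean_space) complete_space
proof
  fix X :: "nat \<Rightarrow> 'a L2"
  assume X: "Cauchy X"
  then obtain r where r: "strict_mono (r::nat \<Rightarrow> nat)"
    "\<And>m n. m \<le> n \<Longrightarrow> dist (X (r n)) (X (r m)) \<le> (1/2) ^ m"
    using Cauchy_fast_subseq by blast
  have "\<exists>f. X (r n) = L2_class f \<and> L2fun f" for n
    using L2_class_cases by metis
  then obtain f where f: "\<And>n. X (r n) = L2_class (f n)" "\<And>n. L2fun (f n)"
    by metis
  have "\<exists>g. L2fun g \<and> (\<lambda>n. L2_class (f n)) \<longlonglongrightarrow> L2_class g"
    by (rule L2_class_fast_Cauchy_convergent[OF f(2)]) (use r(2) in \<open>simp add: f(1)[symmetric]\<close>)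
  then obtain g where "(\<lambda>n. L2_class (f n)) \<longlonglongrightarrow> L2_class g" by blast
  then have "(X \<circ> r) \<longlonglongrightarrow> L2_class g"
    by (simp add: o_def f(1))
  then have "X \<longlonglongrightarrow> L2_class g"
    using X r(1) Cauchy_converges_subseq by blast
  then show "convergent X" by (auto simp: convergent_def)
qed

section \<open>Quadratic forms with compact embedding\<close>

definition orthonormal :: "'h::real_inner set \<Rightarrow> bool" where
  "orthonormal B \<longleftrightarrow> (\<forall>u\<in>B. \<forall>w\<in>B. inner u w = (if u = w then 1 else 0))"

text \<open>Weak eigenvectors of the operator associated with the quadratic form \<open>norm (snd g) ^ 2\<close>
  relative to \<open>norm (fst g) ^ 2\<close>, where \<open>g\<close> ranges over the graph \<open>G\<close>.\<close>
definition form_eigen :: "('h::real_inner \<times> 'h) set \<Rightarrow> real \<Rightarrow> 'h \<Rightarrow> bool" where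
  "form_eigen G \<kappa> u \<longleftrightarrow> (\<exists>v. (u, v) \<in> G \<and> (\<forall>p q. (p, q) \<in> G \<longrightarrow> inner v q = \<kappa> * inner u p))"

text \<open>Each eigen equation is tested with the other eigenpair; symmetry of the form gives
  \<kappa> <u, w> = \<mu> <u, w>.\<close>

lemma form_eigen_orthogonal:
  assumes "form_eigen G \<kappa> u" "form_eigen G \<mu> w" "\<kappa> \<noteq> \<mu>"
  shows "inner u w = 0"
proof -
  obtain v where v: "(u, v) \<in> G" "\<And>p q. (p, q) \<in> G \<Longrightarrow> inner v q = \<kappa> * inner u p"
    using assms(1) by (auto simp: form_eigen_def)
  obtain y where y: "(w, y) \<in> G" "\<And>p q. (p, q) \<in> G \<Longrightarrow> inner y q = \<mu> * inner w p"
    using assms(2) by (auto simp: form_eigen_def)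
  have "\<kappa> * inner u w = \<mu> * inner u w"
    using v(2)[OF y(1)] y(2)[OF v(1)] by (simp add: inner_commute)
  then show ?thesis using assms(3) by simp
qed

lemma orthonormal_sum_inner:
  assumes "finite B" "orthonormal B" "w \<in> B"
  shows "inner (\<Sum>x\<in>B. c x *\<^sub>R x) w = c w"
proof -
  have "inner (\<Sum>x\<in>B. c x *\<^sub>R x) w = (\<Sum>x\<in>B. c x * inner x w)"
    by (simp add: inner_sum_left)
  also have "\<dots> = (\<Sum>x\<in>B. if x = w then c x else 0)"
    using assms by (intro sum.cong) (auto simp: orthonormal_def)
  finally show ?thesis using assms by simp
qed

lemma orthonormal_sum_norm:
  assumes "finite B" "orthonormal B"
  shows "inner (\<Sum>x\<in>B. c x *\<^sub>R x) (\<Sum>x\<in>B. c x *\<^sub>R x) = (\<Sum>x\<in>B. (c x)\<^sup>2)"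
  by (subst inner_sum_right) (simp add: orthonormal_sum_inner[OF assms] power2_eq_square)

text \<open>First-order condition at a minimum. At t = - a / (b + 1) the quadratic equals - a^2 (b +
  2) up to a positive factor; b + 1 instead of b allows b = 0.\<close>

lemma linear_coefficient_zero:
  fixes a b :: real
  assumes "\<And>t. 0 \<le> 2 * t * a + t\<^sup>2 * b" "0 \<le> b"
  shows "a = 0"
proof -
  define s where "s = b + 1"
  have s: "s > 0" using assms(2) by (simp add: s_def)
  have "0 \<le> (2 * (- a / s) * a + (- a / s)\<^sup>2 * b) * s\<^sup>2"
    using assms(1)[of "- a / s"] by simp
  also have "\<dots> = - 2 * a\<^sup>2 * s + a\<^sup>2 * b"
    using s by (simp add: field_simps power2_eq_square)
  also have "\<dots> = - (a\<^sup>2 * (b + 2))"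
    by (simp add: s_def algebra_simps)
  finally have "a\<^sup>2 * (b + 2) \<le> 0" by simp
  then show ?thesis using assms(2) by (simp add: mult_le_0_iff)
qed

text \<open>A closed quadratic form presented by pairs: first entries range over the form domain,
  the norm of a pair is the graph norm, and \<open>compact_G\<close> is compactness of the embedding
  of the form domain.\<close>

locale compact_form =
  fixes G :: "('h::{real_inner,complete_space} \<times> 'h) set"
  assumes subspace_G: "subspace G"
    and closed_G: "closed G"
    and compact_G: "\<And>g M. (\<And>n::nat. g n \<in> G \<and> norm (g n) \<le> M) \<Longrightarrow>
      \<exists>r::nat \<Rightarrow> nat. strict_mono r \<and> convergent (\<lambda>n. fst (g (r n)))"
begin

text \<open>Subtracting the component along \<open>B\<close> in both entries splits both squared
  norms orthogonally, the second by the eigen equations. Pairings with pairs orthogonal to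
  \<open>B\<close> do not notice the subtraction; the last clause records this in order to extend a
  variational equation from the complement of \<open>B\<close> to all of \<open>G\<close>.\<close>

lemma deflate:
  assumes B: "finite B" "orthonormal B" "\<forall>u\<in>B. form_eigen G (l u) u"
    and fh: "(f, h) \<in> G"
  obtains f' h' where "(f', h') \<in> G" "\<forall>w\<in>B. inner f' w = 0"
    "(norm f)\<^sup>2 = (norm f')\<^sup>2 + (\<Sum>w\<in>B. (inner f w)\<^sup>2)"
    "(norm h)\<^sup>2 = (norm h')\<^sup>2 + (\<Sum>w\<in>B. l w * (inner f w)\<^sup>2)"
    "\<forall>u v. (u, v) \<in> G \<and> (\<forall>w\<in>B. inner u w = 0) \<longrightarrow>
       inner u f' = inner u f \<and> inner v h' = inner v h"
proof -
  have "\<forall>u\<in>B. \<exists>v. (u, v) \<in> G \<and> (\<forall>p q. (p, q) \<in> G \<longrightarrow> inner v q = l u * inner u p)"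
    using B(3) by (auto simp: form_eigen_def)
  then obtain V where V: "\<And>u. u \<in> B \<Longrightarrow> (u, V u) \<in> G"
    "\<And>u p q. u \<in> B \<Longrightarrow> (p, q) \<in> G \<Longrightarrow> inner (V u) q = l u * inner u p"
    by metis
  define a where "a = (\<Sum>w\<in>B. inner f w *\<^sub>R w)"
  define b where "b = (\<Sum>w\<in>B. inner f w *\<^sub>R V w)"
  have ab: "(a, b) \<in> G"
  proof -
    have "(\<Sum>w\<in>B. inner f w *\<^sub>R (w, V w)) \<in> G"
      by (intro subspace_sum subspace_scale subspace_G V)
    also have "(\<Sum>w\<in>B. inner f w *\<^sub>R (w, V w)) = (a, b)"
      by (simp add: a_def b_def sum_prod)
    finally show ?thesis .
  qed
  have mem: "(f - a, h - b) \<in> G"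
    using subspace_diff[OF subspace_G fh ab] by simp
  have orth: "\<forall>w\<in>B. inner (f - a) w = 0"
    using orthonormal_sum_inner[OF B(1,2), of _ "\<lambda>w. inner f w"]
    by (simp add: a_def inner_diff_left)
  have fa: "inner (f - a) a = 0"
    using orth by (subst (2) a_def) (simp add: inner_sum_right)
  have hb: "inner (h - b) b = 0"
  proof -
    have "inner b (h - b) = (\<Sum>w\<in>B. inner f w * (l w * inner w (f - a)))"
      by (subst (1) b_def) (simp add: inner_sum_left V(2)[OF _ mem])
    also have "\<dots> = 0"
      using orth by (simp add: inner_commute)
    finally show ?thesis by (simp add: inner_commute)
  qed
  have na: "inner a a = (\<Sum>w\<in>B. (inner f w)\<^sup>2)"
    unfolding a_def by (rule orthonormal_sum_norm[OF B(1,2)])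
  have nb: "inner b b = (\<Sum>w\<in>B. l w * (inner f w)\<^sup>2)"
  proof -
    have "inner b b = (\<Sum>w\<in>B. inner f w * inner (V w) b)"
      by (subst (1) b_def) (simp add: inner_sum_left)
    also have "\<dots> = (\<Sum>w\<in>B. inner f w * (l w * inner w a))"
      by (intro sum.cong refl) (simp add: V(2)[OF _ ab])
    also have "\<dots> = (\<Sum>w\<in>B. l w * (inner f w)\<^sup>2)"
    proof (intro sum.cong refl)
      fix w assume "w \<in> B"
      then have "inner w a = inner f w"
        unfolding a_def by (subst inner_commute) (rule orthonormal_sum_inner[OF B(1,2)])
      then show "inner f w * (l w * inner w a) = l w * (inner f w)\<^sup>2"
        by (simp add: power2_eq_square)
    qed
    finally show ?thesis .
  qed
  show ?thesis
  proof (rule that[OF mem orth])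
    have "(norm ((f - a) + a))\<^sup>2 = (norm (f - a))\<^sup>2 + inner a a"
      unfolding power2_norm_eq_inner using fa
      by (simp only: inner_add_left inner_add_right inner_commute[of a "f - a"])
    then show "(norm f)\<^sup>2 = (norm (f - a))\<^sup>2 + (\<Sum>w\<in>B. (inner f w)\<^sup>2)"
      by (simp add: na)
    have "(norm ((h - b) + b))\<^sup>2 = (norm (h - b))\<^sup>2 + inner b b"
      unfolding power2_norm_eq_inner using hb
      by (simp only: inner_add_left inner_add_right inner_commute[of b "h - b"])
    then show "(norm h)\<^sup>2 = (norm (h - b))\<^sup>2 + (\<Sum>w\<in>B. l w * (inner f w)\<^sup>2)"
      by (simp add: nb)
    show "\<forall>u v. (u, v) \<in> G \<and> (\<forall>w\<in>B. inner u w = 0) \<longrightarrow>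
        inner u (f - a) = inner u f \<and> inner v (h - b) = inner v h"
    proof (intro allI impI, elim conjE)
    fix u v assume uv: "(u, v) \<in> G" "\<forall>w\<in>B. inner u w = 0"
    have "inner u a = 0"
      using uv(2) by (simp add: a_def inner_sum_right)
    moreover have "inner b v = (\<Sum>w\<in>B. inner f w * (l w * inner w u))"
      by (simp add: b_def inner_sum_left V(2)[OF _ uv(1)])
    then have "inner v b = 0"
      using uv(2) by (simp add: inner_commute)
    ultimately show "inner u (f - a) = inner u f \<and> inner v (h - b) = inner v h"
      by (simp add: inner_diff_right)
    qed
  qed
qed

text \<open>By \<open>lt\<close> the Rayleigh quotient of (f, h) is below \<open>R\<close>, so its
  infimum over unit vectors orthogonal to \<open>B\<close> is below \<open>R\<close> too.
  Compactness makes the first entries of a minimising sequence converge strongly, and closedness of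
  \<open>G\<close> keeps the limit pair admissible.\<close>

lemma minimizer_eigen:
  assumes B: "finite B" "orthonormal B" "\<forall>u\<in>B. form_eigen G (l u) u"
    and fh: "(f, h) \<in> G" "\<forall>w\<in>B. inner f w = 0"
    and lt: "(norm h)\<^sup>2 < R * (norm f)\<^sup>2"
  obtains \<kappa> u where "\<kappa> < R" "form_eigen G \<kappa> u" "norm u = 1" "\<forall>w\<in>B. inner u w = 0"
proof -
  define K where "K = {g \<in> G. (\<forall>w\<in>B. inner (fst g) w = 0) \<and> norm (fst g) = 1}"
  define Q where "Q g = (norm (snd g))\<^sup>2" for g :: "'h \<times> 'h"
  define m where "m = Inf (Q ` K)"
  have f0: "norm f > 0" using lt by (cases "f = 0") auto
  define k where "k = (1 / norm f) *\<^sub>R (f, h)"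
  have kK: "k \<in> K"
    using fh f0 subspace_scale[OF subspace_G fh(1), of "1 / norm f"] by (auto simp: K_def k_def)
  have QR: "Q k < R"
    using lt f0 by (simp add: Q_def k_def power_divide field_simps)
  have bdd: "bdd_below (Q ` K)"
    by (intro bdd_belowI[of _ 0]) (auto simp: Q_def)
  have mQ: "m \<le> Q g" if "g \<in> K" for g
    unfolding m_def using that bdd by (intro cInf_lower) auto
  have mR: "m < R" using mQ[OF kK] QR by simp
  have m0: "0 \<le> m"
    unfolding m_def using kK by (intro cInf_greatest) (auto simp: Q_def)
  have H: "m * (norm p)\<^sup>2 \<le> (norm q)\<^sup>2" if "(p, q) \<in> G" "\<forall>w\<in>B. inner p w = 0" for p q
  proof (cases "p = 0")
    case False
    then have "(1 / norm p) *\<^sub>R (p, q) \<in> K"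
      using that subspace_scale[OF subspace_G that(1), of "1 / norm p"] by (auto simp: K_def)
    from mQ[OF this] show ?thesis
      using False by (simp add: Q_def power_divide field_simps)
  qed simp
  have "\<exists>g\<in>K. Q g < m + 1 / real (Suc n)" for n
    using cInf_lessD[of "Q ` K" "m + 1 / real (Suc n)"] kK by (auto simp: m_def)
  then obtain g where gK: "\<And>n. g n \<in> K" and gQ: "\<And>n. Q (g n) < m + 1 / real (Suc n)"
    by metis
  have "norm (g n) \<le> 1 + (m + 1)" for n
  proof -
    have "(norm (snd (g n)))\<^sup>2 \<le> m + 1"
      using gQ[of n] by (simp add: Q_def) (smt (verit) divide_le_eq_1 of_nat_0_le_iff)
    also have "\<dots> \<le> (m + 1)\<^sup>2"
      using m0 by (simp add: power2_eq_square algebra_simps)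
    finally have "norm (snd (g n)) \<le> m + 1"
      by (rule power2_le_imp_le) (use m0 in simp)
    moreover have "norm (fst (g n)) = 1"
      using gK[of n] by (simp add: K_def)
    ultimately show ?thesis
      using norm_Pair_le[of "fst (g n)" "snd (g n)"] by simp
  qed
  then obtain r :: "nat \<Rightarrow> nat" where r: "strict_mono r" "convergent (\<lambda>n. fst (g (r n)))"
    using compact_G[of g "1 + (m + 1)"] gK by (auto simp: K_def)
  then obtain u where u: "(\<lambda>n. fst (g (r n))) \<longlonglongrightarrow> u"
    by (auto simp: convergent_def)
  define a where "a n = g (r n)" for n
  have aK: "a n \<in> K" for n by (simp add: a_def gK)
  have aQ: "Q (a n) < m + 1 / real (Suc n)" for n
  proof -
    have "1 / real (Suc (r n)) \<le> 1 / real (Suc n)"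
      using seq_suble[OF r(1), of n] by (simp add: frac_le)
    then show ?thesis using gQ[of "r n"] by (simp add: a_def)
  qed
  have au: "(\<lambda>n. fst (a n)) \<longlonglongrightarrow> u" using u by (simp add: a_def)
  \<comment> \<open>The parallelogram law turns convergence of the first components, together with
    minimality, into the Cauchy property of the second components.\<close>
  have par: "(norm (snd (a i) - snd (a j)))\<^sup>2
      \<le> 2 / real (Suc i) + 2 / real (Suc j) + m * (norm (fst (a i) - fst (a j)))\<^sup>2" for i j
  proof -
    have ai: "a i \<in> G" "a j \<in> G" "norm (fst (a i)) = 1" "norm (fst (a j)) = 1"
      using aK by (auto simp: K_def)
    have "(fst (a i) + fst (a j), snd (a i) + snd (a j)) \<in> G"
      using subspace_add[OF subspace_G ai(1,2)] by (simp add: plus_prod_def)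
    then have 1: "m * (norm (fst (a i) + fst (a j)))\<^sup>2 \<le> (norm (snd (a i) + snd (a j)))\<^sup>2"
      by (rule H) (use aK in \<open>auto simp: K_def inner_add_left\<close>)
    have P: "(norm (x + y))\<^sup>2 + (norm (x - y))\<^sup>2 = 2 * (norm x)\<^sup>2 + 2 * (norm y)\<^sup>2" for x y :: 'h
      unfolding power2_norm_eq_inner
      by (simp add: inner_add_left inner_add_right inner_diff_left inner_diff_right)
    have 2: "(norm (fst (a i) + fst (a j)))\<^sup>2 = 4 - (norm (fst (a i) - fst (a j)))\<^sup>2"
      using P[of "fst (a i)" "fst (a j)"] ai(3,4) by simp
    have 3: "m * (norm (fst (a i) + fst (a j)))\<^sup>2 = 4 * m - m * (norm (fst (a i) - fst (a j)))\<^sup>2"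
      unfolding 2 by (simp add: algebra_simps)
    show ?thesis
      using P[of "snd (a i)" "snd (a j)"] 1 3 aQ[of i] aQ[of j] by (simp add: Q_def)
  qed
  have "Cauchy (\<lambda>n. snd (a n))"
  proof (rule CauchyI)
    fix e :: real assume e: "0 < e"
    \<comment> \<open>For large indices \<open>par\<close> gives less than 2 d + 2 d + d, which is
      below 8 d = e^2. The last d needs first entries within sqrt (d / (m + 1)), where m + 1 covers
      m = 0.\<close>
    define d where "d = e\<^sup>2 / 8"
    have d: "0 < d" using e by (simp add: d_def)
    have "Cauchy (\<lambda>n. fst (a n))" using au by (rule LIMSEQ_imp_Cauchy)
    moreover have "0 < sqrt (d / (m + 1))" using d m0 by simp
    ultimately obtain N1 where N1: "\<And>i j. i \<ge> N1 \<Longrightarrow> j \<ge> N1 \<Longrightarrow>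
        norm (fst (a i) - fst (a j)) < sqrt (d / (m + 1))"
      by (meson CauchyD)
    obtain N2 where N2: "1 / real (Suc N2) < d"
      using nat_approx_posE[OF d] by blast
    have "norm (snd (a i) - snd (a j)) < e" if "i \<ge> max N1 N2" "j \<ge> max N1 N2" for i j
    proof -
      have "1 / real (Suc i) \<le> 1 / real (Suc N2)" "1 / real (Suc j) \<le> 1 / real (Suc N2)"
        using that by (auto intro!: frac_le)
      then have s: "1 / real (Suc i) < d" "1 / real (Suc j) < d" using N2 by auto
      have "(norm (fst (a i) - fst (a j)))\<^sup>2 \<le> (sqrt (d / (m + 1)))\<^sup>2"
        using N1[of i j] that by (intro power_mono) auto
      then have "(norm (fst (a i) - fst (a j)))\<^sup>2 \<le> d / (m + 1)" using d m0 by simp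
      then have "m * (norm (fst (a i) - fst (a j)))\<^sup>2 \<le> m * (d / (m + 1))"
        using m0 by (rule mult_left_mono)
      also have "\<dots> \<le> d" using m0 d by (simp add: field_simps)
      finally have "(norm (snd (a i) - snd (a j)))\<^sup>2 < 8 * d"
        using par[of i j] s d by simp
      also have "8 * d = e\<^sup>2" by (simp add: d_def)
      finally show ?thesis by (rule power2_less_imp_less) (use e in simp)
    qed
    then show "\<exists>M. \<forall>i\<ge>M. \<forall>j\<ge>M. norm (snd (a i) - snd (a j)) < e" by blast
  qed
  then obtain v where av: "(\<lambda>n. snd (a n)) \<longlonglongrightarrow> v"
    using Cauchy_convergent by (auto simp: convergent_def)
  have "a \<longlonglongrightarrow> (u, v)"
    using tendsto_Pair[OF au av] by simp
  then have uv: "(u, v) \<in> G"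
    using closed_G aK unfolding closed_sequential_limits by (auto simp: K_def)
  have u_orth: "\<forall>w\<in>B. inner u w = 0"
  proof
    fix w assume that: "w \<in> B"
    have "(\<lambda>n. inner (fst (a n)) w) \<longlonglongrightarrow> inner u w" by (intro tendsto_intros au)
    moreover have "inner (fst (a n)) w = 0" for n using aK[of n] that by (auto simp: K_def)
    ultimately show "inner u w = 0" by (simp add: LIMSEQ_const_iff)
  qed
  have u1: "norm u = 1"
  proof -
    have "(\<lambda>n. norm (fst (a n))) \<longlonglongrightarrow> norm u" by (intro tendsto_intros au)
    moreover have "norm (fst (a n)) = 1" for n using aK[of n] by (auto simp: K_def)
    ultimately show ?thesis by (simp add: LIMSEQ_const_iff)
  qed
  have vm: "(norm v)\<^sup>2 = m"
  proof (rule antisym)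
    have "(\<lambda>n. m + 1 / real (Suc n)) \<longlonglongrightarrow> m + 0"
      by (intro tendsto_intros LIMSEQ_Suc[OF lim_1_over_n])
    moreover have "(\<lambda>n. Q (a n)) \<longlonglongrightarrow> (norm v)\<^sup>2"
      unfolding Q_def by (intro tendsto_intros av)
    ultimately show "(norm v)\<^sup>2 \<le> m"
      using aQ by (intro LIMSEQ_le[of _ _ _ m]) (auto intro: less_imp_le)
    show "m \<le> (norm v)\<^sup>2" using H[OF uv u_orth] u1 by simp
  qed
  \<comment> \<open>Minimality along u + t p yields a nonnegative quadratic in t whose constant term
    vanishes, as (norm v)^2 = m and u is a unit vector. Its linear coefficient must then be
    0.\<close>
  have var: "inner v q = m * inner u p" if pq: "(p, q) \<in> G" "\<forall>w\<in>B. inner p w = 0" for p q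
  proof -
    have "0 \<le> 2 * t * (inner v q - m * inner u p) + t\<^sup>2 * ((norm q)\<^sup>2 - m * (norm p)\<^sup>2)" for t
    proof -
      have "(u + t *\<^sub>R p, v + t *\<^sub>R q) \<in> G"
        using subspace_add[OF subspace_G uv subspace_scale[OF subspace_G pq(1), of t]] by simp
      then have "m * (norm (u + t *\<^sub>R p))\<^sup>2 \<le> (norm (v + t *\<^sub>R q))\<^sup>2"
        by (rule H) (use pq u_orth in \<open>auto simp: inner_add_left\<close>)
      moreover have E: "(norm (x + t *\<^sub>R y))\<^sup>2 = (norm x)\<^sup>2 + 2 * t * inner x y + t\<^sup>2 * (norm y)\<^sup>2" for x y :: 'h
        unfolding power2_norm_eq_inner
        by (simp add: inner_add_left inner_add_right inner_commute[of y x] power2_eq_square algebra_simps)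
      ultimately show ?thesis using vm u1 unfolding E by (simp add: algebra_simps)
    qed
    moreover have "0 \<le> (norm q)\<^sup>2 - m * (norm p)\<^sup>2" using H[OF pq] by simp
    ultimately have "inner v q - m * inner u p = 0" by (rule linear_coefficient_zero)
    then show ?thesis by simp
  qed
  have "form_eigen G m u"
    unfolding form_eigen_def
  proof (intro exI[of _ v] conjI allI impI uv)
    fix p q assume "(p, q) \<in> G"
    \<comment> \<open>The variation reached only pairs orthogonal to \<open>B\<close>;
      \<open>deflate\<close> removes the remaining part of (p, q) without changing either
      pairing.\<close>
    then obtain p' q' where pq': "(p', q') \<in> G" "\<forall>w\<in>B. inner p' w = 0"
      "(norm p)\<^sup>2 = (norm p')\<^sup>2 + (\<Sum>w\<in>B. (inner p w)\<^sup>2)"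
      "(norm q)\<^sup>2 = (norm q')\<^sup>2 + (\<Sum>w\<in>B. l w * (inner p w)\<^sup>2)"
      "\<forall>u v. (u, v) \<in> G \<and> (\<forall>w\<in>B. inner u w = 0) \<longrightarrow>
         inner u p' = inner u p \<and> inner v q' = inner v q"
      by (rule deflate[OF B])
    show "inner v q = m * inner u p"
      using var[OF pq'(1,2)] pq'(5) uv u_orth by simp
  qed
  then show ?thesis using that mR u1 u_orth by blast
qed

text \<open>Deflating (f, h) removes exactly the right-hand side, so the claim becomes R |f'|^2 <=
  |h'|^2 on the complement of \<open>B\<close>. With \<open>B\<close> of greatest cardinality, which
  exists thanks to the bound \<open>N\<close>, a violation would let \<open>minimizer_eigen\<close>
  produce a further unit eigenvector below \<open>R\<close>.\<close>

theorem spectral_bound: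
  assumes fin: "\<And>B l. finite B \<Longrightarrow> orthonormal B \<Longrightarrow> \<forall>u\<in>B. form_eigen G (l u) u \<and> l u < R \<Longrightarrow> card B \<le> N"
  obtains B l where "finite B" "orthonormal B" "\<forall>u\<in>B. form_eigen G (l u) u" "\<forall>u\<in>B. l u < R"
    "\<forall>f h. (f, h) \<in> G \<longrightarrow> R * (norm f)\<^sup>2 - (norm h)\<^sup>2 \<le> (\<Sum>u\<in>B. (R - l u) * (inner f u)\<^sup>2)"
proof -
  define P where "P k \<longleftrightarrow> (\<exists>B l. finite B \<and> orthonormal B \<and> (\<forall>u\<in>B. form_eigen G (l u) u \<and> l u < R) \<and> card B = k)" for k
  have "P 0" unfolding P_def by (rule exI[of _ "{}"]) (simp add: orthonormal_def)
  moreover have PN: "\<forall>k. P k \<longrightarrow> k \<le> N" unfolding P_def using fin by blast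
  ultimately have "P (Greatest P)" by (metis GreatestI_nat)
  then obtain B l where B: "finite B" "orthonormal B" "\<forall>u\<in>B. form_eigen G (l u) u"
    "\<forall>u\<in>B. l u < R" "card B = Greatest P"
    unfolding P_def by blast
  have "R * (norm f)\<^sup>2 - (norm h)\<^sup>2 \<le> (\<Sum>u\<in>B. (R - l u) * (inner f u)\<^sup>2)" if fh: "(f, h) \<in> G" for f h
  proof -
    from fh obtain f' h' where fh': "(f', h') \<in> G" "\<forall>w\<in>B. inner f' w = 0"
      "(norm f)\<^sup>2 = (norm f')\<^sup>2 + (\<Sum>w\<in>B. (inner f w)\<^sup>2)"
      "(norm h)\<^sup>2 = (norm h')\<^sup>2 + (\<Sum>w\<in>B. l w * (inner f w)\<^sup>2)"
      "\<forall>u v. (u, v) \<in> G \<and> (\<forall>w\<in>B. inner u w = 0) \<longrightarrow>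
         inner u f' = inner u f \<and> inner v h' = inner v h"
      by (rule deflate[OF B(1-3)])
    have "R * (norm f')\<^sup>2 \<le> (norm h')\<^sup>2"
    proof (rule ccontr)
      assume "\<not> R * (norm f')\<^sup>2 \<le> (norm h')\<^sup>2"
      then have "(norm h')\<^sup>2 < R * (norm f')\<^sup>2" by simp
      then obtain \<kappa> u where
        u: "\<kappa> < R" "form_eigen G \<kappa> u" "norm u = 1" "\<forall>w\<in>B. inner u w = 0"
        by (rule minimizer_eigen[OF B(1-3) fh'(1,2)])
      have uB: "u \<notin> B" using u(3,4) by (auto simp: norm_eq_1)
      have "P (Suc (card B))"
        unfolding P_def
      proof (intro exI conjI)
        show "orthonormal (insert u B)"
          using B(2) u(3,4) uB unfolding orthonormal_def norm_eq_1
          by (auto simp: inner_commute)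
        show "\<forall>x\<in>insert u B. form_eigen G ((l(u := \<kappa>)) x) x \<and> (l(u := \<kappa>)) x < R"
          using B(3,4) u(1,2) uB by auto
      qed (use B(1) uB in auto)
      then have "Suc (card B) \<le> Greatest P"
        by (rule Greatest_le_nat[where b = N]) (use PN in blast)
      then show False using B(5) by simp
    qed
    then show ?thesis
      unfolding fh'(3,4) by (simp add: algebra_simps sum_distrib_left sum_subtractf)
  qed
  then show ?thesis using that B by blast
qed

end

section \<open>The Plancherel theorem for test functions\<close>

definition gauss :: "'a::euclidean_space \<Rightarrow> real" where
  "gauss v = exp (- (norm v)\<^sup>2 / 2)"

lemma gauss_measurable [measurable]: "gauss \<in> borel_measurable borel"
  unfolding gauss_def[abs_def] by measurable

lemma gauss_0 [simp]: "gauss 0 = 1"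
  by (simp add: gauss_def)

lemma gauss_pos: "gauss v > 0"
  by (simp add: gauss_def)

text \<open>Lebesgue measure is the image of a product of one-dimensional ones, so integrals of
  tensor products factor; this reduces the Gaussian transform to dimension one.\<close>

lemma integrable_lborel_prod:
  fixes f :: "'a::euclidean_space \<Rightarrow> real \<Rightarrow> complex"
  assumes "\<And>b. b \<in> Basis \<Longrightarrow> integrable lborel (f b)"
  shows "integrable lborel (\<lambda>x::'a. \<Prod>b\<in>Basis. f b (inner x b))" (is ?int)
    and "(\<integral>x. (\<Prod>b\<in>Basis. f b (inner (x::'a) b)) \<partial>lborel) = (\<Prod>b\<in>Basis. integral\<^sup>L lborel (f b))" (is ?eq)
proof -
  interpret product_sigma_finite "\<lambda>_::'a. lborel :: real measure" ..
  have [measurable]: "f b \<in> borel_measurable borel" if "b \<in> Basis" for b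
    using borel_measurable_integrable[OF assms[OF that]] by simp
  let ?T = "\<lambda>g::'a \<Rightarrow> real. \<Sum>b\<in>Basis. g b *\<^sub>R b"
  have T: "?T \<in> (\<Pi>\<^sub>M b\<in>(Basis::'a set). lborel) \<rightarrow>\<^sub>M borel" by measurable
  have F: "(\<lambda>x::'a. \<Prod>b\<in>Basis. f b (inner x b)) \<in> borel_measurable borel"
    by measurable
  have eq: "(\<Prod>b\<in>Basis. f b (inner (?T g) b)) = (\<Prod>b\<in>Basis. f b (g b))" for g
    by (intro prod.cong) auto
  show ?int
    by (subst lborel_eq, subst integrable_distr_eq[OF T F], unfold eq)
       (intro product_integrable_prod assms finite_Basis)
  show ?eq
    by (subst lborel_eq, subst integral_distr[OF T F], unfold eq)
       (intro product_integral_prod assms finite_Basis)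
qed

text \<open>The characteristic function of the standard normal law, freed from its normalisation 1 /
  sqrt (2 pi).\<close>

lemma real_gauss_fourier:
  shows "integrable lborel (\<lambda>x::real. complex_of_real (exp (- x\<^sup>2 / 2)) * iexp (t * x))" (is ?int)
    and "(\<integral>x. complex_of_real (exp (- x\<^sup>2 / 2)) * iexp (t * x) \<partial>lborel) = complex_of_real (sqrt (2 * pi) * exp (- t\<^sup>2 / 2))" (is "?I = _")
proof -
  interpret D: real_distribution std_normal_distribution by (rule real_dist_normal_dist)
  have pos: "sqrt (2 * pi) > 0" by simp
  have eq: "std_normal_density x *\<^sub>R iexp (t * x)
      = complex_of_real (1 / sqrt (2 * pi)) * (complex_of_real (exp (- x\<^sup>2 / 2)) * iexp (t * x))" for x
    by (simp add: std_normal_density_def scaleR_conv_of_real)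
  have "integrable std_normal_distribution (\<lambda>x. iexp (t * x))"
    by (rule D.integrable_const_bound[of _ 1]) auto
  then have i: "integrable lborel (\<lambda>x. std_normal_density x *\<^sub>R iexp (t * x))"
    by (subst (asm) integrable_density) auto
  then show ?int
  proof -
    have "complex_of_real (sqrt (2 * pi)) * (complex_of_real (1 / sqrt (2 * pi)) * z) = z" for z
      using pos by (simp add: field_simps)
    then show ?thesis
      using integrable_mult_right[of "complex_of_real (sqrt (2 * pi))" lborel, OF i[unfolded eq]]
      by (simp only:)
  qed
  have "complex_of_real (exp (- t\<^sup>2 / 2)) = char std_normal_distribution t"
    by (simp add: char_std_normal_distribution)
  also have "\<dots> = (\<integral>x. std_normal_density x *\<^sub>R iexp (t * x) \<partial>lborel)"
    unfolding char_def by (subst integral_density) auto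
  also have "\<dots> = complex_of_real (1 / sqrt (2 * pi)) * ?I"
    unfolding eq by (rule integral_mult_right_zero)
  finally show "?I = complex_of_real (sqrt (2 * pi) * exp (- t\<^sup>2 / 2))"
    using pos by (simp add: field_simps)
qed

lemma gauss_fourier_complex:
  fixes w :: "'a::euclidean_space"
  shows "integrable lborel (\<lambda>\<xi>::'a. complex_of_real (gauss \<xi>) * iexp (inner \<xi> w))" (is ?int)
    and "(\<integral>\<xi>. complex_of_real (gauss \<xi>) * iexp (inner \<xi> w) \<partial>lborel) = complex_of_real (sqrt (2 * pi) ^ DIM('a) * gauss w)" (is "?I = ?J")
proof -
  have nsq: "(norm v)\<^sup>2 = (\<Sum>b\<in>Basis. (inner v b)\<^sup>2)" for v :: 'a
    unfolding power2_norm_eq_inner by (subst euclidean_inner) (simp add: power2_eq_square)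
  have g: "gauss v = (\<Prod>b\<in>Basis. exp (- (inner v b)\<^sup>2 / 2))" for v :: 'a
    by (simp add: gauss_def nsq exp_sum[symmetric] sum_negf sum_divide_distrib)
  have e: "iexp (inner \<xi> w) = (\<Prod>b\<in>Basis. iexp (inner w b * inner \<xi> b))" for \<xi>
    by (subst euclidean_inner) (simp add: exp_sum[symmetric] sum_distrib_left mult.commute)
  have eq: "complex_of_real (gauss \<xi>) * iexp (inner \<xi> w)
     = (\<Prod>b\<in>Basis. complex_of_real (exp (- (inner \<xi> b)\<^sup>2 / 2)) * iexp (inner w b * inner \<xi> b))" for \<xi>
    by (simp add: g e prod.distrib)
  show ?int
    unfolding eq by (rule integrable_lborel_prod(1)) (rule real_gauss_fourier(1))
  have "?I = (\<Prod>b\<in>Basis. complex_of_real (sqrt (2 * pi) * exp (- (inner w b)\<^sup>2 / 2)))"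
    unfolding eq
    by (subst integrable_lborel_prod(2)) (simp_all only: real_gauss_fourier)
  also have "\<dots> = ?J"
    by (simp add: g prod.distrib prod_constant)
  finally show "?I = ?J" .
qed

lemma gauss_fourier:
  fixes w :: "'a::euclidean_space"
  shows "(\<integral>\<xi>. gauss \<xi> * cos (inner \<xi> w) \<partial>lborel) = sqrt (2 * pi) ^ DIM('a) * gauss w"
proof -
  have "(\<integral>\<xi>. Re (complex_of_real (gauss \<xi>) * iexp (inner \<xi> w)) \<partial>lborel)
      = Re (\<integral>\<xi>. complex_of_real (gauss \<xi>) * iexp (inner \<xi> w) \<partial>lborel)"
    by (rule integral_bounded_linear[OF bounded_linear_Re gauss_fourier_complex(1)])
  then show ?thesis
    by (simp add: gauss_fourier_complex(2) Re_exp)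
qed

lemma gauss_integrable: "integrable lborel (gauss :: 'a::euclidean_space \<Rightarrow> real)"
  using integrable_Re[OF gauss_fourier_complex(1)[of "0::'a"]] by simp

lemma gauss_integral: "integral\<^sup>L lborel (gauss :: 'a::euclidean_space \<Rightarrow> real) = sqrt (2 * pi) ^ DIM('a)"
  using gauss_fourier[of "0::'a"] by simp

lemma nn_integral_scale:
  fixes f :: "'a::euclidean_space \<Rightarrow> ennreal"
  assumes [measurable]: "f \<in> borel_measurable borel" and c: "c > 0"
  shows "(\<integral>\<^sup>+x. f x \<partial>lborel) = ennreal (c ^ DIM('a)) * (\<integral>\<^sup>+x. f (c *\<^sub>R x) \<partial>lborel)"
proof -
  have "(\<integral>\<^sup>+x. f x \<partial>lborel) = (\<integral>\<^sup>+x. f x \<partial>density (distr lborel borel (\<lambda>x. 0 + c *\<^sub>R x)) (\<lambda>_. \<bar>c\<bar>^DIM('a)))"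
    using lborel_affine[of c "0::'a"] c by simp
  also have "\<dots> = ennreal (c ^ DIM('a)) * (\<integral>\<^sup>+x. f (c *\<^sub>R x) \<partial>lborel)"
    using c by (subst nn_integral_density) (auto simp: nn_integral_distr nn_integral_cmult)
  finally show ?thesis .
qed

lemma integral_scale:
  fixes f :: "'a::euclidean_space \<Rightarrow> real"
  assumes [measurable]: "f \<in> borel_measurable borel" and c: "c > 0"
  shows "(\<integral>x. f x \<partial>lborel) = c ^ DIM('a) * (\<integral>x. f (c *\<^sub>R x) \<partial>lborel)"
proof -
  have "(\<integral>x. f x \<partial>lborel) = (\<integral>x. f x \<partial>density (distr lborel borel (\<lambda>x. 0 + c *\<^sub>R x)) (\<lambda>_. ennreal (\<bar>c\<bar>^DIM('a))))"
    using lborel_affine[of c "0::'a"] c by simp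
  also have "\<dots> = c ^ DIM('a) * (\<integral>x. f (c *\<^sub>R x) \<partial>lborel)"
    using c by (subst integral_density) (auto simp: integral_distr)
  finally show ?thesis .
qed

text \<open>Squared modulus of the Fourier transform, split into sine and cosine transforms so that all
  integrals are real.\<close>
definition fpow :: "('a::euclidean_space \<Rightarrow> real) \<Rightarrow> 'a \<Rightarrow> real" where
  "fpow f \<xi> = (\<integral>x. f x * cos (inner x \<xi>) \<partial>lborel)\<^sup>2 + (\<integral>x. f x * sin (inner x \<xi>) \<partial>lborel)\<^sup>2"

text \<open>The autocorrelation. Its Fourier transform is \<open>fpow f\<close> and its value at 0
  is the squared L^2 norm of \<open>f\<close>, so Plancherel amounts to Fourier inversion for it at
  0.\<close>

definition acorr :: "('a::euclidean_space \<Rightarrow> real) \<Rightarrow> 'a \<Rightarrow> real" where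
  "acorr f w = (\<integral>x. f x * f (x + w) \<partial>lborel)"

lemma acorr_measurable [measurable]:
  assumes [measurable]: "f \<in> borel_measurable borel"
  shows "acorr f \<in> borel_measurable borel"
  unfolding acorr_def[abs_def] by measurable

lemma fpow_measurable [measurable]:
  assumes [measurable]: "f \<in> borel_measurable borel"
  shows "fpow f \<in> borel_measurable borel"
  unfolding fpow_def[abs_def] by measurable

lemma integrable_bounded_support:
  fixes f :: "'a::euclidean_space \<Rightarrow> real"
  assumes "f \<in> borel_measurable borel" "\<forall>x. \<bar>f x\<bar> \<le> B" "\<forall>x. x \<notin> S \<longrightarrow> f x = 0" "bounded S"
  shows "integrable lborel f"
proof -
  obtain R where R: "\<And>x. x \<in> S \<Longrightarrow> norm x \<le> R"
    using assms(4) by (auto simp: bounded_iff)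
  show ?thesis
  proof (rule Bochner_Integration.integrable_bound)
    show "integrable lborel (\<lambda>x. B * indicator (cball (0::'a) R) x)"
      by (intro integrable_mult_right integrable_real_indicator)
         (use emeasure_bounded_finite[OF bounded_cball, of "0::'a" R] in auto)
    have "norm (f x) \<le> norm (B * indicator (cball 0 R) x)" for x
      using assms(2,3) R[of x] abs_ge_self[of B] order_trans[of "\<bar>f x\<bar>" B "\<bar>B\<bar>"] by (cases "x \<in> S") (auto simp: indicator_def)
    then show "AE x in lborel. norm (f x) \<le> norm (B * indicator (cball 0 R) x)" by simp
  qed (use assms(1) in simp)
qed

section \<open>The Plancherel identity by Gaussian regularisation\<close>

context
  fixes f :: "'a::euclidean_space \<Rightarrow> real" and \<Omega>
  assumes f: "f \<in> Cc_inf \<Omega>"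
begin

lemma borel_measurable_f [measurable]: "f \<in> borel_measurable borel"
  by (rule Cc_inf_measurable[OF f])

lemma mult_shift_zero:
  assumes "\<forall>x. norm x > R \<longrightarrow> f x = 0" "norm w > 2 * R"
  shows "f x * f (x + w) = 0"
proof -
  have "norm w \<le> norm (x + w) + norm x"
    using norm_triangle_ineq4[of "x + w" x] by simp
  then have "norm x > R \<or> norm (x + w) > R" using assms(2) by auto
  then show ?thesis using assms(1) by auto
qed

lemma correlation_integrable:
  "integrable (lborel \<Otimes>\<^sub>M lborel) (\<lambda>(x, w). f x * f (x + w) * cos (inner w \<xi>))"
proof -
  obtain B R where BR: "0 < R" "0 < B" "\<forall>x. \<bar>f x\<bar> \<le> B" "\<forall>x. norm x > R \<longrightarrow> f x = 0"
    using f by (rule Cc_inf_bounded)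
  have "integrable (lborel :: ('a \<times> 'a) measure) (\<lambda>(x, w). f x * f (x + w) * cos (inner w \<xi>))"
  proof (rule integrable_bounded_support)
    show "(\<lambda>(x, w). f x * f (x + w) * cos (inner w \<xi>)) \<in> borel_measurable borel"
      by (simp add: borel_prod[symmetric])
    have "\<bar>f x * f (x + w) * cos (inner w \<xi>)\<bar> \<le> B * B * 1" for x w
      unfolding abs_mult using BR(2,3) by (intro mult_mono) auto
    then show "\<forall>y. \<bar>case y of (x, w) \<Rightarrow> f x * f (x + w) * cos (inner w \<xi>)\<bar> \<le> B * B * 1"
      by auto
    show "bounded (cball (0::'a) R \<times> cball (0::'a) (2 * R))"
      by (intro bounded_Times bounded_cball)
    show "\<forall>y. y \<notin> cball 0 R \<times> cball 0 (2 * R) \<longrightarrow> (case y of (x, w) \<Rightarrow> f x * f (x + w) * cos (inner w \<xi>)) = 0"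
      using mult_shift_zero[OF BR(4)] BR(4) by (auto simp: not_le)
  qed
  then show ?thesis by (simp add: lborel_prod)
qed

text \<open>By the addition formula the two squares combine into a double integral of f x f y cos
  (inner (y - x) \<xi>); substituting y = x + w and exchanging the integrals leaves the
  autocorrelation.\<close>

lemma fpow_acorr: "fpow f \<xi> = (\<integral>w. acorr f w * cos (inner w \<xi>) \<partial>lborel)"
proof -
  let ?C = "\<integral>y. f y * cos (inner y \<xi>) \<partial>lborel" and ?S = "\<integral>y. f y * sin (inner y \<xi>) \<partial>lborel"
  have i: "integrable lborel (\<lambda>y. f y * cos (inner y \<xi>))" "integrable lborel (\<lambda>y. f y * sin (inner y \<xi>))"
    by (rule Cc_inf_integrable[of _ \<Omega>]; intro Cc_inf_mult f smooth_fun_cos_inner smooth_fun_sin_inner)+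
  have "fpow f \<xi> = (\<integral>x. f x * cos (inner x \<xi>) * ?C
      + f x * sin (inner x \<xi>) * ?S \<partial>lborel)"
    unfolding fpow_def power2_eq_square using i by simp
  also have "\<dots> = (\<integral>x. f x * (\<integral>y. f y * cos (inner (y - x) \<xi>) \<partial>lborel) \<partial>lborel)"
  proof (intro Bochner_Integration.integral_cong refl)
    fix x
    have "(\<integral>y. f y * cos (inner (y - x) \<xi>) \<partial>lborel)
      = (\<integral>y. cos (inner x \<xi>) * (f y * cos (inner y \<xi>)) + sin (inner x \<xi>) * (f y * sin (inner y \<xi>)) \<partial>lborel)"
      by (intro Bochner_Integration.integral_cong refl) (simp add: inner_diff_left cos_diff algebra_simps)
    also have "\<dots> = cos (inner x \<xi>) * ?C + sin (inner x \<xi>) * ?S"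
      using i by simp
    finally show "f x * cos (inner x \<xi>) * ?C
      + f x * sin (inner x \<xi>) * ?S = f x * (\<integral>y. f y * cos (inner (y - x) \<xi>) \<partial>lborel)"
      by (simp add: algebra_simps)
  qed
  also have "\<dots> = (\<integral>x. (\<integral>w. f x * f (x + w) * cos (inner w \<xi>) \<partial>lborel) \<partial>lborel)"
  proof (intro Bochner_Integration.integral_cong refl)
    fix x
    have "(\<integral>y. f y * cos (inner (y - x) \<xi>) \<partial>lborel) = (\<integral>w. f (x + w) * cos (inner w \<xi>) \<partial>lborel)"
      using integral_translation(1)[of "\<lambda>y. f y * cos (inner (y - x) \<xi>)" x] by simp
    then show "f x * (\<integral>y. f y * cos (inner (y - x) \<xi>) \<partial>lborel) = (\<integral>w. f x * f (x + w) * cos (inner w \<xi>) \<partial>lborel)"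
      by (simp add: mult.assoc)
  qed
  also have "\<dots> = (\<integral>w. (\<integral>x. f x * f (x + w) * cos (inner w \<xi>) \<partial>lborel) \<partial>lborel)"
    by (rule lborel_pair.Fubini_integral[symmetric]) (rule correlation_integrable)
  also have "\<dots> = (\<integral>w. acorr f w * cos (inner w \<xi>) \<partial>lborel)"
    by (simp add: acorr_def)
  finally show ?thesis .
qed

lemma acorr_bounded: "\<exists>C. \<forall>w. \<bar>acorr f w\<bar> \<le> C"
proof -
  obtain B R where BR: "0 < R" "0 < B" "\<forall>x. \<bar>f x\<bar> \<le> B" "\<forall>x. norm x > R \<longrightarrow> f x = 0"
    using f by (rule Cc_inf_bounded)
  have "\<bar>acorr f w\<bar> \<le> (\<integral>x. B * \<bar>f x\<bar> \<partial>lborel)" for w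
  proof -
    have "norm (acorr f w) \<le> (\<integral>x. norm (f x * f (x + w)) \<partial>lborel)"
      unfolding acorr_def by (rule integral_norm_bound)
    also have "\<dots> \<le> (\<integral>x. B * \<bar>f x\<bar> \<partial>lborel)"
    proof (rule integral_mono_AE')
      show "integrable lborel (\<lambda>x. B * \<bar>f x\<bar>)"
        using Cc_inf_integrable[OF f] by simp
      have "norm (f x * f (x + w)) \<le> B * \<bar>f x\<bar>" for x
        using BR(3) by (simp add: abs_mult mult.commute[of "\<bar>f x\<bar>"] mult_right_mono)
      then show "AE x in lborel. norm (f x * f (x + w)) \<le> B * \<bar>f x\<bar>" by simp
    qed (use BR in auto)
    finally show ?thesis by simp
  qed
  then show ?thesis by blast
qed

lemma acorr_integrable: "integrable lborel (acorr f)"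
proof -
  obtain B R where BR: "0 < R" "0 < B" "\<forall>x. \<bar>f x\<bar> \<le> B" "\<forall>x. norm x > R \<longrightarrow> f x = 0"
    using f by (rule Cc_inf_bounded)
  obtain C where C: "\<forall>w. \<bar>acorr f w\<bar> \<le> C" using acorr_bounded by blast
  show ?thesis
  proof (rule integrable_bounded_support[OF _ C])
    show "\<forall>w. w \<notin> cball 0 (2 * R) \<longrightarrow> acorr f w = 0"
    proof (intro allI impI)
      fix w :: 'a assume w: "w \<notin> cball 0 (2 * R)"
      then have "f x * f (x + w) = 0" for x
        by (intro mult_shift_zero[OF BR(4)]) simp
      then have "(\<lambda>x. f x * f (x + w)) = (\<lambda>x. 0)" by (rule ext)
      then show "acorr f w = 0" unfolding acorr_def by (simp only:) simp
    qed
  qed auto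
qed

lemma acorr_tendsto:
  assumes "w \<longlonglongrightarrow> 0"
  shows "(\<lambda>n. acorr f (w n)) \<longlonglongrightarrow> (\<integral>x. (f x)\<^sup>2 \<partial>lborel)"
proof -
  obtain B R where BR: "0 < R" "0 < B" "\<forall>x. \<bar>f x\<bar> \<le> B" "\<forall>x. norm x > R \<longrightarrow> f x = 0"
    using f by (rule Cc_inf_bounded)
  show ?thesis
    unfolding acorr_def
  proof (rule integral_dominated_convergence[where w = "\<lambda>x. B * \<bar>f x\<bar>"])
    show "integrable lborel (\<lambda>x. B * \<bar>f x\<bar>)"
      using Cc_inf_integrable[OF f] by simp
    show "AE x in lborel. (\<lambda>n. f x * f (x + w n)) \<longlonglongrightarrow> (f x)\<^sup>2"
    proof (rule AE_I2)
      fix x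
      have "isCont f x"
        using Cc_inf_continuous[OF f] by (simp add: continuous_on_eq_continuous_at)
      moreover have "(\<lambda>n. x + w n) \<longlonglongrightarrow> x"
        using tendsto_add[OF tendsto_const assms, of x] by simp
      ultimately have "(\<lambda>n. f (x + w n)) \<longlonglongrightarrow> f x" by (rule isCont_tendsto_compose)
      then show "(\<lambda>n. f x * f (x + w n)) \<longlonglongrightarrow> (f x)\<^sup>2"
        unfolding power2_eq_square by (intro tendsto_intros)
    qed
    have "norm (f x * f (x + w n)) \<le> B * \<bar>f x\<bar>" for n x
      using BR(3) by (simp add: abs_mult mult.commute[of "\<bar>f x\<bar>"] mult_right_mono)
    then show "AE x in lborel. norm (f x * f (x + w n)) \<le> B * \<bar>f x\<bar>" for n by simp
  qed auto
qed

text \<open>The Gaussian factor makes the double integral over frequency and shift absolutely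
  convergent. After Fubini and the substitution w = c v, the frequency integral is an explicit
  Gaussian transform, which absorbs the power of c.\<close>

lemma gauss_fpow:
  assumes c: "c > 0"
  shows "integrable lborel (\<lambda>\<xi>. gauss (c *\<^sub>R \<xi>) * fpow f \<xi>)" (is ?int)
    and "(\<integral>\<xi>. gauss (c *\<^sub>R \<xi>) * fpow f \<xi> \<partial>lborel) = sqrt (2 * pi) ^ DIM('a) * (\<integral>v. acorr f (c *\<^sub>R v) * gauss v \<partial>lborel)" (is "?I = ?J")
proof -
  let ?h = "\<lambda>\<xi> w. gauss (c *\<^sub>R \<xi>) * (acorr f w * cos (inner w \<xi>))"
  let ?k = "\<lambda>v. \<integral>\<xi>. gauss (c *\<^sub>R \<xi>) * cos (inner (c *\<^sub>R \<xi>) v) \<partial>lborel"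
  have gi: "integrable lborel (\<lambda>\<xi>::'a. gauss (c *\<^sub>R \<xi>))"
  proof (rule integrableI_nonneg)
    have "(\<integral>\<^sup>+\<xi>. ennreal (gauss (\<xi>::'a)) \<partial>lborel) = ennreal (c ^ DIM('a)) * (\<integral>\<^sup>+\<xi>. ennreal (gauss (c *\<^sub>R (\<xi>::'a))) \<partial>lborel)"
      by (rule nn_integral_scale) (use c in auto)
    moreover have "(\<integral>\<^sup>+\<xi>. ennreal (gauss (\<xi>::'a)) \<partial>lborel) < \<infinity>"
      by (subst nn_integral_eq_integral[OF gauss_integrable]) (auto simp: gauss_pos less_imp_le)
    ultimately show "(\<integral>\<^sup>+\<xi>. ennreal (gauss (c *\<^sub>R (\<xi>::'a))) \<partial>lborel) < \<infinity>"
      using c by (auto simp: ennreal_mult_less_top)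
  qed (auto simp: gauss_pos less_imp_le)
  have prod: "integrable (lborel \<Otimes>\<^sub>M lborel) (\<lambda>(\<xi>, w). ?h \<xi> w)"
  proof (rule Bochner_Integration.integrable_bound)
    show "integrable (lborel \<Otimes>\<^sub>M lborel) (\<lambda>(\<xi>::'a, w). gauss (c *\<^sub>R \<xi>) * acorr f w)"
    proof (rule lborel_pair.Fubini_integrable)
      have "(\<lambda>\<xi>::'a. \<integral>w. norm (gauss (c *\<^sub>R \<xi>) * acorr f w) \<partial>lborel) = (\<lambda>\<xi>. gauss (c *\<^sub>R \<xi>) * (\<integral>w. \<bar>acorr f w\<bar> \<partial>lborel))"
        by (simp add: abs_mult less_imp_le[OF gauss_pos] abs_of_nonneg)
      then show "integrable lborel (\<lambda>\<xi>::'a. \<integral>w. norm (case (\<xi>, w) of (\<xi>, w) \<Rightarrow> gauss (c *\<^sub>R \<xi>) * acorr f w) \<partial>lborel)"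
        using gi by simp
    qed (auto intro!: acorr_integrable)
    show "AE p in lborel \<Otimes>\<^sub>M lborel. norm (case p of (\<xi>, w) \<Rightarrow> ?h \<xi> w)
        \<le> norm (case p of (\<xi>::'a, w) \<Rightarrow> gauss (c *\<^sub>R \<xi>) * acorr f w)"
      by (rule AE_I2) (auto simp: abs_mult less_imp_le[OF gauss_pos] abs_of_nonneg
          intro!: mult_left_mono mult_left_le)
  qed measurable
  show ?int
    using lborel_pair.integrable_fst'[OF prod] by (simp add: fpow_acorr)
  have "?I = (\<integral>\<xi>. (\<integral>w. ?h \<xi> w \<partial>lborel) \<partial>lborel)"
    by (simp add: fpow_acorr)
  also have "\<dots> = (\<integral>w. (\<integral>\<xi>. ?h \<xi> w \<partial>lborel) \<partial>lborel)"
    by (rule lborel_pair.Fubini_integral[symmetric]) (rule prod)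
  also have "\<dots> = c ^ DIM('a) * (\<integral>v. (\<integral>\<xi>. gauss (c *\<^sub>R \<xi>) * (acorr f (c *\<^sub>R v) * cos (inner (c *\<^sub>R v) \<xi>)) \<partial>lborel) \<partial>lborel)"
    by (rule integral_scale) (use c in measurable)
  also have "\<dots> = c ^ DIM('a) * (\<integral>v. acorr f (c *\<^sub>R v) * ?k v \<partial>lborel)"
    by (simp add: mult.left_commute[of "gauss _"] inner_commute)
  also have "\<dots> = (\<integral>v. acorr f (c *\<^sub>R v) * (c ^ DIM('a) * ?k v) \<partial>lborel)"
    by (subst integral_mult_right_zero[symmetric]) (simp only: mult.left_commute)
  also have "\<dots> = (\<integral>v. acorr f (c *\<^sub>R v) * (sqrt (2 * pi) ^ DIM('a) * gauss v) \<partial>lborel)"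
    by (subst integral_scale[OF _ c, symmetric]) (simp_all add: gauss_fourier)
  also have "\<dots> = ?J"
    by (subst integral_mult_right_zero[symmetric]) (simp only: mult.left_commute)
  finally show "?I = ?J" .
qed

text \<open>The regularisation c tends to 0. The left side converges monotonically; on the right
  \<open>acorr f\<close> at c v tends to the squared norm of \<open>f\<close>, dominated by a
  multiple of the Gaussian, whose integral supplies the second factor sqrt (2 pi)^d.\<close>

theorem plancherel:
  "(\<integral>\<^sup>+\<xi>. ennreal (fpow f \<xi>) \<partial>lborel) = ennreal ((2 * pi) ^ DIM('a) * (\<integral>x. (f x)\<^sup>2 \<partial>lborel))"
proof -
  let ?N = "\<integral>x. (f x)\<^sup>2 \<partial>lborel"
  define c where "c n = 1 / real (Suc n)" for n
  let ?a = "\<lambda>n. \<integral>v. acorr f (c n *\<^sub>R v) * gauss v \<partial>lborel" and ?K = "sqrt (2 * pi) ^ DIM('a)"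
  have c: "c n > 0" for n by (simp add: c_def)
  have c0: "c \<longlonglongrightarrow> 0" unfolding c_def[abs_def] using LIMSEQ_Suc[OF lim_1_over_n] by simp
  have fp0: "0 \<le> fpow f \<xi>" for \<xi> by (simp add: fpow_def)
  have lim1: "(\<lambda>n. \<integral>\<^sup>+\<xi>. ennreal (gauss (c n *\<^sub>R \<xi>) * fpow f \<xi>) \<partial>lborel) \<longlonglongrightarrow> (\<integral>\<^sup>+\<xi>. ennreal (fpow f \<xi>) \<partial>lborel)"
  proof (rule nn_integral_LIMSEQ)
    show "incseq (\<lambda>n \<xi>. ennreal (gauss (c n *\<^sub>R \<xi>) * fpow f \<xi>))"
    proof (intro incseq_SucI le_funI ennreal_leI mult_right_mono fp0)
      fix n and \<xi> :: 'a
      have "norm (c (Suc n) *\<^sub>R \<xi>) \<le> norm (c n *\<^sub>R \<xi>)"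
        unfolding norm_scaleR by (intro mult_right_mono) (auto simp: c_def frac_le)
      then show "gauss (c n *\<^sub>R \<xi>) \<le> gauss (c (Suc n) *\<^sub>R \<xi>)"
        by (simp add: gauss_def power_mono)
    qed
    show "(\<lambda>n. ennreal (gauss (c n *\<^sub>R \<xi>) * fpow f \<xi>)) \<longlonglongrightarrow> ennreal (fpow f \<xi>)" for \<xi>
    proof -
      have "(\<lambda>n. gauss (c n *\<^sub>R \<xi>) * fpow f \<xi>) \<longlonglongrightarrow> exp (- (norm (0 *\<^sub>R \<xi>))\<^sup>2 / 2) * fpow f \<xi>"
        unfolding gauss_def by (intro tendsto_intros c0) simp
      then show ?thesis by (intro tendsto_ennrealI) simp
    qed
  qed measurable
  have eq: "(\<integral>\<^sup>+\<xi>. ennreal (gauss (c n *\<^sub>R \<xi>) * fpow f \<xi>) \<partial>lborel)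
      = ennreal (?K * ?a n)" for n
    by (subst nn_integral_eq_integral[OF gauss_fpow(1)[OF c]])
       (auto simp: gauss_fpow(2)[OF c] fp0 gauss_pos less_imp_le)
  have lim2: "(\<lambda>n. ennreal (?K * ?a n))
      \<longlonglongrightarrow> ennreal ((2 * pi) ^ DIM('a) * ?N)"
  proof (rule tendsto_ennrealI)
    obtain C where C: "\<forall>w. \<bar>acorr f w\<bar> \<le> C" using acorr_bounded by blast
    have "(\<lambda>n. ?a n) \<longlonglongrightarrow> (\<integral>v. ?N * gauss (v::'a) \<partial>lborel)"
    proof (rule integral_dominated_convergence[where w = "\<lambda>v. C * gauss v"])
      show "integrable lborel (\<lambda>v::'a. C * gauss v)" by (intro integrable_mult_right gauss_integrable)
      show "AE v in lborel. (\<lambda>n. acorr f (c n *\<^sub>R v) * gauss v) \<longlonglongrightarrow> ?N * gauss v"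
      proof (rule AE_I2, intro tendsto_intros acorr_tendsto)
        fix v :: 'a
        show "(\<lambda>n. c n *\<^sub>R v) \<longlonglongrightarrow> 0"
          using tendsto_scaleR[OF c0 tendsto_const, of v] by simp
      qed
      show "AE v in lborel. norm (acorr f (c n *\<^sub>R v) * gauss v) \<le> C * gauss v" for n
        using C by (auto simp: abs_mult less_imp_le[OF gauss_pos] abs_of_nonneg intro!: mult_right_mono)
    qed measurable
    then have lim: "(\<lambda>n. ?K * ?a n)
      \<longlonglongrightarrow> ?K * (?N * ?K)"
      by (intro tendsto_mult tendsto_const) (simp add: gauss_integral)
    have sq: "?K * ?K = (2 * pi) ^ DIM('a)"
      unfolding power_mult_distrib[symmetric] by simp
    have eq2: "?K * (?N * ?K)
        = (2 * pi) ^ DIM('a) * ?N"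
    proof -
      have ac: "x * (y * x) = (x * x) * y" for x y :: real by (simp only: mult_ac)
      show ?thesis unfolding ac sq by (rule refl)
    qed
    show "(\<lambda>n. ?K * ?a n)
      \<longlonglongrightarrow> (2 * pi) ^ DIM('a) * ?N"
      using lim unfolding eq2 .
  qed
  show ?thesis
    using lim1 unfolding eq by (rule LIMSEQ_unique[OF _ lim2])
qed

end

text \<open>Green's identity moves the Laplacian onto the plane wave, which it multiplies by -
  |xi|^2; squaring gives the fourth power.\<close>

lemma fpow_laplacian:
  assumes "f \<in> Cc_inf \<Omega>"
  shows "fpow (laplacian f) \<xi> = norm \<xi> ^ 4 * fpow f \<xi>"
proof -
  have "(\<integral>x. f x * (- (norm \<xi>)\<^sup>2 * g x) \<partial>lborel) = - (norm \<xi>)\<^sup>2 * (\<integral>x. f x * g x \<partial>lborel)" for g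
    by (subst integral_mult_right_zero[symmetric]) (simp add: mult.left_commute)
  then show ?thesis
    unfolding fpow_def green_identity[OF assms smooth_fun_cos_inner] green_identity[OF assms smooth_fun_sin_inner]
      laplacian_cos_inner laplacian_sin_inner
    by (simp add: power_mult_distrib distrib_left flip: power_mult)
qed

section \<open>Phase space volume\<close>

lemma emeasure_quartic_sublevel:
  assumes "0 \<le> t"
  shows "emeasure lborel {\<xi>::'a::euclidean_space. norm \<xi> ^ 4 \<le> t} =
    ennreal (unit_ball_vol (real DIM('a)) * t powr (real DIM('a) / 4))"
proof -
  have "{\<xi>::'a. norm \<xi> ^ 4 \<le> t} = cball 0 (root 4 t)"
  proof -
    have "norm \<xi> ^ 4 \<le> t \<longleftrightarrow> norm \<xi> \<le> root 4 t" for \<xi> :: 'a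
    proof -
      have r: "root 4 (norm \<xi> ^ 4) = norm \<xi>" by (rule real_root_power_cancel) (rule zero_less_numeral, rule norm_ge_zero)
      have "root 4 (norm \<xi> ^ 4) \<le> root 4 t \<longleftrightarrow> norm \<xi> ^ 4 \<le> t" by (rule real_root_le_iff) (rule zero_less_numeral)
      then show ?thesis unfolding r by (rule sym)
    qed
    then show ?thesis by (intro set_eqI) (simp only: mem_Collect_eq mem_cball_0)
  qed
  moreover have "root 4 t ^ DIM('a) = t powr (real DIM('a) / 4)"
  proof (cases "t = 0")
    case False
    then have "root 4 t = t powr (1 / 4)" using assms by (simp add: root_powr_inverse)
    moreover have "(t powr (1 / 4)) ^ DIM('a) = t powr (1 / 4 * real DIM('a))"
      using False assms by (simp add: powr_realpow[symmetric] powr_powr)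
    ultimately show ?thesis by simp
  qed simp
  ultimately show ?thesis
    using assms by (simp add: emeasure_cball)
qed

text \<open>Layer cake: (R - |xi|^4)_+ is the length of the interval from |xi|^4 to R. Exchanging
  the integrals leaves the volume of a ball of radius t^(1/4), integrated over 0 <= t <= R.\<close>

lemma nn_integral_quartic_well:
  assumes "0 \<le> R"
  shows "(\<integral>\<^sup>+\<xi>. ennreal (max (R - norm (\<xi>::'a::euclidean_space) ^ 4) 0) \<partial>lborel) =
    ennreal (4 / (real DIM('a) + 4) * unit_ball_vol (real DIM('a)) * R powr (1 + real DIM('a) / 4))"
proof -
  define d where "d = real DIM('a)"
  define I where "I \<xi> t = (indicator {norm \<xi> ^ 4..R} t :: ennreal)" for \<xi> :: 'a and t :: real
  have I_alt: "I \<xi> t = (if norm \<xi> ^ 4 \<le> t \<and> t \<le> R then 1 else 0)" for \<xi> t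
    by (auto simp: I_def)
  have [measurable]: "case_prod I \<in> borel_measurable (lborel \<Otimes>\<^sub>M lborel)"
    unfolding I_alt[abs_def] by measurable
  have "(\<integral>\<^sup>+\<xi>. ennreal (max (R - norm (\<xi>::'a) ^ 4) 0) \<partial>lborel) = (\<integral>\<^sup>+\<xi>. \<integral>\<^sup>+t. I \<xi> t \<partial>lborel \<partial>lborel)"
  proof (intro nn_integral_cong)
    fix \<xi> :: 'a
    show "ennreal (max (R - norm \<xi> ^ 4) 0) = (\<integral>\<^sup>+t. I \<xi> t \<partial>lborel)"
      by (cases "norm \<xi> ^ 4 \<le> R") (simp_all add: I_def max_def)
  qed
  also have "\<dots> = (\<integral>\<^sup>+t. \<integral>\<^sup>+\<xi>. I \<xi> t \<partial>lborel \<partial>lborel)"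
    by (rule lborel_pair.Fubini'[symmetric]) simp
  also have "\<dots> = (\<integral>\<^sup>+t. ennreal (unit_ball_vol d * t powr (d / 4)) * indicator {0..R} t \<partial>lborel)"
  proof (intro nn_integral_cong)
    fix t :: real
    show "(\<integral>\<^sup>+\<xi>. I \<xi> t \<partial>lborel) = ennreal (unit_ball_vol d * t powr (d / 4)) * indicator {0..R} t"
    proof (cases "0 \<le> t \<and> t \<le> R")
      case True
      then have "(\<lambda>\<xi>. I \<xi> t) = indicator {\<xi>. norm \<xi> ^ 4 \<le> t}"
        by (auto simp: I_def fun_eq_iff indicator_def)
      then show ?thesis using True by (simp add: emeasure_quartic_sublevel d_def)
    next
      case False
      have "I \<xi> t = 0" for \<xi>
        using False order_trans[of 0 "norm \<xi> ^ 4" t] by (auto simp: I_alt)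
      then show ?thesis using False by auto
    qed
  qed
  also have "\<dots> = ennreal (unit_ball_vol d * (R powr (d / 4 + 1) / (d / 4 + 1)))"
  proof (rule nn_integral_has_integral_lebesgue')
    have "((\<lambda>t. unit_ball_vol d * t powr (d / 4)) has_integral unit_ball_vol d * (R powr (d / 4 + 1) / (d / 4 + 1))) {0..R}"
      by (intro has_integral_mult_right has_integral_powr_from_0) (use assms in \<open>auto simp: d_def\<close>)
    then show "((\<lambda>t. unit_ball_vol d * t powr (d / 4)) has_integral unit_ball_vol d * (R powr (d / 4 + 1) / (d / 4 + 1))) {0..R}" .
  qed (auto simp: d_def)
  also have "unit_ball_vol d * (R powr (d / 4 + 1) / (d / 4 + 1)) = 4 / (d + 4) * unit_ball_vol d * R powr (1 + d / 4)"
    by (simp add: d_def field_simps)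
  finally show ?thesis by (simp add: d_def)
qed

section \<open>The graph of the Laplacian on test functions\<close>

text \<open>With \<open>sinw\<close>, the real and imaginary parts of \<rho> e_xi as vectors of L^2.
  Two kinds of weight occur: the indicator of \<Omega>, for transforms of functions on \<Omega>, and
  a test function, for the lower bound.\<close>

definition cosw :: "('a::euclidean_space \<Rightarrow> real) \<Rightarrow> 'a \<Rightarrow> 'a L2" where
  "cosw \<rho> \<xi> = L2_class (\<lambda>x. \<rho> x * cos (inner x \<xi>))"

definition sinw :: "('a::euclidean_space \<Rightarrow> real) \<Rightarrow> 'a \<Rightarrow> 'a L2" where
  "sinw \<rho> \<xi> = L2_class (\<lambda>x. \<rho> x * sin (inner x \<xi>))"

text \<open>Squared modulus of the Fourier transform of \<open>\<rho> f\<close>.\<close>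
definition wpow :: "('a::euclidean_space \<Rightarrow> real) \<Rightarrow> 'a L2 \<Rightarrow> 'a \<Rightarrow> real" where
  "wpow \<rho> f \<xi> = (inner f (cosw \<rho> \<xi>))\<^sup>2 + (inner f (sinw \<rho> \<xi>))\<^sup>2"

lemma wpow_nonneg [simp]: "0 \<le> wpow \<rho> f \<xi>"
  by (simp add: wpow_def)

lemma trig_measurable_lebesgue [measurable]:
  "(\<lambda>x. cos (inner x \<xi>)) \<in> borel_measurable lebesgue"
  "(\<lambda>x. sin (inner x \<xi>)) \<in> borel_measurable lebesgue"
  by (auto intro!: measurable_completion)

lemma L2fun_trig:
  assumes "L2fun \<rho>"
  shows "L2fun (\<lambda>x. \<rho> x * cos (inner x \<xi>))" "L2fun (\<lambda>x. \<rho> x * sin (inner x \<xi>))"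
proof -
  have [measurable]: "\<rho> \<in> borel_measurable lebesgue" using assms by (rule L2funD)
  show "L2fun (\<lambda>x. \<rho> x * cos (inner x \<xi>))" "L2fun (\<lambda>x. \<rho> x * sin (inner x \<xi>))"
    by (auto intro!: L2fun_bound[OF assms] simp: abs_mult mult_left_le)
qed

text \<open>As cos^2 + sin^2 = 1, the total is the same at every frequency; this makes the Bessel
  bound uniform in the frequency.\<close>

lemma trigw_norm:
  assumes "L2fun \<rho>"
  shows "(norm (cosw \<rho> \<xi>))\<^sup>2 + (norm (sinw \<rho> \<xi>))\<^sup>2 = (norm (L2_class \<rho>))\<^sup>2"
proof -
  have "(norm (cosw \<rho> \<xi>))\<^sup>2 + (norm (sinw \<rho> \<xi>))\<^sup>2
      = (\<integral>x. (\<rho> x * cos (inner x \<xi>))\<^sup>2 + (\<rho> x * sin (inner x \<xi>))\<^sup>2 \<partial>lebesgue)"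
    using L2funD(2)[OF L2fun_trig(1)[OF assms]] L2funD(2)[OF L2fun_trig(2)[OF assms]]
    by (simp add: cosw_def sinw_def norm_L2_class_sq L2fun_trig assms)
  also have "\<dots> = (\<integral>x. (\<rho> x)\<^sup>2 \<partial>lebesgue)"
    by (simp add: power_mult_distrib flip: distrib_left)
  finally show ?thesis by (simp add: norm_L2_class_sq assms)
qed

text \<open>Dominated convergence with bound 4 \<rho>^2. It serves to make
  \<open>cosw \<rho>\<close> and \<open>sinw \<rho>\<close> norm continuous, which gives
  measurability of \<open>wpow\<close> and the passage from a dense set of frequencies to all of
  them.\<close>

lemma multiplier_tendsto:
  fixes \<rho> :: "'a::euclidean_space \<Rightarrow> real"
  assumes \<rho>: "L2fun \<rho>" and m: "\<And>n. m n \<in> borel_measurable borel" "m' \<in> borel_measurable borel"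
    and le: "\<And>n x. \<bar>m n x\<bar> \<le> 1" "\<And>x. \<bar>m' x\<bar> \<le> 1" and lim: "\<And>x. (\<lambda>n. m n x) \<longlonglongrightarrow> m' x"
  shows "(\<lambda>n. L2_class (\<lambda>x. \<rho> x * m n x)) \<longlonglongrightarrow> L2_class (\<lambda>x. \<rho> x * m' x)"
proof (subst tendsto_L2_class_iff)
  have [measurable]: "\<rho> \<in> borel_measurable lebesgue" using \<rho> by (rule L2funD)
  have [measurable]: "m n \<in> borel_measurable lebesgue" "m' \<in> borel_measurable lebesgue" for n
    using m by (auto intro!: measurable_completion)
  show "L2fun (\<lambda>x. \<rho> x * m n x)" "L2fun (\<lambda>x. \<rho> x * m' x)" for n
    using le by (auto intro!: L2fun_bound[OF \<rho>] simp: abs_mult mult_left_le)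
  have "(\<lambda>n. \<integral>x. (\<rho> x * m n x - \<rho> x * m' x)\<^sup>2 \<partial>lebesgue) \<longlonglongrightarrow> (\<integral>x. 0 \<partial>(lebesgue :: 'a measure))"
  proof (rule integral_dominated_convergence[where w = "\<lambda>x. 4 * (\<rho> x)\<^sup>2"])
    show "AE x in lebesgue. (\<lambda>n. (\<rho> x * m n x - \<rho> x * m' x)\<^sup>2) \<longlonglongrightarrow> 0"
    proof (rule AE_I2)
      fix x
      have "(\<lambda>n. (\<rho> x * m n x - \<rho> x * m' x)\<^sup>2) \<longlonglongrightarrow> (\<rho> x * m' x - \<rho> x * m' x)\<^sup>2"
        by (intro tendsto_intros lim)
      then show "(\<lambda>n. (\<rho> x * m n x - \<rho> x * m' x)\<^sup>2) \<longlonglongrightarrow> 0" by simp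
    qed
    have "(\<rho> x * m n x - \<rho> x * m' x)\<^sup>2 \<le> 4 * (\<rho> x)\<^sup>2" for n x
    proof -
      have "\<bar>m n x - m' x\<bar>\<^sup>2 \<le> 2\<^sup>2" by (rule power_mono) (use le(1)[of n x] le(2)[of x] in linarith, simp)
      then have "(\<rho> x)\<^sup>2 * (m n x - m' x)\<^sup>2 \<le> (\<rho> x)\<^sup>2 * 4" by (intro mult_left_mono) auto
      then show ?thesis by (simp add: power_mult_distrib[symmetric] right_diff_distrib)
    qed
    then show "AE x in lebesgue. norm ((\<rho> x * m n x - \<rho> x * m' x)\<^sup>2) \<le> 4 * (\<rho> x)\<^sup>2" for n by simp
    show "integrable lebesgue (\<lambda>x. 4 * (\<rho> x)\<^sup>2)" using L2funD(2)[OF \<rho>] by simp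
  qed measurable
  then show "(\<lambda>n. \<integral>x. (\<rho> x * m n x - \<rho> x * m' x)\<^sup>2 \<partial>lebesgue) \<longlonglongrightarrow> 0" by simp
qed

lemma continuous_trigw:
  assumes "L2fun \<rho>"
  shows "continuous_on UNIV (cosw \<rho>)" "continuous_on UNIV (sinw \<rho>)"
  unfolding continuous_on_sequentially o_def cosw_def sinw_def
  by (intro allI impI ballI multiplier_tendsto[OF assms] tendsto_intros | simp | elim conjE)+

lemma wpow_measurable:
  assumes "L2fun \<rho>" shows "wpow \<rho> f \<in> borel_measurable borel"
  unfolding wpow_def[abs_def]
  by (intro borel_measurable_continuous_onI continuous_intros continuous_trigw assms)

lemma wpow_le:
  assumes "L2fun \<rho>" shows "wpow \<rho> f \<xi> \<le> (norm f)\<^sup>2 * (norm (L2_class \<rho>))\<^sup>2"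
proof -
  have "(inner f g)\<^sup>2 \<le> (norm f)\<^sup>2 * (norm g)\<^sup>2" for g
    using Cauchy_Schwarz_ineq[of f g] by (simp add: power2_norm_eq_inner)
  then have "wpow \<rho> f \<xi> \<le> (norm f)\<^sup>2 * (norm (cosw \<rho> \<xi>))\<^sup>2 + (norm f)\<^sup>2 * (norm (sinw \<rho> \<xi>))\<^sup>2"
    unfolding wpow_def by (intro add_mono)
  also have "\<dots> = (norm f)\<^sup>2 * (norm (L2_class \<rho>))\<^sup>2"
    using trigw_norm[OF assms, of \<xi>] by (simp flip: distrib_left)
  finally show ?thesis .
qed

lemma bessel:
  assumes "finite B" "orthonormal B"
  shows "(\<Sum>u\<in>B. (inner u g)\<^sup>2) \<le> (norm g)\<^sup>2"
proof -
  define a where "a = (\<Sum>u\<in>B. inner u g *\<^sub>R u)"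
  have ag: "inner a g = (\<Sum>u\<in>B. (inner u g)\<^sup>2)"
    by (simp add: a_def inner_sum_left power2_eq_square)
  have aa: "inner a a = (\<Sum>u\<in>B. (inner u g)\<^sup>2)"
    unfolding a_def by (rule orthonormal_sum_norm[OF assms])
  have "0 \<le> inner (g - a) (g - a)" by simp
  also have "\<dots> = inner g g - 2 * inner a g + inner a a"
    by (simp add: inner_diff_left inner_diff_right inner_commute)
  finally show ?thesis by (simp add: ag aa power2_norm_eq_inner)
qed

lemma wpow_bessel:
  assumes "L2fun \<rho>" "finite B" "orthonormal B"
  shows "(\<Sum>u\<in>B. wpow \<rho> u \<xi>) \<le> (norm (L2_class \<rho>))\<^sup>2"
  unfolding trigw_norm[OF assms(1), of \<xi>, symmetric] wpow_def sum.distrib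
  by (intro add_mono bessel assms)

lemma wpow_tendsto:
  assumes "f \<longlonglongrightarrow> g"
  shows "(\<lambda>n. wpow \<rho> (f n) \<xi>) \<longlonglongrightarrow> wpow \<rho> g \<xi>"
  unfolding wpow_def by (intro tendsto_intros assms)

lemma wpow_class:
  assumes "\<psi> \<in> Cc_inf \<Omega>" "L2fun \<rho>" and b: "(\<lambda>x. \<psi> x * \<rho> x) \<in> borel_measurable borel"
  shows "wpow \<rho> (L2_class \<psi>) \<xi> = fpow (\<lambda>x. \<psi> x * \<rho> x) \<xi>"
proof -
  have [measurable]: "(\<lambda>x. \<psi> x * \<rho> x) \<in> borel_measurable borel" by fact
  have "inner (L2_class \<psi>) (L2_class (\<lambda>x. \<rho> x * g x)) = (\<integral>x. \<psi> x * \<rho> x * g x \<partial>lborel)"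
    if [measurable]: "g \<in> borel_measurable borel" and "L2fun (\<lambda>x. \<rho> x * g x)" for g
    using that by (simp add: inner_L2_class Cc_inf_L2fun[OF assms(1)] mult.assoc[symmetric] integral_lebesgue_borel)
  then show ?thesis
    by (simp add: wpow_def fpow_def cosw_def sinw_def L2fun_trig assms)
qed

definition bilap_graph :: "'a::euclidean_space set \<Rightarrow> ('a L2 \<times> 'a L2) set" where
  "bilap_graph \<Omega> = closure {(L2_class \<phi>, L2_class (laplacian \<phi>)) | \<phi>. \<phi> \<in> Cc_inf \<Omega>}"

lemma bilap_graph_sequence:
  assumes "(f, h) \<in> bilap_graph \<Omega>"
  obtains \<phi> where "\<forall>n. \<phi> n \<in> Cc_inf \<Omega>" "(\<lambda>n. L2_class (\<phi> n)) \<longlonglongrightarrow> f"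
    "(\<lambda>n. L2_class (laplacian (\<phi> n))) \<longlonglongrightarrow> h"
proof -
  obtain g where g: "\<forall>n. g n \<in> {(L2_class \<phi>, L2_class (laplacian \<phi>)) | \<phi>. \<phi> \<in> Cc_inf \<Omega>}" "g \<longlonglongrightarrow> (f, h)"
    using assms unfolding bilap_graph_def closure_sequential by blast
  then have "\<forall>n. \<exists>\<phi>. \<phi> \<in> Cc_inf \<Omega> \<and> g n = (L2_class \<phi>, L2_class (laplacian \<phi>))" by blast
  then obtain \<phi> where \<phi>: "\<And>n. \<phi> n \<in> Cc_inf \<Omega>" "\<And>n. g n = (L2_class (\<phi> n), L2_class (laplacian (\<phi> n)))"
    by metis
  have "(\<lambda>n. fst (g n)) \<longlonglongrightarrow> f" "(\<lambda>n. snd (g n)) \<longlonglongrightarrow> h"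
    using tendsto_fst[OF g(2)] tendsto_snd[OF g(2)] by auto
  then show ?thesis using that[of \<phi>] \<phi> by simp
qed

lemma bilap_graphI:
  assumes "\<And>n. \<phi> n \<in> Cc_inf \<Omega>" "(\<lambda>n. L2_class (\<phi> n)) \<longlonglongrightarrow> f" "(\<lambda>n. L2_class (laplacian (\<phi> n))) \<longlonglongrightarrow> h"
  shows "(f, h) \<in> bilap_graph \<Omega>"
  unfolding bilap_graph_def closure_sequential
  by (rule exI[of _ "\<lambda>n. (L2_class (\<phi> n), L2_class (laplacian (\<phi> n)))"])
     (use assms in \<open>auto intro!: tendsto_intros\<close>)

lemma bilap_graph_smooth: "\<phi> \<in> Cc_inf \<Omega> \<Longrightarrow> (L2_class \<phi>, L2_class (laplacian \<phi>)) \<in> bilap_graph \<Omega>"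
  unfolding bilap_graph_def by (rule subsetD[OF closure_subset]) blast

lemma laplacian_add:
  assumes "smooth_fun f" "smooth_fun g"
  shows "laplacian (\<lambda>x. f x + g x) = (\<lambda>x. laplacian f x + laplacian g x)"
proof
  fix x
  have 1: "pd i (\<lambda>x. f x + g x) = (\<lambda>x. pd i f x + pd i g x)" for i
    by (intro ext pd_add smooth_fun_differentiable assms)
  have "pd i (pd i (\<lambda>x. f x + g x)) x = pd i (pd i f) x + pd i (pd i g) x" if "i \<in> Basis" for i
    unfolding 1 by (intro pd_add smooth_fun_differentiable smooth_fun_pd assms that)
  then show "laplacian (\<lambda>x. f x + g x) x = laplacian f x + laplacian g x"
    by (simp add: laplacian_pd sum.distrib)
qed

lemma laplacian_const [simp]: "laplacian (\<lambda>x. c) x = 0"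
proof -
  have "pd i (\<lambda>x::'a. c) = (\<lambda>x. 0)" for i by (rule ext) (rule pd_const)
  then show ?thesis by (simp add: laplacian_pd)
qed

lemma laplacian_scale:
  assumes "smooth_fun f"
  shows "laplacian (\<lambda>x. c * f x) = (\<lambda>x. c * laplacian f x)"
  using laplacian_mult[OF smooth_fun_const assms, of c]
  by (simp add: fun_eq_iff laplacian_const)

lemma subspace_closure_real_normed:
  fixes S :: "'b::real_normed_vector set"
  assumes "subspace S" shows "subspace (closure S)"
  unfolding subspace_def
proof (intro conjI ballI allI)
  show "0 \<in> closure S" using subspace_0[OF assms] closure_subset by blast
next
  fix x y assume "x \<in> closure S" "y \<in> closure S"
  then obtain f g where fg: "\<forall>n. f n \<in> S" "f \<longlonglongrightarrow> x" "\<forall>n. g n \<in> S" "g \<longlonglongrightarrow> y"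
    unfolding closure_sequential by blast
  show "x + y \<in> closure S"
    unfolding closure_sequential
    by (rule exI[of _ "\<lambda>n. f n + g n"]) (use fg in \<open>auto intro: subspace_add[OF assms] tendsto_add\<close>)
next
  fix x and c :: real assume "x \<in> closure S"
  then obtain f where f: "\<forall>n. f n \<in> S" "f \<longlonglongrightarrow> x"
    unfolding closure_sequential by blast
  show "c *\<^sub>R x \<in> closure S"
    unfolding closure_sequential
    by (rule exI[of _ "\<lambda>n. c *\<^sub>R f n"]) (use f in \<open>auto intro: subspace_scale[OF assms] tendsto_intros\<close>)
qed

lemma subspace_bilap_graph: "subspace (bilap_graph \<Omega>)"
  unfolding bilap_graph_def
proof (rule subspace_closure_real_normed)
  show "subspace {(L2_class \<phi>, L2_class (laplacian \<phi>)) | \<phi>. \<phi> \<in> Cc_inf \<Omega>}" (is "subspace ?G")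
    unfolding subspace_def
  proof (intro conjI ballI allI)
    have 0: "(\<lambda>x. 0) \<in> Cc_inf \<Omega>"
      by (rule Cc_infI[of _ "{}"]) (auto intro: smooth_fun_const)
    have "laplacian (\<lambda>x::'a. 0) = (\<lambda>x. 0)" by (rule ext) (rule laplacian_const)
    then show "0 \<in> ?G"
      using 0 by (force simp: L2_class_zero zero_prod_def)
  next
    fix p q assume "p \<in> ?G" "q \<in> ?G"
    then obtain \<phi> \<psi> where m: "\<phi> \<in> Cc_inf \<Omega>" "\<psi> \<in> Cc_inf \<Omega>"
      and p: "p = (L2_class \<phi>, L2_class (laplacian \<phi>))" and q: "q = (L2_class \<psi>, L2_class (laplacian \<psi>))"
      by blast
    have "p + q = (L2_class (\<lambda>x. \<phi> x + \<psi> x), L2_class (laplacian (\<lambda>x. \<phi> x + \<psi> x)))"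
      using m by (simp add: p q laplacian_add Cc_inf_smooth L2_class_add Cc_inf_L2fun[of _ \<Omega>] Cc_inf_laplacian)
    then show "p + q \<in> ?G" using Cc_inf_add[OF m] by blast
  next
    fix p and c :: real assume "p \<in> ?G"
    then obtain \<phi> where m: "\<phi> \<in> Cc_inf \<Omega>" and p: "p = (L2_class \<phi>, L2_class (laplacian \<phi>))" by blast
    have "c *\<^sub>R p = (L2_class (\<lambda>x. c * \<phi> x), L2_class (laplacian (\<lambda>x. c * \<phi> x)))"
      using m by (simp add: p laplacian_scale Cc_inf_smooth L2_class_scale Cc_inf_L2fun[of _ \<Omega>] Cc_inf_laplacian)
    then show "c *\<^sub>R p \<in> ?G" using Cc_inf_scale[OF m, of c] by blast
  qed
qed

section \<open>The graph closure and the eigenvalue problem of the definitions\<close>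

lemma H20_iff_graph:
  "H20 \<Omega> U V \<longleftrightarrow> L2fun U \<and> L2fun V \<and> (L2_class U, L2_class V) \<in> bilap_graph \<Omega>"
proof (cases "L2fun U \<and> L2fun V")
  case True
  have eq: "(\<lambda>n. \<integral>x. (\<phi> n x - U x)\<^sup>2 \<partial>lebesgue) \<longlonglongrightarrow> 0 \<longleftrightarrow> (\<lambda>n. L2_class (\<phi> n)) \<longlonglongrightarrow> L2_class U"
    "(\<lambda>n. \<integral>x. (laplacian (\<phi> n) x - V x)\<^sup>2 \<partial>lebesgue) \<longlonglongrightarrow> 0 \<longleftrightarrow> (\<lambda>n. L2_class (laplacian (\<phi> n))) \<longlonglongrightarrow> L2_class V"
    if "\<forall>n. \<phi> n \<in> Cc_inf \<Omega>" for \<phi>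
    using that True by (auto intro!: tendsto_L2_class_iff[symmetric] Cc_inf_L2fun Cc_inf_laplacian)
  have "H20 \<Omega> U V \<longleftrightarrow> (\<exists>\<phi>. (\<forall>n. \<phi> n \<in> Cc_inf \<Omega>) \<and> (\<lambda>n. L2_class (\<phi> n)) \<longlonglongrightarrow> L2_class U \<and>
      (\<lambda>n. L2_class (laplacian (\<phi> n))) \<longlonglongrightarrow> L2_class V)"
    unfolding H20_def using True eq by meson
  also have "\<dots> \<longleftrightarrow> (L2_class U, L2_class V) \<in> bilap_graph \<Omega>"
    using bilap_graphI[of _ \<Omega>] by (auto elim!: bilap_graph_sequence)
  finally show ?thesis using True by simp
qed (auto simp: H20_def)

lemma bilap_eigen_iff:
  "bilap_eigen \<Omega> \<kappa> U \<longleftrightarrow> L2fun U \<and> form_eigen (bilap_graph \<Omega>) \<kappa> (L2_class U)"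
proof
  assume "bilap_eigen \<Omega> \<kappa> U"
  then obtain V where V: "H20 \<Omega> U V"
    "\<And>\<phi> \<psi>. H20 \<Omega> \<phi> \<psi> \<Longrightarrow> (\<integral>x. V x * \<psi> x \<partial>lebesgue) = \<kappa> * (\<integral>x. U x * \<phi> x \<partial>lebesgue)"
    by (auto simp: bilap_eigen_def)
  have UV: "L2fun U" "L2fun V" "(L2_class U, L2_class V) \<in> bilap_graph \<Omega>"
    using V(1) by (auto simp: H20_iff_graph)
  have "inner (L2_class V) q = \<kappa> * inner (L2_class U) p" if "(p, q) \<in> bilap_graph \<Omega>" for p q
  proof -
    obtain \<phi> where \<phi>: "p = L2_class \<phi>" "L2fun \<phi>" by (rule L2_class_cases)
    obtain \<psi> where \<psi>: "q = L2_class \<psi>" "L2fun \<psi>" by (rule L2_class_cases)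
    have "H20 \<Omega> \<phi> \<psi>" using that \<phi> \<psi> by (simp add: H20_iff_graph)
    from V(2)[OF this] show ?thesis using \<phi> \<psi> UV by (simp add: inner_L2_class)
  qed
  then show "L2fun U \<and> form_eigen (bilap_graph \<Omega>) \<kappa> (L2_class U)"
    using UV by (auto simp: form_eigen_def)
next
  assume "L2fun U \<and> form_eigen (bilap_graph \<Omega>) \<kappa> (L2_class U)"
  then obtain v where U: "L2fun U" and v: "(L2_class U, v) \<in> bilap_graph \<Omega>"
    "\<And>p q. (p, q) \<in> bilap_graph \<Omega> \<Longrightarrow> inner v q = \<kappa> * inner (L2_class U) p"
    by (auto simp: form_eigen_def)
  obtain V where V: "v = L2_class V" "L2fun V" by (rule L2_class_cases)
  have "(\<integral>x. V x * \<psi> x \<partial>lebesgue) = \<kappa> * (\<integral>x. U x * \<phi> x \<partial>lebesgue)" if "H20 \<Omega> \<phi> \<psi>" for \<phi> \<psi>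
    using that v(2)[of "L2_class \<phi>" "L2_class \<psi>"] U V by (simp add: H20_iff_graph inner_L2_class)
  moreover have "H20 \<Omega> U V" using U V v(1) by (simp add: H20_iff_graph)
  ultimately show "bilap_eigen \<Omega> \<kappa> U" by (auto simp: bilap_eigen_def)
qed

section \<open>The Berezin--Li--Yau bound and compactness\<close>

definition well :: "real \<Rightarrow> 'a::euclidean_space \<Rightarrow> real" where
  "well R \<xi> = max (R - norm \<xi> ^ 4) 0"

lemma well_nonneg [simp]: "0 \<le> well R \<xi>"
  by (simp add: well_def)

lemma well_measurable [measurable]: "well R \<in> borel_measurable borel"
  unfolding well_def[abs_def] by measurable

lemma
  assumes "0 \<le> R"
  shows integrable_well: "integrable lborel (well R :: 'a::euclidean_space \<Rightarrow> real)"
    and integral_well: "integral\<^sup>L lborel (well R :: 'a \<Rightarrow> real) =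
      4 / (real DIM('a) + 4) * unit_ball_vol (real DIM('a)) * R powr (1 + real DIM('a) / 4)" (is "?I = ?J")
proof -
  have nn: "(\<integral>\<^sup>+\<xi>. ennreal (well R (\<xi>::'a)) \<partial>lborel) = ennreal ?J"
    unfolding well_def by (rule nn_integral_quartic_well[OF assms])
  show i: "integrable lborel (well R :: 'a \<Rightarrow> real)"
    by (rule integrableI_nonneg) (auto simp: nn)
  show "?I = ?J"
    by (rule integral_eq_nn_integral[THEN trans]) (auto simp: nn enn2real_ennreal)
qed

locale finite_domain =
  fixes \<Omega> :: "'a::euclidean_space set"
  assumes open_domain: "open \<Omega>" and domain_nonempty: "\<Omega> \<noteq> {}"
    and domain_finite: "emeasure lebesgue \<Omega> < \<infinity>"
begin

abbreviation "fp \<equiv> wpow (indicator \<Omega>)"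
abbreviation "vol \<equiv> measure lebesgue \<Omega>"
abbreviation "\<Gamma> \<equiv> bilap_graph \<Omega>"
abbreviation "eigen \<equiv> form_eigen \<Gamma>"

lemma domain_sets [measurable]: "\<Omega> \<in> sets borel" "\<Omega> \<in> sets lebesgue"
  using open_domain by auto

lemma L2fun_indicator: "L2fun (indicator \<Omega>)"
  and norm_indicator: "(norm (L2_class (indicator \<Omega>)))\<^sup>2 = vol"
proof -
  have "(\<lambda>x. (indicator \<Omega> x :: real)\<^sup>2) = indicator \<Omega>"
    by (auto simp: fun_eq_iff indicator_def)
  moreover have "integrable lebesgue (indicator \<Omega> :: 'a \<Rightarrow> real)"
    using domain_finite by (intro integrable_real_indicator) auto
  ultimately show L: "L2fun (indicator \<Omega>)"
    by (simp add: L2fun_def)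
  show "(norm (L2_class (indicator \<Omega>)))\<^sup>2 = vol"
    unfolding norm_L2_class_sq[OF L] \<open>(\<lambda>x. (indicator \<Omega> x :: real)\<^sup>2) = indicator \<Omega>\<close> by simp
qed

lemma fp_measurable [measurable]: "fp f \<in> borel_measurable borel"
  by (rule wpow_measurable[OF L2fun_indicator])

lemma fp_le: "fp f \<xi> \<le> (norm f)\<^sup>2 * vol"
  using wpow_le[OF L2fun_indicator] by (simp add: norm_indicator)

lemma fp_class:
  assumes "\<phi> \<in> Cc_inf \<Omega>"
  shows "fp (L2_class \<phi>) = fpow \<phi>"
proof
  fix \<xi>
  have eq: "(\<lambda>x. \<phi> x * indicator \<Omega> x) = \<phi>"
    using Cc_inf_zero[OF assms] by (auto simp: fun_eq_iff indicator_def)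
  show "fp (L2_class \<phi>) \<xi> = fpow \<phi> \<xi>"
    using wpow_class[OF assms L2fun_indicator] Cc_inf_measurable[OF assms] by (simp add: eq)
qed

lemma fpow_integrals:
  assumes "\<phi> \<in> Cc_inf \<Omega>"
  shows "integrable lborel (fpow \<phi>)" "integral\<^sup>L lborel (fpow \<phi>) = (2 * pi) ^ DIM('a) * (norm (L2_class \<phi>))\<^sup>2"
proof -
  have [measurable]: "\<phi> \<in> borel_measurable borel" by (rule Cc_inf_measurable[OF assms])
  have n: "(norm (L2_class \<phi>))\<^sup>2 = (\<integral>x. (\<phi> x)\<^sup>2 \<partial>lborel)"
    by (simp add: norm_L2_class_sq Cc_inf_L2fun[OF assms] integral_lebesgue_borel)
  have nn: "(\<integral>\<^sup>+\<xi>. ennreal (fpow \<phi> \<xi>) \<partial>lborel) = ennreal ((2 * pi) ^ DIM('a) * (norm (L2_class \<phi>))\<^sup>2)"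
    unfolding n by (rule plancherel[OF assms])
  have nonneg: "0 \<le> fpow \<phi> \<xi>" for \<xi> by (simp add: fpow_def)
  show "integrable lborel (fpow \<phi>)"
    by (rule integrableI_nonneg) (auto simp: nn nonneg)
  show "integral\<^sup>L lborel (fpow \<phi>) = (2 * pi) ^ DIM('a) * (norm (L2_class \<phi>))\<^sup>2"
    by (rule integral_eq_nn_integral[THEN trans]) (auto simp: nn nonneg)
qed

lemma integrable_well_fp: "0 \<le> R \<Longrightarrow> integrable lborel (\<lambda>\<xi>. well R \<xi> * fp f \<xi>)"
proof (rule Bochner_Integration.integrable_bound)
  show "0 \<le> R \<Longrightarrow> integrable lborel (\<lambda>\<xi>::'a. (norm f)\<^sup>2 * vol * well R \<xi>)"
    by (intro integrable_mult_right integrable_well)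
  have "well R \<xi> * fp f \<xi> \<le> (norm f)\<^sup>2 * vol * well R \<xi>" for \<xi> :: 'a
    using fp_le[of f \<xi>] mult_left_mono[of "fp f \<xi>" "(norm f)\<^sup>2 * vol" "well R \<xi>"]
    by (simp add: mult.commute)
  then show "AE \<xi> in lborel. norm (well R \<xi> * fp f \<xi>) \<le> norm ((norm f)\<^sup>2 * vol * well R \<xi>)"
    by simp
qed measurable

text \<open>On test functions this is Plancherel for the function and its Laplacian, with R - |xi|^4
  <= \<open>well R\<close>. Reaching the closed graph is a limit passage: the transforms are bounded
  by K^2 vol, so an integrable multiple of \<open>well R\<close> dominates the right-hand
  side.\<close>

lemma quadratic_form_bound:
  assumes "(f, h) \<in> \<Gamma>" and R: "0 \<le> R"
  shows "(2 * pi) ^ DIM('a) * (R * (norm f)\<^sup>2 - (norm h)\<^sup>2) \<le> (\<integral>\<xi>. well R \<xi> * fp f \<xi> \<partial>lborel)"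
proof -
  obtain \<phi> where \<phi>: "\<forall>n. \<phi> n \<in> Cc_inf \<Omega>" "(\<lambda>n. L2_class (\<phi> n)) \<longlonglongrightarrow> f"
    "(\<lambda>n. L2_class (laplacian (\<phi> n))) \<longlonglongrightarrow> h"
    using assms(1) by (rule bilap_graph_sequence)
  let ?q = "\<lambda>n. (2 * pi) ^ DIM('a) * (R * (norm (L2_class (\<phi> n)))\<^sup>2 - (norm (L2_class (laplacian (\<phi> n))))\<^sup>2)"
    and ?p = "\<lambda>n. \<integral>\<xi>. well R \<xi> * fp (L2_class (\<phi> n)) \<xi> \<partial>lborel"
  have step: "?q n
      \<le> ?p n" for n
  proof -
    have \<phi>n: "\<phi> n \<in> Cc_inf \<Omega>" using \<phi>(1) by blast
    note A = fpow_integrals[OF \<phi>n] and B = fpow_integrals[OF Cc_inf_laplacian[OF \<phi>n]]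
    have "?q n
      = R * integral\<^sup>L lborel (fpow (\<phi> n)) - integral\<^sup>L lborel (fpow (laplacian (\<phi> n)))"
      by (simp add: A B algebra_simps)
    also have "\<dots> = (\<integral>\<xi>. R * fpow (\<phi> n) \<xi> - fpow (laplacian (\<phi> n)) \<xi> \<partial>lborel)"
      using A(1) B(1) by simp
    also have "\<dots> \<le> ?p n"
    proof (rule integral_mono)
      show "integrable lborel (\<lambda>\<xi>. R * fpow (\<phi> n) \<xi> - fpow (laplacian (\<phi> n)) \<xi>)"
        using A(1) B(1) by simp
      fix \<xi> :: 'a
      have "R * fpow (\<phi> n) \<xi> - fpow (laplacian (\<phi> n)) \<xi> = (R - norm \<xi> ^ 4) * fpow (\<phi> n) \<xi>"
        by (simp add: fpow_laplacian[OF \<phi>n] algebra_simps)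
      also have "\<dots> \<le> well R \<xi> * fpow (\<phi> n) \<xi>"
        by (rule mult_right_mono) (auto simp: well_def fpow_def)
      finally show "R * fpow (\<phi> n) \<xi> - fpow (laplacian (\<phi> n)) \<xi> \<le> well R \<xi> * fp (L2_class (\<phi> n)) \<xi>"
        by (simp add: fp_class[OF \<phi>n])
    qed (rule integrable_well_fp[OF R])
    finally show ?thesis .
  qed
  have lim1: "(\<lambda>n. ?q n)
      \<longlonglongrightarrow> (2 * pi) ^ DIM('a) * (R * (norm f)\<^sup>2 - (norm h)\<^sup>2)"
    by (intro tendsto_intros \<phi>)
  have "Bseq (\<lambda>n. L2_class (\<phi> n))"
    using \<phi>(2) by (intro convergent_imp_Bseq) (auto simp: convergent_def)
  then obtain K where K: "\<And>n. norm (L2_class (\<phi> n)) \<le> K"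
    by (auto simp: Bseq_def)
  have lim2: "(\<lambda>n. ?p n) \<longlonglongrightarrow> (\<integral>\<xi>. well R \<xi> * fp f \<xi> \<partial>lborel)"
  proof (rule integral_dominated_convergence[where w = "\<lambda>\<xi>. K\<^sup>2 * vol * well R \<xi>"])
    show "integrable lborel (\<lambda>\<xi>::'a. K\<^sup>2 * vol * well R \<xi>)"
      by (intro integrable_mult_right integrable_well R)
    show "AE \<xi> in lborel. (\<lambda>n. well R \<xi> * fp (L2_class (\<phi> n)) \<xi>) \<longlonglongrightarrow> well R \<xi> * fp f \<xi>"
      by (intro AE_I2 tendsto_intros wpow_tendsto \<phi>)
    have "well R \<xi> * fp (L2_class (\<phi> n)) \<xi> \<le> K\<^sup>2 * vol * well R \<xi>" for \<xi> :: 'a and n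
    proof -
      have "fp (L2_class (\<phi> n)) \<xi> \<le> (norm (L2_class (\<phi> n)))\<^sup>2 * vol" by (rule fp_le)
      also have "\<dots> \<le> K\<^sup>2 * vol" by (intro mult_right_mono power_mono K) auto
      finally have "well R \<xi> * fp (L2_class (\<phi> n)) \<xi> \<le> well R \<xi> * (K\<^sup>2 * vol)"
        by (rule mult_left_mono) simp
      then show ?thesis by (simp only: mult.commute)
    qed
    then show "AE \<xi> in lborel. norm (well R \<xi> * fp (L2_class (\<phi> n)) \<xi>) \<le> K\<^sup>2 * vol * well R \<xi>" for n
      by simp
  qed measurable
  show ?thesis
    by (rule LIMSEQ_le[OF lim1 lim2]) (use step in blast)
qed

text \<open>The eigen equation is tested with the eigenpair itself.\<close>

lemma form_eigen_norm:
  assumes "eigen \<kappa> u" "norm u = 1"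
  obtains v where "(u, v) \<in> \<Gamma>" "(norm v)\<^sup>2 = \<kappa>"
proof -
  obtain v where v: "(u, v) \<in> \<Gamma>"
    "\<And>p q. (p, q) \<in> \<Gamma> \<Longrightarrow> inner v q = \<kappa> * inner u p"
    using assms(1) by (auto simp: form_eigen_def)
  have "(norm v)\<^sup>2 = \<kappa>" using v(2)[OF v(1)] assms(2) by (simp add: power2_norm_eq_inner norm_eq_1)
  then show ?thesis using that v(1) by blast
qed

text \<open>For R >= 0 the frequency integral of (R - |xi|^4)_+, that is, the Weyl term up to the
  factor vol / (2 pi)^d.\<close>

definition weyl :: "real \<Rightarrow> real" where
  "weyl R = 4 / (real DIM('a) + 4) * unit_ball_vol (real DIM('a)) * R powr (1 + real DIM('a) / 4)"

lemma orthonormal_norm: "orthonormal B \<Longrightarrow> u \<in> B \<Longrightarrow> norm u = 1"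
  by (auto simp: orthonormal_def norm_eq_1)

theorem berezin_li_yau:
  assumes B: "finite B" "orthonormal B" "\<forall>u\<in>B. eigen (l u) u" and R: "0 \<le> R"
  shows "(2 * pi) ^ DIM('a) * (\<Sum>u\<in>B. R - l u) \<le> vol * weyl R"
proof -
  have "(2 * pi) ^ DIM('a) * (\<Sum>u\<in>B. R - l u) \<le> (\<Sum>u\<in>B. (\<integral>\<xi>. well R \<xi> * fp u \<xi> \<partial>lborel))"
    unfolding sum_distrib_left
  proof (rule sum_mono)
    fix u assume u: "u \<in> B"
    then have n: "norm u = 1" using B(2) by (rule orthonormal_norm[rotated])
    obtain v where "(u, v) \<in> \<Gamma>" "(norm v)\<^sup>2 = l u"
      using B(3) u n by (blast elim: form_eigen_norm)
    then show "(2 * pi) ^ DIM('a) * (R - l u) \<le> (\<integral>\<xi>. well R \<xi> * fp u \<xi> \<partial>lborel)"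
      using quadratic_form_bound[of u v R] R n by simp
  qed
  also have "\<dots> = (\<integral>\<xi>. (\<Sum>u\<in>B. well R \<xi> * fp u \<xi>) \<partial>lborel)"
    by (rule Bochner_Integration.integral_sum[symmetric]) (rule integrable_well_fp[OF R])
  also have "\<dots> \<le> (\<integral>\<xi>. vol * well R (\<xi>::'a) \<partial>lborel)"
  proof (rule integral_mono)
    show "integrable lborel (\<lambda>\<xi>. \<Sum>u\<in>B. well R \<xi> * fp u \<xi>)"
      by (intro Bochner_Integration.integrable_sum integrable_well_fp R)
    show "integrable lborel (\<lambda>\<xi>::'a. vol * well R \<xi>)"
      by (intro integrable_mult_right integrable_well R)
    show "(\<Sum>u\<in>B. well R \<xi> * fp u \<xi>) \<le> vol * well R \<xi>" for \<xi>
      using mult_right_mono[OF wpow_bessel[OF L2fun_indicator B(1,2), of \<xi>], of "well R \<xi>"]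
      by (simp add: norm_indicator sum_distrib_left mult.commute)
  qed
  also have "\<dots> = vol * weyl R"
    by (simp add: integral_well[OF R] weyl_def)
  finally show ?thesis .
qed

text \<open>Berezin--Li--Yau at a level at least one above \<open>R\<close>, where each eigenvalue
  below \<open>R\<close> contributes at least 1 to the sum; \<open>max R 0\<close> keeps that level
  nonnegative.\<close>

definition max_count :: "real \<Rightarrow> nat" where
  "max_count R = nat \<lceil>vol * weyl (max R 0 + 1) / (2 * pi) ^ DIM('a)\<rceil>"

lemma card_eigen_le:
  assumes B: "finite B" "orthonormal B" "\<forall>u\<in>B. eigen (l u) u \<and> l u < R"
  shows "card B \<le> max_count R"
proof -
  define S where "S = max R 0 + 1"
  have "(2 * pi) ^ DIM('a) * (\<Sum>u\<in>B. 1) \<le> (2 * pi) ^ DIM('a) * (\<Sum>u\<in>B. S - l u)"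
    using B(3) by (intro mult_left_mono sum_mono) (force simp: S_def)+
  also have "\<dots> \<le> vol * weyl S"
    by (rule berezin_li_yau) (use B in \<open>auto simp: S_def\<close>)
  finally have "real (card B) \<le> vol * weyl S / (2 * pi) ^ DIM('a)"
    by (simp add: field_simps)
  then show ?thesis
    unfolding max_count_def S_def by linarith
qed

text \<open>One subsequence must serve all frequencies: a diagonal argument settles a countable
  dense set, and norm continuity of \<open>c\<close> and \<open>s\<close> together with the bound
  \<open>M\<close> on \<open>F n\<close> extends convergence to the rest. \<open>E n\<close>
  measures the squared deviation of the transforms from their limit;
  \<open>quadratic_form_bound\<close>, applied to differences, then makes the subsequence
  Cauchy.\<close>

lemma bilap_graph_compact:
  assumes g: "\<And>n::nat. g n \<in> \<Gamma> \<and> norm (g n) \<le> M"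
  shows "\<exists>r::nat \<Rightarrow> nat. strict_mono r \<and> convergent (\<lambda>n. fst (g (r n)))"
proof -
  define F where "F n = fst (g n)" for n
  define c where "c \<xi> = cosw (indicator \<Omega>) \<xi>" for \<xi>
  define s where "s \<xi> = sinw (indicator \<Omega>) \<xi>" for \<xi>
  have M: "0 \<le> M" using g[of 0] norm_ge_zero[of "g 0"] by linarith
  have nF: "norm (F n) \<le> M" for n
    using g[of n] norm_fst_le[of "fst (g n)" "snd (g n)"] by (simp add: F_def)
  have nH: "norm (snd (g n)) \<le> M" for n
    using g[of n] norm_snd_le[of "snd (g n)" "fst (g n)"] by simp
  have cs: "(norm (c \<xi>))\<^sup>2 + (norm (s \<xi>))\<^sup>2 = vol" for \<xi>
    using trigw_norm[OF L2fun_indicator, of \<xi>] by (simp add: c_def s_def norm_indicator)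
  have nc: "norm (c \<xi>) \<le> sqrt vol" "norm (s \<xi>) \<le> sqrt vol" for \<xi>
    using cs[of \<xi>] by (auto intro!: real_le_rsqrt simp: add_increasing add_increasing2)
     (smt (verit) zero_le_power2)+
  define K where "K = M * sqrt vol"
  have bnd: "\<bar>inner (F n) w\<bar> \<le> K" if "norm w \<le> sqrt vol" for n w
  proof -
    have "\<bar>inner (F n) w\<bar> \<le> norm (F n) * norm w" by (rule Cauchy_Schwarz_ineq2)
    also have "\<dots> \<le> K" unfolding K_def by (intro mult_mono nF that M) auto
    finally show ?thesis .
  qed
  obtain D :: "'a set" where D: "countable D" "\<And>X. open X \<Longrightarrow> X \<noteq> {} \<Longrightarrow> \<exists>d\<in>D. d \<in> X"
    by (rule countable_dense_setE) blast
  have bnd2: "norm (inner (F n) (c \<xi>), inner (F n) (s \<xi>)) \<le> K + K" for n \<xi>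
    using norm_Pair_le[of "inner (F n) (c \<xi>)" "inner (F n) (s \<xi>)"] bnd[OF nc(1), of n \<xi>] bnd[OF nc(2), of n \<xi>]
    by simp
  obtain r :: "nat \<Rightarrow> nat" where r: "strict_mono r"
    "\<And>\<xi>. \<xi> \<in> D \<Longrightarrow> \<exists>l. (\<lambda>n. (inner (F (r n)) (c \<xi>), inner (F (r n)) (s \<xi>))) \<longlonglongrightarrow> l"
    by (rule function_convergent_subsequence[OF D(1), of "\<lambda>n \<xi>. (inner (F n) (c \<xi>), inner (F n) (s \<xi>))" "K + K"])
       (use bnd2 in auto)
  have conv: "convergent (\<lambda>n. inner (F (r n)) (w \<xi>))"
    if w: "continuous_on UNIV w" and wD: "\<And>\<xi>. \<xi> \<in> D \<Longrightarrow> convergent (\<lambda>n. inner (F (r n)) (w \<xi>))" for w :: "'a \<Rightarrow> 'a L2" and \<xi>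
  proof (rule Cauchy_convergent, rule CauchyI)
    fix e :: real assume e: "0 < e"
    \<comment> \<open>A three-term estimate, uniform in \<open>n\<close>, comparing \<xi> with a
      nearby point of \<open>D\<close>; M + 1 covers M = 0.\<close>
    define d where "d = e / (3 * (M + 1))"
    have d: "0 < d" using e M by (simp add: d_def)
    have "open (w -` ball (w \<xi>) d)"
      by (intro open_vimage open_ball w)
    moreover have "\<xi> \<in> w -` ball (w \<xi>) d" using d by simp
    then have "w -` ball (w \<xi>) d \<noteq> {}" by blast
    ultimately have "\<exists>\<eta>\<in>D. \<eta> \<in> w -` ball (w \<xi>) d" by (rule D(2))
    then obtain \<eta> where \<eta>: "\<eta> \<in> D" "dist (w \<xi>) (w \<eta>) < d" by auto
    have close: "\<bar>inner (F n) (w \<xi>) - inner (F n) (w \<eta>)\<bar> < e / 3" for n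
    proof -
      have "\<bar>inner (F n) (w \<xi> - w \<eta>)\<bar> \<le> norm (F n) * norm (w \<xi> - w \<eta>)" by (rule Cauchy_Schwarz_ineq2)
      also have "\<dots> \<le> M * d" using \<eta>(2) M by (intro mult_mono nF) (auto simp: dist_norm)
      also have "\<dots> < (M + 1) * d" using d by simp
      also have "\<dots> = e / 3" using M by (simp add: d_def field_simps)
      finally show ?thesis by (simp add: inner_diff_right)
    qed
    obtain N where N: "\<And>m n. m \<ge> N \<Longrightarrow> n \<ge> N \<Longrightarrow> norm (inner (F (r m)) (w \<eta>) - inner (F (r n)) (w \<eta>)) < e / 3"
      using CauchyD[OF convergent_Cauchy[OF wD[OF \<eta>(1)]], of "e / 3"] e by auto
    have "norm (inner (F (r m)) (w \<xi>) - inner (F (r n)) (w \<xi>)) < e" if "m \<ge> N" "n \<ge> N" for m n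
      using N[OF that] close[of "r m"] close[of "r n"] unfolding real_norm_def by linarith
    then show "\<exists>N. \<forall>m\<ge>N. \<forall>n\<ge>N. norm (inner (F (r m)) (w \<xi>) - inner (F (r n)) (w \<xi>)) < e" by blast
  qed
  have convc: "convergent (\<lambda>n. inner (F (r n)) (c \<xi>))" and convs: "convergent (\<lambda>n. inner (F (r n)) (s \<xi>))" for \<xi>
  proof -
    have "convergent (\<lambda>n. inner (F (r n)) (c \<eta>)) \<and> convergent (\<lambda>n. inner (F (r n)) (s \<eta>))" if D: "\<eta> \<in> D" for \<eta>
    proof -
      from r(2)[OF D] obtain l where "(\<lambda>n. (inner (F (r n)) (c \<eta>), inner (F (r n)) (s \<eta>))) \<longlonglongrightarrow> l" ..
      from tendsto_fst[OF this] tendsto_snd[OF this] show ?thesis by (auto simp: convergent_def)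
    qed
    moreover have "continuous_on UNIV c" "continuous_on UNIV s"
      unfolding c_def[abs_def] s_def[abs_def] by (rule continuous_trigw[OF L2fun_indicator])+
    ultimately show "convergent (\<lambda>n. inner (F (r n)) (c \<xi>))" "convergent (\<lambda>n. inner (F (r n)) (s \<xi>))"
      by (blast intro: conv)+
  qed
  define \<alpha> where "\<alpha> \<xi> = lim (\<lambda>n. inner (F (r n)) (c \<xi>))" for \<xi>
  define \<beta> where "\<beta> \<xi> = lim (\<lambda>n. inner (F (r n)) (s \<xi>))" for \<xi>
  have \<alpha>: "(\<lambda>n. inner (F (r n)) (c \<xi>)) \<longlonglongrightarrow> \<alpha> \<xi>" and \<beta>: "(\<lambda>n. inner (F (r n)) (s \<xi>)) \<longlonglongrightarrow> \<beta> \<xi>" for \<xi>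
    unfolding \<alpha>_def \<beta>_def using convc convs by (auto simp: convergent_LIMSEQ_iff)
  have cm: "(\<lambda>\<xi>. inner f (c \<xi>)) \<in> borel_measurable borel" "(\<lambda>\<xi>. inner f (s \<xi>)) \<in> borel_measurable borel" for f
    unfolding c_def s_def
    by (intro borel_measurable_continuous_onI continuous_intros continuous_trigw L2fun_indicator)+
  note [measurable] = cm
  have [measurable]: "\<alpha> \<in> borel_measurable borel" "\<beta> \<in> borel_measurable borel"
    unfolding \<alpha>_def[abs_def] \<beta>_def[abs_def] by measurable
  have \<alpha>K: "\<bar>\<alpha> \<xi>\<bar> \<le> K" and \<beta>K: "\<bar>\<beta> \<xi>\<bar> \<le> K" for \<xi>
    using LIMSEQ_le_const2[OF tendsto_rabs[OF \<alpha>[of \<xi>]], of K] LIMSEQ_le_const2[OF tendsto_rabs[OF \<beta>[of \<xi>]], of K]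
      bnd[OF nc(1)] bnd[OF nc(2)] by auto
  define E where "E n \<xi> = (inner (F (r n)) (c \<xi>) - \<alpha> \<xi>)\<^sup>2 + (inner (F (r n)) (s \<xi>) - \<beta> \<xi>)\<^sup>2" for n \<xi>
  have E0: "0 \<le> E n \<xi>" for n \<xi> by (simp add: E_def)
  have Em[measurable]: "E n \<in> borel_measurable borel" for n
    unfolding E_def[abs_def] by measurable
  \<comment> \<open>Each of the two deviations is at most 2 K, so their squares sum to at most 8
    K^2.\<close>
  have EK: "E n \<xi> \<le> 8 * K\<^sup>2" for n \<xi>
  proof -
    have sq: "(a - b)\<^sup>2 \<le> 4 * K\<^sup>2" if "\<bar>a\<bar> \<le> K" "\<bar>b\<bar> \<le> K" for a b
    proof -
      have "\<bar>a - b\<bar>\<^sup>2 \<le> (2 * K)\<^sup>2" by (rule power_mono) (use that in linarith, simp)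
      then show ?thesis by (simp add: power_mult_distrib)
    qed
    show ?thesis
      unfolding E_def using sq[OF bnd[OF nc(1)] \<alpha>K, of "r n" \<xi> \<xi>] sq[OF bnd[OF nc(2)] \<beta>K, of "r n" \<xi> \<xi>] by linarith
  qed
  have wEK: "well R \<xi> * E n \<xi> \<le> 8 * K\<^sup>2 * well R \<xi>" for R \<xi> n
    using mult_left_mono[OF EK[of n \<xi>], of "well R \<xi>"] by (simp add: mult.commute)
  have wE: "integrable lborel (\<lambda>\<xi>. well R \<xi> * E n \<xi>)" if "0 \<le> R" for R n
  proof (rule Bochner_Integration.integrable_bound)
    show "integrable lborel (\<lambda>\<xi>::'a. 8 * K\<^sup>2 * well R \<xi>)"
      by (intro integrable_mult_right integrable_well that)
    show "AE \<xi> in lborel. norm (well R \<xi> * E n \<xi>) \<le> norm (8 * K\<^sup>2 * well R \<xi>)"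
      using E0 wEK by simp
  qed measurable
  define J where "J R n = (\<integral>\<xi>. well R \<xi> * E n \<xi> \<partial>lborel)" for R n
  have Elim: "J R \<longlonglongrightarrow> 0" if "0 \<le> R" for R
  proof -
    have "(\<lambda>n. \<integral>\<xi>. well R \<xi> * E n \<xi> \<partial>lborel) \<longlonglongrightarrow> (\<integral>\<xi>. 0 \<partial>(lborel :: 'a measure))"
    proof (rule integral_dominated_convergence[where w = "\<lambda>\<xi>. 8 * K\<^sup>2 * well R \<xi>"])
      show "integrable lborel (\<lambda>\<xi>::'a. 8 * K\<^sup>2 * well R \<xi>)"
        by (intro integrable_mult_right integrable_well that)
      show "AE \<xi> in lborel. (\<lambda>n. well R \<xi> * E n \<xi>) \<longlonglongrightarrow> 0"
      proof (rule AE_I2)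
        fix \<xi> :: 'a
        have "(\<lambda>n. well R \<xi> * E n \<xi>) \<longlonglongrightarrow> well R \<xi> * ((\<alpha> \<xi> - \<alpha> \<xi>)\<^sup>2 + (\<beta> \<xi> - \<beta> \<xi>)\<^sup>2)"
          unfolding E_def by (intro tendsto_intros \<alpha> \<beta>)
        then show "(\<lambda>n. well R \<xi> * E n \<xi>) \<longlonglongrightarrow> 0" by simp
      qed
      show "AE \<xi> in lborel. norm (well R \<xi> * E n \<xi>) \<le> 8 * K\<^sup>2 * well R \<xi>" for n
        using E0 wEK by simp
    qed measurable
    then show ?thesis by (simp add: J_def[abs_def])
  qed
  let ?d = "\<lambda>m n. (norm (F (r m) - F (r n)))\<^sup>2" and ?e = "\<lambda>m n. (norm (snd (g (r m)) - snd (g (r n))))\<^sup>2"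
  have bound: "R * ?d m n \<le> 4 * M\<^sup>2 +
      (2 * J R m + 2 * J R n)" if R: "0 \<le> R" for R m n
  proof -
    have "g (r m) - g (r n) \<in> \<Gamma>"
      using subspace_diff[OF subspace_bilap_graph] g by blast
    then have "(fst (g (r m) - g (r n)), snd (g (r m) - g (r n))) \<in> \<Gamma>"
      by (simp only: prod.collapse)
    from quadratic_form_bound[OF this R]
    have q: "(2 * pi) ^ DIM('a) * (R * ?d m n - ?e m n)
        \<le> (\<integral>\<xi>. well R \<xi> * fp (F (r m) - F (r n)) \<xi> \<partial>lborel)"
      by (simp add: F_def)
    also have "\<dots> \<le> (\<integral>\<xi>. 2 * (well R \<xi> * E m \<xi>) + 2 * (well R \<xi> * E n \<xi>) \<partial>lborel)"
    proof (rule integral_mono)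
      show "integrable lborel (\<lambda>\<xi>. 2 * (well R \<xi> * E m \<xi>) + 2 * (well R \<xi> * E n \<xi>))"
        using wE[OF R] by simp
      fix \<xi>
      have sq: "(a - b)\<^sup>2 \<le> 2 * (a - t)\<^sup>2 + 2 * (b - t)\<^sup>2" for a b t :: real
        using zero_le_power2[of "(a - t) + (b - t)"] by (simp add: power2_eq_square algebra_simps)
      have comb: "x + y \<le> 2 * (a + a') + 2 * (b + b')"
        if "x \<le> 2 * a + 2 * b" "y \<le> 2 * a' + 2 * b'" for x y a b a' b' :: real
        using that by simp
      have "fp (F (r m) - F (r n)) \<xi> \<le> 2 * E m \<xi> + 2 * E n \<xi>"
        unfolding wpow_def E_def c_def[symmetric] s_def[symmetric] inner_diff_left
        by (rule comb[OF sq sq])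
      from mult_left_mono[OF this, of "well R \<xi>"]
      show "well R \<xi> * fp (F (r m) - F (r n)) \<xi> \<le> 2 * (well R \<xi> * E m \<xi>) + 2 * (well R \<xi> * E n \<xi>)"
        by (simp add: algebra_simps)
    qed (rule integrable_well_fp[OF R])
    also have "\<dots> = 2 * J R m + 2 * J R n" (is "_ = ?I")
      using wE[OF R] by (simp add: J_def)
    finally have 1: "(2 * pi) ^ DIM('a) * (R * ?d m n - ?e m n) \<le> ?I" .
    have "1 \<le> 2 * pi" using pi_gt3 by simp
    then have p1: "1 \<le> (2 * pi) ^ DIM('a)" by (rule one_le_power)
    have I0: "0 \<le> ?I"
      unfolding J_def by (intro add_nonneg_nonneg mult_nonneg_nonneg integral_nonneg_AE) (auto simp: E0)
    have "R * ?d m n - ?e m n \<le> ?I"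
    proof (cases "0 \<le> R * ?d m n - ?e m n")
      case True
      from order_trans[OF mult_right_mono[OF p1 True] 1] show ?thesis by (simp only: mult_1)
    next
      case False
      then show ?thesis using I0 by (meson le_cases order_trans)
    qed
    moreover have "?e m n \<le> (2 * M)\<^sup>2"
      by (rule power_mono) (use norm_triangle_ineq4[of "snd (g (r m))" "snd (g (r n))"] nH[of "r m"] nH[of "r n"] in linarith, simp)
    ultimately show ?thesis by (simp add: power_mult_distrib)
  qed
  have "Cauchy (\<lambda>n. F (r n))"
  proof (rule CauchyI)
    fix e :: real assume e: "0 < e"
    \<comment> \<open>Once \<open>J R m\<close> and \<open>J R n\<close> are below 1,
      \<open>bound\<close> gives less than 4 M^2 + 4 for R times the squared distance; the numerator
      is chosen above this value.\<close>
    define R where "R = (4 * M\<^sup>2 + 5) / e\<^sup>2"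
    have R: "0 \<le> R" by (simp add: R_def)
    obtain N where N: "\<And>n. n \<ge> N \<Longrightarrow> J R n < 1"
      using order_tendstoD(2)[OF Elim[OF R], of 1] by (auto simp: eventually_sequentially)
    have "norm (F (r m) - F (r n)) < e" if "m \<ge> N" "n \<ge> N" for m n
    proof (rule power2_less_imp_less)
      have "R * ?d m n < 4 * M\<^sup>2 + 5"
        using bound[OF R, of m n] N[OF that(1)] N[OF that(2)] by linarith
      also have "\<dots> = R * e\<^sup>2" using e by (simp add: R_def)
      finally show "?d m n < e\<^sup>2"
        using R by (simp add: mult_less_cancel_left)
    qed (use e in simp)
    then show "\<exists>N. \<forall>m\<ge>N. \<forall>n\<ge>N. norm (F (r m) - F (r n)) < e" by blast
  qed
  then have "convergent (\<lambda>n. fst (g (r n)))"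
    using Cauchy_convergent by (simp add: F_def)
  with r(1) show ?thesis by blast
qed

sublocale compact_form \<Gamma>
proof
  show "subspace (\<Gamma>)" by (rule subspace_bilap_graph)
  show "closed (\<Gamma>)" by (simp add: bilap_graph_def)
qed (rule bilap_graph_compact)

end

section \<open>Trial functions for the lower bound\<close>

text \<open>Controls, up to the factor 1 + |xi|^2, all but the leading term |xi|^4 \<phi>^2 of
  |Laplacian (\<phi> e_xi)|^2. The 4 comes from squaring the mixed term 2 grad \<phi> . xi.\<close>

definition energy :: "('a::euclidean_space \<Rightarrow> real) \<Rightarrow> 'a \<Rightarrow> real" where
  "energy \<phi> x = (\<phi> x)\<^sup>2 + (laplacian \<phi> x)\<^sup>2 + 4 * (\<Sum>i\<in>Basis. (pd i \<phi> x)\<^sup>2)"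

text \<open>With L the Laplacian of \<phi>, k = |xi|^2 and g = grad \<phi> . xi, the Laplacian of
  \<phi> e_xi is (L - k \<phi> + 2 i g) e_xi, of squared modulus (L - k \<phi>)^2 + 4 g^2.
  Cauchy--Schwarz bounds g^2, and - 2 k \<phi> L <= k (\<phi>^2 + L^2) handles the cross
  term.\<close>

lemma modulated_laplacian_bound:
  assumes "smooth_fun \<phi>"
  shows "(laplacian (\<lambda>x. \<phi> x * cos (inner x \<xi>)) x)\<^sup>2 + (laplacian (\<lambda>x. \<phi> x * sin (inner x \<xi>)) x)\<^sup>2
    \<le> norm \<xi> ^ 4 * (\<phi> x)\<^sup>2 + (1 + (norm \<xi>)\<^sup>2) * energy \<phi> x"
proof -
  define g where "g = (\<Sum>i\<in>Basis. pd i \<phi> x * inner i \<xi>)"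
  define k where "k = (norm \<xi>)\<^sup>2"
  define L where "L = laplacian \<phi> x"
  define G where "G = (\<Sum>i\<in>Basis. (pd i \<phi> x)\<^sup>2)"
  define c where "c = cos (inner x \<xi>)"
  define s where "s = sin (inner x \<xi>)"
  have n: "k = (\<Sum>i\<in>Basis. (inner i \<xi>)\<^sup>2)"
    unfolding k_def power2_norm_eq_inner by (subst euclidean_inner) (simp add: power2_eq_square inner_commute)
  have C: "laplacian (\<lambda>x. \<phi> x * cos (inner x \<xi>)) x = (L - k * \<phi> x) * c - 2 * g * s"
  proof -
    have "(\<Sum>i\<in>Basis. pd i \<phi> x * (- inner i \<xi> * s)) = - (g * s)"
      by (simp add: g_def sum_distrib_right sum_negf mult.assoc)
    then show ?thesis
      unfolding laplacian_mult[OF assms smooth_fun_cos_inner] laplacian_cos_inner pd_cos_inner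
        s_def[symmetric] c_def[symmetric] L_def[symmetric] k_def[symmetric]
      by (simp add: algebra_simps)
  qed
  have S: "laplacian (\<lambda>x. \<phi> x * sin (inner x \<xi>)) x = (L - k * \<phi> x) * s + 2 * g * c"
  proof -
    have "(\<Sum>i\<in>Basis. pd i \<phi> x * (inner i \<xi> * c)) = g * c"
      by (simp add: g_def sum_distrib_right mult.assoc)
    then show ?thesis
      unfolding laplacian_mult[OF assms smooth_fun_sin_inner] laplacian_sin_inner pd_sin_inner
        s_def[symmetric] c_def[symmetric] L_def[symmetric] k_def[symmetric]
      by (simp add: algebra_simps)
  qed
  have cs: "c\<^sup>2 + s\<^sup>2 = 1" by (simp add: c_def s_def)
  have "((L - k * \<phi> x) * c - 2 * g * s)\<^sup>2 + ((L - k * \<phi> x) * s + 2 * g * c)\<^sup>2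
      = ((L - k * \<phi> x)\<^sup>2 + 4 * g\<^sup>2) * (c\<^sup>2 + s\<^sup>2)"
    by (simp add: power2_eq_square algebra_simps)
  also have "\<dots> = (L - k * \<phi> x)\<^sup>2 + 4 * g\<^sup>2" by (simp add: cs)
  also have "\<dots> \<le> (L - k * \<phi> x)\<^sup>2 + 4 * (G * k)"
    unfolding g_def G_def n
    using Cauchy_Schwarz_ineq_sum[of "\<lambda>i. pd i \<phi> x" "\<lambda>i. inner i \<xi>" Basis] by simp
  also have "(L - k * \<phi> x)\<^sup>2 \<le> k\<^sup>2 * (\<phi> x)\<^sup>2 + k * ((\<phi> x)\<^sup>2 + L\<^sup>2) + L\<^sup>2"
  proof -
    have "0 \<le> k * (\<phi> x + L)\<^sup>2" by (simp add: k_def)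
    then show ?thesis by (simp add: power2_eq_square algebra_simps)
  qed
  also have "k\<^sup>2 * (\<phi> x)\<^sup>2 + k * ((\<phi> x)\<^sup>2 + L\<^sup>2) + L\<^sup>2 + 4 * (G * k)
      \<le> k\<^sup>2 * (\<phi> x)\<^sup>2 + (1 + k) * ((\<phi> x)\<^sup>2 + L\<^sup>2 + 4 * G)"
  proof -
    have "0 \<le> G" by (simp add: G_def sum_nonneg)
    then show ?thesis using zero_le_power2[of "\<phi> x"] by (simp add: algebra_simps)
  qed
  finally show ?thesis
    unfolding C S energy_def L_def[symmetric] G_def[symmetric] k_def[symmetric]
    by (simp add: k_def flip: power_mult)
qed

abbreviation "cosm \<phi> \<xi> \<equiv> \<lambda>x. \<phi> x * cos (inner x \<xi>)"
abbreviation "sinm \<phi> \<xi> \<equiv> \<lambda>x. \<phi> x * sin (inner x \<xi>)"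

context finite_domain
begin

text \<open>\<open>wpow \<phi> f\<close> is the power of the transform of \<phi> f, and |\<phi> f|
  <= |f|. Plancherel applies to the approximating test functions, and Fatou carries the inequality
  over to \<open>f\<close>.\<close>

lemma wpow_integral_le:
  assumes "(f, h) \<in> \<Gamma>" and \<phi>: "\<phi> \<in> Cc_inf \<Omega>" "\<And>x. \<bar>\<phi> x\<bar> \<le> 1"
  shows "(\<integral>\<^sup>+\<xi>. ennreal (wpow \<phi> f \<xi>) \<partial>lborel) \<le> ennreal ((2 * pi) ^ DIM('a) * (norm f)\<^sup>2)"
proof -
  obtain \<psi> where \<psi>: "\<forall>n. \<psi> n \<in> Cc_inf \<Omega>" "(\<lambda>n. L2_class (\<psi> n)) \<longlonglongrightarrow> f"
    "(\<lambda>n. L2_class (laplacian (\<psi> n))) \<longlonglongrightarrow> h"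
    using assms(1) by (rule bilap_graph_sequence)
  note L\<phi> = Cc_inf_L2fun[OF \<phi>(1)]
  have [measurable]: "wpow \<phi> f \<in> borel_measurable borel" for f by (rule wpow_measurable[OF L\<phi>])
  have step: "(\<integral>\<^sup>+\<xi>. ennreal (wpow \<phi> (L2_class (\<psi> n)) \<xi>) \<partial>lborel) \<le> ennreal ((2 * pi) ^ DIM('a) * (norm (L2_class (\<psi> n)))\<^sup>2)" for n
  proof -
    have \<psi>n: "\<psi> n \<in> Cc_inf \<Omega>" using \<psi>(1) by blast
    have m: "(\<lambda>x. \<psi> n x * \<phi> x) \<in> Cc_inf \<Omega>"
      by (rule Cc_inf_mult[OF \<psi>n Cc_inf_smooth[OF \<phi>(1)]])
    note mb [measurable] = Cc_inf_measurable[OF m] Cc_inf_measurable[OF \<psi>n]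
    have "(\<integral>\<^sup>+\<xi>. ennreal (wpow \<phi> (L2_class (\<psi> n)) \<xi>) \<partial>lborel) = (\<integral>\<^sup>+\<xi>. ennreal (fpow (\<lambda>x. \<psi> n x * \<phi> x) \<xi>) \<partial>lborel)"
      by (simp add: wpow_class[OF \<psi>n L\<phi> mb(1)])
    also have "\<dots> = ennreal ((2 * pi) ^ DIM('a) * (\<integral>x. (\<psi> n x * \<phi> x)\<^sup>2 \<partial>lborel))"
      by (rule plancherel[OF m])
    also have "\<dots> \<le> ennreal ((2 * pi) ^ DIM('a) * (norm (L2_class (\<psi> n)))\<^sup>2)"
    proof (intro ennreal_leI mult_left_mono)
      have "(\<integral>x. (\<psi> n x * \<phi> x)\<^sup>2 \<partial>lebesgue) \<le> (\<integral>x. (\<psi> n x)\<^sup>2 \<partial>lebesgue)"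
      proof (rule integral_mono)
        show "integrable lebesgue (\<lambda>x. (\<psi> n x * \<phi> x)\<^sup>2)" "integrable lebesgue (\<lambda>x. (\<psi> n x)\<^sup>2)"
          using L2funD(2)[OF Cc_inf_L2fun[OF m]] L2funD(2)[OF Cc_inf_L2fun[OF \<psi>n]] by auto
        fix x
        have "\<bar>\<phi> x\<bar>\<^sup>2 \<le> 1\<^sup>2" by (rule power_mono[OF \<phi>(2)]) simp
        then show "(\<psi> n x * \<phi> x)\<^sup>2 \<le> (\<psi> n x)\<^sup>2"
          by (simp add: power_mult_distrib mult_left_le)
      qed
      then show "(\<integral>x. (\<psi> n x * \<phi> x)\<^sup>2 \<partial>lborel) \<le> (norm (L2_class (\<psi> n)))\<^sup>2"
        by (simp add: norm_L2_class_sq Cc_inf_L2fun[OF \<psi>n] integral_lebesgue_borel)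
    qed auto
    finally show ?thesis .
  qed
  have lim: "(\<lambda>n. ennreal ((2 * pi) ^ DIM('a) * (norm (L2_class (\<psi> n)))\<^sup>2)) \<longlonglongrightarrow> ennreal ((2 * pi) ^ DIM('a) * (norm f)\<^sup>2)"
    by (intro tendsto_ennrealI tendsto_intros \<psi>)
  have "(\<integral>\<^sup>+\<xi>. ennreal (wpow \<phi> f \<xi>) \<partial>lborel) = (\<integral>\<^sup>+\<xi>. liminf (\<lambda>n. ennreal (wpow \<phi> (L2_class (\<psi> n)) \<xi>)) \<partial>lborel)"
  proof (rule nn_integral_cong)
    fix \<xi>
    have "(\<lambda>n. ennreal (wpow \<phi> (L2_class (\<psi> n)) \<xi>)) \<longlonglongrightarrow> ennreal (wpow \<phi> f \<xi>)"
      by (intro tendsto_ennrealI wpow_tendsto \<psi>)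
    then show "ennreal (wpow \<phi> f \<xi>) = liminf (\<lambda>n. ennreal (wpow \<phi> (L2_class (\<psi> n)) \<xi>))"
      by (subst lim_imp_Liminf) auto
  qed
  also have "\<dots> \<le> liminf (\<lambda>n. \<integral>\<^sup>+\<xi>. ennreal (wpow \<phi> (L2_class (\<psi> n)) \<xi>) \<partial>lborel)"
    by (rule nn_integral_liminf) measurable
  also have "\<dots> \<le> liminf (\<lambda>n. ennreal ((2 * pi) ^ DIM('a) * (norm (L2_class (\<psi> n)))\<^sup>2))"
    by (rule Liminf_mono) (use step in simp)
  also have "\<dots> = ennreal ((2 * pi) ^ DIM('a) * (norm f)\<^sup>2)"
    by (rule lim_imp_Liminf[OF _ lim]) simp
  finally show ?thesis .
qed

lemma trial_energy:
  assumes \<phi>: "\<phi> \<in> Cc_inf \<Omega>"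
  shows "(norm (L2_class (laplacian (cosm \<phi> \<xi>))))\<^sup>2 + (norm (L2_class (laplacian (sinm \<phi> \<xi>))))\<^sup>2
    \<le> norm \<xi> ^ 4 * (norm (L2_class \<phi>))\<^sup>2 + (1 + (norm \<xi>)\<^sup>2) * integral\<^sup>L lebesgue (energy \<phi>)" (is "?c + ?s \<le> ?b")
proof -
  have c: "cosm \<phi> \<xi> \<in> Cc_inf \<Omega>" and s: "sinm \<phi> \<xi> \<in> Cc_inf \<Omega>"
    by (intro Cc_inf_mult \<phi> smooth_fun_cos_inner smooth_fun_sin_inner)+
  have sqi: "integrable lebesgue (\<lambda>x. (f x)\<^sup>2)" if "f \<in> Cc_inf \<Omega>" for f
    by (rule L2funD(2)[OF Cc_inf_L2fun[OF that]])
  have n: "(norm (L2_class f))\<^sup>2 = (\<integral>x. (f x)\<^sup>2 \<partial>lebesgue)" if "f \<in> Cc_inf \<Omega>" for f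
    by (rule norm_L2_class_sq[OF Cc_inf_L2fun[OF that]])
  note i = sqi[OF Cc_inf_laplacian[OF c]] sqi[OF Cc_inf_laplacian[OF s]]
  have ei: "integrable lebesgue (energy \<phi>)"
    unfolding energy_def[abs_def]
    by (intro Bochner_Integration.integrable_add integrable_mult_right Bochner_Integration.integrable_sum
        sqi \<phi> Cc_inf_laplacian Cc_inf_pd)
  have "?c
      + ?s
      = (\<integral>x. (laplacian (cosm \<phi> \<xi>) x)\<^sup>2 + (laplacian (sinm \<phi> \<xi>) x)\<^sup>2 \<partial>lebesgue)"
    using i by (simp add: n[OF Cc_inf_laplacian[OF c]] n[OF Cc_inf_laplacian[OF s]])
  also have "\<dots> \<le> (\<integral>x. norm \<xi> ^ 4 * (\<phi> x)\<^sup>2 + (1 + (norm \<xi>)\<^sup>2) * energy \<phi> x \<partial>lebesgue)"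
    by (intro integral_mono Bochner_Integration.integrable_add integrable_mult_right i sqi ei \<phi>
        modulated_laplacian_bound Cc_inf_smooth[OF \<phi>])
  also have "\<dots> = ?b"
    using sqi[OF \<phi>] ei by (simp add: n[OF \<phi>])
  finally show ?thesis .
qed

text \<open>Where |xi|^4 < (1 - \<delta>) R one has |xi|^2 <= sqrt R, so \<open>large\<close> bounds
  the error C (1 + |xi|^2) by \<delta> R A; what remains is A times the lowered well.\<close>

theorem riesz_lower:
  assumes \<phi>: "\<phi> \<in> Cc_inf \<Omega>" "\<And>x. \<bar>\<phi> x\<bar> \<le> 1" and R: "0 < R" and \<delta>: "0 < \<delta>" "\<delta> < 1"
    and large: "integral\<^sup>L lebesgue (energy \<phi>) * (1 + sqrt R) \<le> \<delta> * R * (norm (L2_class \<phi>))\<^sup>2"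
  obtains B l where "finite B" "orthonormal B" "\<forall>u\<in>B. eigen (l u) u" "\<forall>u\<in>B. l u < R"
    "(norm (L2_class \<phi>))\<^sup>2 * weyl ((1 - \<delta>) * R) \<le> (2 * pi) ^ DIM('a) * (\<Sum>u\<in>B. R - l u)"
proof -
  define A where "A = (norm (L2_class \<phi>))\<^sup>2"
  define C where "C = integral\<^sup>L lebesgue (energy \<phi>)"
  have A0: "0 \<le> A" by (simp add: A_def)
  have C0: "0 \<le> C" unfolding C_def
    by (intro integral_nonneg_AE AE_I2) (simp add: energy_def sum_nonneg)
  note L\<phi> = Cc_inf_L2fun[OF \<phi>(1)]
  have [measurable]: "wpow \<phi> f \<in> borel_measurable borel" for f by (rule wpow_measurable[OF L\<phi>])
  obtain B l where B: "finite B" "orthonormal B" "\<forall>u\<in>B. eigen (l u) u" "\<forall>u\<in>B. l u < R"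
    and bound: "\<forall>f h. (f, h) \<in> \<Gamma> \<longrightarrow> R * (norm f)\<^sup>2 - (norm h)\<^sup>2 \<le> (\<Sum>u\<in>B. (R - l u) * (inner f u)\<^sup>2)"
    by (rule spectral_bound[OF card_eigen_le])
  \<comment> \<open>The spectral bound is added up for the cosine and the sine trial function; their
    squared norms sum to A at every frequency.\<close>
  have pw: "R * A - norm \<xi> ^ 4 * A - C * (1 + (norm \<xi>)\<^sup>2) \<le> (\<Sum>u\<in>B. (R - l u) * wpow \<phi> u \<xi>)" for \<xi>
  proof -
    have c: "cosm \<phi> \<xi> \<in> Cc_inf \<Omega>" and s: "sinm \<phi> \<xi> \<in> Cc_inf \<Omega>"
      by (intro Cc_inf_mult \<phi> smooth_fun_cos_inner smooth_fun_sin_inner)+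
    have 1: "R * (norm (cosw \<phi> \<xi>))\<^sup>2 - (norm (L2_class (laplacian (cosm \<phi> \<xi>))))\<^sup>2
        \<le> (\<Sum>u\<in>B. (R - l u) * (inner (cosw \<phi> \<xi>) u)\<^sup>2)"
      using bound bilap_graph_smooth[OF c] unfolding cosw_def by blast
    have 2: "R * (norm (sinw \<phi> \<xi>))\<^sup>2 - (norm (L2_class (laplacian (sinm \<phi> \<xi>))))\<^sup>2
        \<le> (\<Sum>u\<in>B. (R - l u) * (inner (sinw \<phi> \<xi>) u)\<^sup>2)"
      using bound bilap_graph_smooth[OF s] unfolding sinw_def by blast
    have "R * A = R * (norm (cosw \<phi> \<xi>))\<^sup>2 + R * (norm (sinw \<phi> \<xi>))\<^sup>2"
      using trigw_norm[OF L\<phi>, of \<xi>] by (simp add: A_def flip: distrib_left)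
    moreover have "(\<Sum>u\<in>B. (R - l u) * wpow \<phi> u \<xi>) =
        (\<Sum>u\<in>B. (R - l u) * (inner (cosw \<phi> \<xi>) u)\<^sup>2) + (\<Sum>u\<in>B. (R - l u) * (inner (sinw \<phi> \<xi>) u)\<^sup>2)"
      by (simp add: wpow_def inner_commute distrib_left sum.distrib)
    moreover have "(norm (L2_class (laplacian (cosm \<phi> \<xi>))))\<^sup>2
      + (norm (L2_class (laplacian (sinm \<phi> \<xi>))))\<^sup>2 \<le> norm \<xi> ^ 4 * A + C * (1 + (norm \<xi>)\<^sup>2)"
      using trial_energy[OF \<phi>(1), of \<xi>] by (simp add: A_def C_def mult.commute)
    ultimately show ?thesis using 1 2 by linarith
  qed
  \<comment> \<open>Outside the lowered well the left side vanishes, and the right side is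
    nonnegative because all \<open>l u\<close> lie below \<open>R\<close>.\<close>
  have pw2: "A * well ((1 - \<delta>) * R) \<xi> \<le> (\<Sum>u\<in>B. (R - l u) * wpow \<phi> u \<xi>)" for \<xi>
  proof (cases "norm \<xi> ^ 4 < (1 - \<delta>) * R")
    case True
    have "((norm \<xi>)\<^sup>2)\<^sup>2 \<le> R"
    proof -
      have "((norm \<xi>)\<^sup>2)\<^sup>2 = norm \<xi> ^ 4" by (simp flip: power_mult)
      also have "\<dots> \<le> (1 - \<delta>) * R" using True by simp
      also have "\<dots> \<le> R" using \<delta> R by (simp add: algebra_simps)
      finally show ?thesis .
    qed
    then have "(norm \<xi>)\<^sup>2 \<le> sqrt R" by (rule real_le_rsqrt)
    then have "C * (1 + (norm \<xi>)\<^sup>2) \<le> C * (1 + sqrt R)" using C0 by (intro mult_left_mono) auto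
    also have "\<dots> \<le> \<delta> * R * A" using large by (simp add: A_def C_def)
    finally have "A * ((1 - \<delta>) * R - norm \<xi> ^ 4) \<le> R * A - norm \<xi> ^ 4 * A - C * (1 + (norm \<xi>)\<^sup>2)"
      by (simp add: algebra_simps)
    then show ?thesis using pw[of \<xi>] True by (simp add: well_def)
  next
    case False
    then have "well ((1 - \<delta>) * R) \<xi> = 0" by (simp add: well_def)
    moreover have "0 \<le> (\<Sum>u\<in>B. (R - l u) * wpow \<phi> u \<xi>)"
      using B(4) by (intro sum_nonneg mult_nonneg_nonneg) (auto intro: less_imp_le)
    ultimately show ?thesis by simp
  qed
  have R': "0 \<le> (1 - \<delta>) * R" using R \<delta> by simp
  have "ennreal (A * weyl ((1 - \<delta>) * R)) = (\<integral>\<^sup>+\<xi>. ennreal (A * well ((1 - \<delta>) * R) (\<xi>::'a)) \<partial>lborel)"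
    using integrable_well[OF R', where 'a='a] A0
    by (subst nn_integral_eq_integral) (auto simp: integral_well[OF R'] weyl_def)
  also have "\<dots> \<le> (\<integral>\<^sup>+\<xi>. (\<Sum>u\<in>B. ennreal (R - l u) * ennreal (wpow \<phi> u \<xi>)) \<partial>lborel)"
  proof (rule nn_integral_mono)
    fix \<xi> :: 'a
    have "ennreal (A * well ((1 - \<delta>) * R) \<xi>) \<le> ennreal (\<Sum>u\<in>B. (R - l u) * wpow \<phi> u \<xi>)"
      by (rule ennreal_leI[OF pw2])
    also have "\<dots> = (\<Sum>u\<in>B. ennreal (R - l u) * ennreal (wpow \<phi> u \<xi>))"
      using B(4) by (subst sum_ennreal[symmetric]) (auto simp: ennreal_mult' less_imp_le)
    finally show "ennreal (A * well ((1 - \<delta>) * R) \<xi>) \<le> (\<Sum>u\<in>B. ennreal (R - l u) * ennreal (wpow \<phi> u \<xi>))" .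
  qed
  also have "\<dots> = (\<Sum>u\<in>B. ennreal (R - l u) * (\<integral>\<^sup>+\<xi>. ennreal (wpow \<phi> u \<xi>) \<partial>lborel))"
    by (subst nn_integral_sum) (auto simp: nn_integral_cmult)
  also have "\<dots> \<le> (\<Sum>u\<in>B. ennreal (R - l u) * ennreal ((2 * pi) ^ DIM('a)))"
  proof (intro sum_mono mult_left_mono)
    fix u assume u: "u \<in> B"
    then have n: "norm u = 1" using B(2) by (rule orthonormal_norm[rotated])
    obtain v where "(u, v) \<in> \<Gamma>"
      using B(3) u by (auto simp: form_eigen_def)
    from wpow_integral_le[OF this \<phi>] show "(\<integral>\<^sup>+\<xi>. ennreal (wpow \<phi> u \<xi>) \<partial>lborel) \<le> ennreal ((2 * pi) ^ DIM('a))"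
      by (simp add: n)
  qed simp
  also have "\<dots> = ennreal ((2 * pi) ^ DIM('a) * (\<Sum>u\<in>B. R - l u))"
    unfolding sum_distrib_left using B(4)
    by (subst sum_ennreal[symmetric]) (auto simp: ennreal_mult' less_imp_le mult.commute)
  finally have le: "ennreal (A * weyl ((1 - \<delta>) * R)) \<le> ennreal ((2 * pi) ^ DIM('a) * (\<Sum>u\<in>B. R - l u))" .
  have "0 \<le> (\<Sum>u\<in>B. R - l u)"
    using B(4) by (intro sum_nonneg) (auto intro: less_imp_le)
  then have "0 \<le> (2 * pi) ^ DIM('a) * (\<Sum>u\<in>B. R - l u)" by simp
  with le have "A * weyl ((1 - \<delta>) * R) \<le> (2 * pi) ^ DIM('a) * (\<Sum>u\<in>B. R - l u)"
    by (simp only: ennreal_le_iff)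
  then show ?thesis using that B unfolding A_def by blast
qed

end

section \<open>Multiplicities and Riesz means\<close>

context finite_domain
begin

definition eigfam :: "real \<Rightarrow> 'a L2 set \<Rightarrow> bool" where
  "eigfam \<kappa> B \<longleftrightarrow> finite B \<and> orthonormal B \<and> (\<forall>u\<in>B. eigen \<kappa> u)"

text \<open>Orthonormality forces an indexed family to be injective, so families of length n and
  orthonormal sets with n elements are interchangeable.\<close>

lemma bilap_mult_eq_Sup: "bilap_mult \<Omega> \<kappa> = Sup {enat (card B) | B. eigfam \<kappa> B}"
proof -
  have eq: "(\<exists>U::nat \<Rightarrow> 'a \<Rightarrow> real. (\<forall>i<n. bilap_eigen \<Omega> \<kappa> (U i)) \<and>
      (\<forall>i<n. \<forall>j<n. (\<integral>x. U i x * U j x \<partial>lebesgue) = (if i = j then 1 else 0)))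
    \<longleftrightarrow> (\<exists>B. eigfam \<kappa> B \<and> card B = n)" (is "?L n \<longleftrightarrow> ?R n") for n
  proof
    assume "?L n"
    then obtain U :: "nat \<Rightarrow> 'a \<Rightarrow> real" where U: "\<And>i. i < n \<Longrightarrow> bilap_eigen \<Omega> \<kappa> (U i)"
      "\<And>i j. i < n \<Longrightarrow> j < n \<Longrightarrow> (\<integral>x. U i x * U j x \<partial>lebesgue) = (if i = j then 1 else 0)"
      by blast
    define b where "b i = L2_class (U i)" for i
    have eig: "L2fun (U i)" "eigen \<kappa> (b i)" if "i < n" for i
      using U(1)[OF that] by (auto simp: bilap_eigen_iff b_def)
    have inner_b: "inner (b i) (b j) = (if i = j then 1 else 0)" if "i < n" "j < n" for i j
      using U(2)[OF that] eig(1)[OF that(1)] eig(1)[OF that(2)] by (simp add: b_def inner_L2_class)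
    have inj: "inj_on b {..<n}"
    proof (rule inj_onI)
      fix i j assume ij: "i \<in> {..<n}" "j \<in> {..<n}" "b i = b j"
      then have "inner (b i) (b j) = 1" using inner_b[of i i] by simp
      then show "i = j" using inner_b[of i j] ij by (auto split: if_splits)
    qed
    have "orthonormal (b ` {..<n})"
      unfolding orthonormal_def using inner_b inj by (auto simp: inj_on_eq_iff)
    then have "eigfam \<kappa> (b ` {..<n})" using eig by (auto simp: eigfam_def)
    moreover have "card (b ` {..<n}) = n" using inj by (simp add: card_image)
    ultimately show "?R n" by blast
  next
    assume "?R n"
    then obtain B where B: "finite B" "orthonormal B" "\<forall>u\<in>B. eigen \<kappa> u" "card B = n"
      by (auto simp: eigfam_def)
    obtain b where b: "bij_betw b {0..<n} B"
      using ex_bij_betw_nat_finite[OF B(1)] B(4) by blast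
    have "\<exists>f. b i = L2_class f \<and> L2fun f" for i by (metis L2_class_cases)
    then obtain U where U: "\<And>i. b i = L2_class (U i)" "\<And>i. L2fun (U i)" by metis
    have bB: "b i \<in> B" if "i < n" for i using b that by (auto simp: bij_betw_def)
    have "bilap_eigen \<Omega> \<kappa> (U i)" if "i < n" for i
      using bB[OF that] B(3) U by (auto simp: bilap_eigen_iff)
    moreover have "(\<integral>x. U i x * U j x \<partial>lebesgue) = (if i = j then 1 else 0)" if "i < n" "j < n" for i j
    proof -
      have "(\<integral>x. U i x * U j x \<partial>lebesgue) = inner (b i) (b j)" by (simp add: U inner_L2_class)
      also have "\<dots> = (if b i = b j then 1 else 0)"
        using B(2) bB that unfolding orthonormal_def by blast
      also have "b i = b j \<longleftrightarrow> i = j"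
        using b that by (auto simp: bij_betw_def inj_on_eq_iff)
      finally show ?thesis .
    qed
    ultimately show "?L n" by blast
  qed
  have "{enat n | n. \<exists>B. eigfam \<kappa> B \<and> card B = n} = {enat (card B) | B. eigfam \<kappa> B}" by auto
  then show ?thesis unfolding bilap_mult_def eq by simp
qed

lemma card_le_bilap_mult: "eigfam \<kappa> B \<Longrightarrow> enat (card B) \<le> bilap_mult \<Omega> \<kappa>"
  unfolding bilap_mult_eq_Sup by (rule Sup_upper) blast

text \<open>Family sizes are bounded by \<open>card_eigen_le\<close>, taken at level \<kappa> + 1
  because it counts eigenvalues strictly below its level; hence the supremum is a maximum.\<close>

lemma bilap_mult_attained: "\<exists>B. eigfam \<kappa> B \<and> bilap_mult \<Omega> \<kappa> = enat (card B)"
proof -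
  define P where "P n \<longleftrightarrow> (\<exists>B. eigfam \<kappa> B \<and> card B = n)" for n
  have P0: "P 0" unfolding P_def by (rule exI[of _ "{}"]) (simp add: eigfam_def orthonormal_def)
  have PN: "n \<le> max_count (\<kappa> + 1)" if "P n" for n
  proof -
    obtain B where B: "eigfam \<kappa> B" "card B = n" using \<open>P n\<close> by (auto simp: P_def)
    show ?thesis
      using card_eigen_le[of B "\<lambda>_. \<kappa>" "\<kappa> + 1"] B by (auto simp: eigfam_def)
  qed
  have "P (Greatest P)" using P0 PN by (metis GreatestI_nat)
  then obtain B where B: "eigfam \<kappa> B" "card B = Greatest P" by (auto simp: P_def)
  have "bilap_mult \<Omega> \<kappa> \<le> enat (card B)"
    unfolding bilap_mult_eq_Sup
  proof (rule Sup_least)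
    fix m assume "m \<in> {enat (card B) | B. eigfam \<kappa> B}"
    then obtain n where n: "m = enat n" "P n" by (auto simp: P_def)
    have "n \<le> Greatest P" by (rule Greatest_le_nat[where b = "max_count (\<kappa> + 1)"]) (use n(2) PN in blast)+
    then show "m \<le> enat (card B)" by (simp add: n(1) B(2))
  qed
  then have "bilap_mult \<Omega> \<kappa> = enat (card B)"
    using card_le_bilap_mult[OF B(1)] by (rule antisym)
  then show ?thesis using B(1) by blast
qed

text \<open>Grouped by the value of \<open>l\<close>, the set splits into eigenfamilies of size at
  most the multiplicity; passing from the occurring values to all reals only adds nonnegative
  terms.\<close>

lemma riesz_sum_ge:
  assumes B: "finite B" "orthonormal B" "\<forall>u\<in>B. eigen (l u) u" "\<forall>u\<in>B. l u < z\<^sup>2"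
  shows "ennreal (\<Sum>u\<in>B. z\<^sup>2 - l u) \<le> riesz_sum \<Omega> z"
proof -
  define f where "f \<kappa> = ennreal_of_enat (bilap_mult \<Omega> \<kappa>) * ennreal (max (z\<^sup>2 - \<kappa>) 0)" for \<kappa>
  have "(\<Sum>u\<in>B. z\<^sup>2 - l u) = (\<Sum>\<kappa>\<in>l ` B. \<Sum>u\<in>{u \<in> B. l u = \<kappa>}. z\<^sup>2 - l u)"
    by (rule sum.image_gen[OF B(1)])
  also have "\<dots> = (\<Sum>\<kappa>\<in>l ` B. real (card {u \<in> B. l u = \<kappa>}) * max (z\<^sup>2 - \<kappa>) 0)"
    using B(4) by (intro sum.cong refl) (auto simp: max_def)
  finally have "ennreal (\<Sum>u\<in>B. z\<^sup>2 - l u)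
      = (\<Sum>\<kappa>\<in>l ` B. ennreal (real (card {u \<in> B. l u = \<kappa>})) * ennreal (max (z\<^sup>2 - \<kappa>) 0))"
    by (simp add: sum_ennreal[symmetric] ennreal_mult')
  also have "\<dots> \<le> (\<Sum>\<kappa>\<in>l ` B. f \<kappa>)"
    unfolding f_def
  proof (intro sum_mono mult_right_mono)
    fix \<kappa>
    have "eigfam \<kappa> {u \<in> B. l u = \<kappa>}"
      using B by (auto simp: eigfam_def orthonormal_def)
    from card_le_bilap_mult[OF this]
    have "ennreal_of_enat (enat (card {u \<in> B. l u = \<kappa>})) \<le> ennreal_of_enat (bilap_mult \<Omega> \<kappa>)"
      by (simp only: ennreal_of_enat_le_iff)
    then show "ennreal (real (card {u \<in> B. l u = \<kappa>})) \<le> ennreal_of_enat (bilap_mult \<Omega> \<kappa>)"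
      by (simp add: ennreal_of_nat_eq_real_of_nat)
  qed simp
  also have "\<dots> = (\<integral>\<^sup>+\<kappa>. f \<kappa> \<partial>count_space (l ` B))"
    using B(1) by (simp add: nn_integral_count_space_finite)
  also have "\<dots> = (\<integral>\<^sup>+\<kappa>. f \<kappa> * indicator (l ` B) \<kappa> \<partial>count_space UNIV)"
    by (rule nn_integral_count_space_indicator) simp
  also have "\<dots> \<le> (\<integral>\<^sup>+\<kappa>. f \<kappa> \<partial>count_space UNIV)"
    by (rule nn_integral_mono) (auto simp: indicator_def)
  finally show ?thesis by (simp add: riesz_sum_def f_def)
qed

text \<open>Choosing a largest eigenfamily for every real number and uniting those below z^2 turns
  the Riesz sum into a sum over one finite orthonormal set, to which Berezin--Li--Yau
  applies.\<close>

lemma riesz_sum_le: "riesz_sum \<Omega> z \<le> ennreal (vol * weyl (z\<^sup>2) / (2 * pi) ^ DIM('a))"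
proof -
  obtain F where F: "\<And>\<kappa>. eigfam \<kappa> (F \<kappa>)" "\<And>\<kappa>. bilap_mult \<Omega> \<kappa> = enat (card (F \<kappa>))"
    using bilap_mult_attained by metis
  let ?U = "\<lambda>S. \<Union>\<kappa>\<in>S. F \<kappa>"
  \<comment> \<open>Recovers the eigenvalue from the vector. It is unique: a unit vector with two
    distinct eigenvalues would be orthogonal to itself.\<close>
  define l where "l u = (SOME \<kappa>. eigen \<kappa> u)" for u
  have l: "l u = \<kappa>" if "u \<in> F \<kappa>" for u \<kappa>
  proof -
    have e: "eigen \<kappa> u" "norm u = 1"
      using F(1)[of \<kappa>] that orthonormal_norm by (auto simp: eigfam_def)
    have "eigen (l u) u"
      unfolding l_def by (rule someI[of _ \<kappa>]) (rule e(1))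
    then show ?thesis
      using form_eigen_orthogonal[OF _ e(1), of "l u" u] e(2) by (auto simp del: inner_eq_zero_iff simp: norm_eq_1)
  qed
  have union: "finite (?U S)" "orthonormal (?U S)"
    "\<forall>u\<in>?U S. eigen (l u) u"
    "sum h (?U S) = (\<Sum>\<kappa>\<in>S. sum h (F \<kappa>))" if "finite S" for S and h :: "'a L2 \<Rightarrow> real"
  proof -
    have fF: "finite (F \<kappa>)" for \<kappa> using F(1) by (auto simp: eigfam_def)
    then show "finite (?U S)" using that by simp
    show "\<forall>u\<in>?U S. eigen (l u) u"
      using F(1) l by (auto simp: eigfam_def)
    have disj: "F \<kappa> \<inter> F \<mu> = {}" if "\<kappa> \<noteq> \<mu>" for \<kappa> \<mu>
      using l that by blast
    show "sum h (?U S) = (\<Sum>\<kappa>\<in>S. sum h (F \<kappa>))"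
      using that fF disj by (intro sum.UNION_disjoint) auto
    show "orthonormal (?U S)"
      unfolding orthonormal_def
    proof safe
      fix u w \<kappa> \<mu> assume uw: "u \<in> F \<kappa>" "w \<in> F \<mu>"
      show "inner u w = (if u = w then 1 else 0)"
      proof (cases "\<kappa> = \<mu>")
        case True
        then show ?thesis using uw F(1)[of \<kappa>] by (auto simp: eigfam_def orthonormal_def)
      next
        case False
        then have "inner u w = 0"
          using uw F(1)[of \<kappa>] F(1)[of \<mu>] form_eigen_orthogonal[of \<Gamma> \<kappa> u \<mu> w]
          by (auto simp: eigfam_def)
        moreover have "u \<noteq> w" using uw False disj by blast
        ultimately show ?thesis by simp
      qed
    qed
  qed
  define T where "T = {\<kappa>. \<kappa> < z\<^sup>2 \<and> F \<kappa> \<noteq> {}}"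
  \<comment> \<open>Each member of \<open>T\<close> contributes at least one vector, so more than
    \<open>max_count (z\<^sup>2)\<close> members would give too large an orthonormal set.\<close>
  have "finite T"
  proof (rule ccontr)
    assume "infinite T"
    obtain S where S: "S \<subseteq> T" "finite S" "card S = Suc (max_count (z\<^sup>2))"
      using infinite_arbitrarily_large[OF \<open>infinite T\<close>] by blast
    have "\<forall>u\<in>?U S. l u < z\<^sup>2" using S(1) l by (auto simp: T_def)
    then have "card (?U S) \<le> max_count (z\<^sup>2)"
      using union(3)[OF S(2)] by (intro card_eigen_le[where l = l, OF union(1,2)[OF S(2)]]) blast
    moreover have "(\<Sum>\<kappa>\<in>S. 1) \<le> (\<Sum>\<kappa>\<in>S. real (card (F \<kappa>)))"
    proof (rule sum_mono)
      fix \<kappa> assume "\<kappa> \<in> S"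
      then have "F \<kappa> \<noteq> {}" "finite (F \<kappa>)" using S(1) F(1) by (auto simp: T_def eigfam_def)
      then have "1 \<le> card (F \<kappa>)" by (simp add: Suc_leI card_gt_0_iff)
      then show "1 \<le> real (card (F \<kappa>))" by simp
    qed
    moreover have "(\<Sum>\<kappa>\<in>S. real (card (F \<kappa>))) = real (card (?U S))"
      using union(4)[OF S(2), of "\<lambda>_. 1"] by simp
    ultimately show False using S(3) by simp
  qed
  have "riesz_sum \<Omega> z = (\<Sum>\<kappa>\<in>T. ennreal_of_enat (bilap_mult \<Omega> \<kappa>) * ennreal (max (z\<^sup>2 - \<kappa>) 0))"
    unfolding riesz_sum_def
    by (rule nn_integral_count_space'[OF \<open>finite T\<close>])
       (auto simp: T_def F(2) max_def zero_enat_def[symmetric])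
  also have "\<dots> = (\<Sum>\<kappa>\<in>T. ennreal (\<Sum>u\<in>F \<kappa>. z\<^sup>2 - l u))"
  proof (rule sum.cong[OF refl])
    fix \<kappa> assume "\<kappa> \<in> T"
    then have "max (z\<^sup>2 - \<kappa>) 0 = z\<^sup>2 - \<kappa>" by (auto simp: T_def)
    moreover have "(\<Sum>u\<in>F \<kappa>. z\<^sup>2 - l u) = real (card (F \<kappa>)) * (z\<^sup>2 - \<kappa>)"
      using l by simp
    ultimately show "ennreal_of_enat (bilap_mult \<Omega> \<kappa>) * ennreal (max (z\<^sup>2 - \<kappa>) 0) = ennreal (\<Sum>u\<in>F \<kappa>. z\<^sup>2 - l u)"
      by (simp add: F(2) ennreal_mult' ennreal_of_nat_eq_real_of_nat)
  qed
  also have "\<dots> = ennreal (\<Sum>\<kappa>\<in>T. \<Sum>u\<in>F \<kappa>. z\<^sup>2 - l u)"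
    by (rule sum_ennreal) (use l in \<open>force simp: T_def intro!: sum_nonneg\<close>)
  also have "\<dots> = ennreal (\<Sum>u\<in>?U T. z\<^sup>2 - l u)"
    by (simp add: union(4)[OF \<open>finite T\<close>])
  also have "\<dots> \<le> ennreal (vol * weyl (z\<^sup>2) / (2 * pi) ^ DIM('a))"
  proof (rule ennreal_leI)
    have "(2 * pi) ^ DIM('a) * (\<Sum>u\<in>?U T. z\<^sup>2 - l u) \<le> vol * weyl (z\<^sup>2)"
      by (rule berezin_li_yau[OF union(1-3)[OF \<open>finite T\<close>]]) simp
    then show "(\<Sum>u\<in>?U T. z\<^sup>2 - l u) \<le> vol * weyl (z\<^sup>2) / (2 * pi) ^ DIM('a)"
      by (simp add: field_simps)
  qed
  finally show ?thesis .
qed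


section \<open>The Weyl limit by matching one-sided bounds\<close>

abbreviation riesz_mean :: "real \<Rightarrow> ennreal" where
  "riesz_mean z \<equiv> ennreal (z powr (- 2 - real DIM('a) / 2)) * riesz_sum \<Omega> z"

text \<open>The substitution R = z^2 turns R^(1 + d/4) into z^(2 + d/2), which the prefactor
  cancels; s = 1 serves the upper bound and s = 1 - \<delta> the lower one.\<close>

lemma weyl_scaling:
  assumes "0 < z" "0 < s"
  shows "z powr (- 2 - real DIM('a) / 2) * weyl (s * z\<^sup>2) =
    4 / (real DIM('a) + 4) * unit_ball_vol (real DIM('a)) * s powr (1 + real DIM('a) / 4)"
proof -
  have "(z\<^sup>2) powr (1 + real DIM('a) / 4) = z powr (2 + real DIM('a) / 2)"
    using assms(1) by (simp add: powr_powr powr_numeral[symmetric] del: powr_numeral)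
  then have "weyl (s * z\<^sup>2) = 4 / (real DIM('a) + 4) * unit_ball_vol (real DIM('a)) *
      (s powr (1 + real DIM('a) / 4) * z powr (2 + real DIM('a) / 2))"
    using assms by (simp add: weyl_def powr_mult)
  moreover have "z powr (- 2 - real DIM('a) / 2) * z powr (2 + real DIM('a) / 2) = 1"
    using assms(1) by (simp flip: powr_add)
  ultimately show ?thesis by (simp add: algebra_simps)
qed

definition weyl_limit :: real where
  "weyl_limit = 4 / (real DIM('a) + 4) * unit_ball_vol (real DIM('a)) / (2 * pi) ^ DIM('a) * vol"

lemma weyl_upper:
  assumes "0 < z"
  shows "riesz_mean z \<le> ennreal weyl_limit"
proof -
  have "riesz_mean z
      \<le> ennreal (z powr (- 2 - real DIM('a) / 2)) * ennreal (vol * weyl (z\<^sup>2) / (2 * pi) ^ DIM('a))"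
    by (rule mult_left_mono[OF riesz_sum_le]) simp
  also have "\<dots> = ennreal (z powr (- 2 - real DIM('a) / 2) * weyl (1 * z\<^sup>2) * (vol / (2 * pi) ^ DIM('a)))"
    by (simp add: ennreal_mult'[symmetric] algebra_simps)
  also have "\<dots> = ennreal weyl_limit"
    unfolding weyl_scaling[OF assms zero_less_one] by (simp add: weyl_limit_def algebra_simps)
  finally show ?thesis .
qed

lemma weyl_lower:
  assumes \<phi>: "\<phi> \<in> Cc_inf \<Omega>" "\<And>x. \<bar>\<phi> x\<bar> \<le> 1" and \<delta>: "0 < \<delta>" "\<delta> < 1"
  shows "eventually (\<lambda>z. ennreal (4 / (real DIM('a) + 4) * unit_ball_vol (real DIM('a)) / (2 * pi) ^ DIM('a)
      * ((norm (L2_class \<phi>))\<^sup>2 * (1 - \<delta>) powr (1 + real DIM('a) / 4)))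
    \<le> riesz_mean z) at_top"
proof (cases "norm (L2_class \<phi>) = 0")
  case False
  define A where "A = (norm (L2_class \<phi>))\<^sup>2"
  define C where "C = integral\<^sup>L lebesgue (energy \<phi>)"
  let ?L = "4 / (real DIM('a) + 4) * unit_ball_vol (real DIM('a)) / (2 * pi) ^ DIM('a) * (A * (1 - \<delta>) powr (1 + real DIM('a) / 4))"
    and ?s = "\<lambda>z. z powr (- 2 - real DIM('a) / 2)"
  have A: "0 < A" using False by (simp add: A_def)
  have C0: "0 \<le> C" unfolding C_def
    by (intro integral_nonneg_AE AE_I2) (simp add: energy_def sum_nonneg)
  \<comment> \<open>For such z, C (1 + z) <= 2 C z <= \<delta> A z^2, which is the hypothesis
    \<open>large\<close> of \<open>riesz_lower\<close> at R = z^2.\<close>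
  have "ennreal (?L)
    \<le> ennreal (?s z) * riesz_sum \<Omega> z" if z: "z \<ge> max 1 (2 * C / (\<delta> * A))" for z
  proof -
    have z1: "1 \<le> z" and z2: "2 * C \<le> z * (\<delta> * A)" and z0: "0 < z"
      using z A \<delta> by (auto simp: field_simps)
    have "C * (1 + z) \<le> C * (2 * z)" using C0 z1 by (intro mult_left_mono) auto
    also have "\<dots> = 2 * C * z" by simp
    also have "\<dots> \<le> z * (\<delta> * A) * z" using z0 z2 by (intro mult_right_mono) auto
    finally have large: "C * (1 + sqrt (z\<^sup>2)) \<le> \<delta> * z\<^sup>2 * A"
      using z0 by (simp add: power2_eq_square algebra_simps)
    obtain B l where B: "finite B" "orthonormal B" "\<forall>u\<in>B. eigen (l u) u" "\<forall>u\<in>B. l u < z\<^sup>2"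
      "A * weyl ((1 - \<delta>) * z\<^sup>2) \<le> (2 * pi) ^ DIM('a) * (\<Sum>u\<in>B. z\<^sup>2 - l u)"
      unfolding A_def
      by (rule riesz_lower[OF \<phi>, of "z\<^sup>2" \<delta>]) (use z0 \<delta> large in \<open>auto simp: A_def C_def\<close>)
    have "?L
      = ?s z * weyl ((1 - \<delta>) * z\<^sup>2) * A / (2 * pi) ^ DIM('a)"
      using \<delta> by (subst weyl_scaling[OF z0]) (auto simp: algebra_simps)
    also have "\<dots> = ?s z * (A * weyl ((1 - \<delta>) * z\<^sup>2) / (2 * pi) ^ DIM('a))"
      by (simp add: algebra_simps)
    also have "\<dots> \<le> ?s z * (\<Sum>u\<in>B. z\<^sup>2 - l u)"
      using B(5) by (intro mult_left_mono) (auto simp: field_simps)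
    finally have "ennreal (?L)
      \<le> ennreal (?s z * (\<Sum>u\<in>B. z\<^sup>2 - l u))" by (rule ennreal_leI)
    also have "\<dots> = ennreal (?s z) * ennreal (\<Sum>u\<in>B. z\<^sup>2 - l u)"
      by (simp add: ennreal_mult')
    also have "\<dots> \<le> ennreal (?s z) * riesz_sum \<Omega> z"
      by (rule mult_left_mono[OF riesz_sum_ge[OF B(1-4)]]) simp
    finally show ?thesis .
  qed
  then show ?thesis
    unfolding A_def eventually_at_top_linorder by blast
qed simp

lemma cutoff_norm_tendsto:
  assumes "\<And>n. \<phi> n \<in> Cc_inf \<Omega>" "\<And>n x. \<bar>\<phi> n x\<bar> \<le> 1" "\<And>x. x \<in> \<Omega> \<Longrightarrow> (\<lambda>n. \<phi> n x) \<longlonglongrightarrow> 1"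
  shows "(\<lambda>n. (norm (L2_class (\<phi> n)))\<^sup>2) \<longlonglongrightarrow> vol"
proof -
  have i: "integrable lebesgue (indicator \<Omega> :: 'a \<Rightarrow> real)"
    using domain_finite by (intro integrable_real_indicator) auto
  have "(\<lambda>n. \<integral>x. (\<phi> n x)\<^sup>2 \<partial>lebesgue) \<longlonglongrightarrow> (\<integral>x. indicator \<Omega> x \<partial>lebesgue)"
  proof (rule integral_dominated_convergence[OF _ _ i])
    show "AE x in lebesgue. (\<lambda>n. (\<phi> n x)\<^sup>2) \<longlonglongrightarrow> indicator \<Omega> x"
    proof (rule AE_I2)
      fix x
      show "(\<lambda>n. (\<phi> n x)\<^sup>2) \<longlonglongrightarrow> indicator \<Omega> x"
      proof (cases "x \<in> \<Omega>")
        case True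
        then show ?thesis using tendsto_power[OF assms(3)[OF True], of 2] by simp
      next
        case False
        then show ?thesis using Cc_inf_zero[OF assms(1) False] by simp
      qed
    qed
    have "(\<phi> n x)\<^sup>2 \<le> indicator \<Omega> x" for n x
      using Cc_inf_zero[OF assms(1), of x n] assms(2)[of n x] by (cases "x \<in> \<Omega>") (auto simp: abs_square_le_1)
    then show "AE x in lebesgue. norm ((\<phi> n x)\<^sup>2) \<le> indicator \<Omega> x" for n by simp
    show "(\<lambda>x. (\<phi> n x)\<^sup>2) \<in> borel_measurable lebesgue" for n
      using L2funD(2)[OF Cc_inf_L2fun[OF assms(1)]] by (rule borel_measurable_integrable)
  qed (use i in auto)
  moreover have "(\<integral>x. indicator \<Omega> x \<partial>lebesgue) = vol" by simp
  ultimately show ?thesis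
    by (simp only: norm_L2_class_sq[OF Cc_inf_L2fun[OF assms(1)]])
qed

text \<open>The upper bound holds at every z > 0. For the lower one, cutoff and \<delta> share an
  index n and the constants \<open>b n\<close> tend to the limit, so a single n with
  \<open>b n\<close> beyond \<open>a\<close> is fixed before z tends to infinity.\<close>

theorem weyl_asymptotics:
  "((\<lambda>z. riesz_mean z) \<longlongrightarrow> ennreal weyl_limit) at_top"
proof (rule order_tendstoI)
  fix a assume "ennreal weyl_limit < a"
  then have "riesz_mean z < a" if "z > 0" for z
    using weyl_upper[OF that] by (rule order.strict_trans1[rotated])
  then show "\<forall>\<^sub>F z in at_top. riesz_mean z < a"
    by (rule eventually_mono[OF eventually_gt_at_top[of 0]])
next
  fix a assume a: "a < ennreal weyl_limit"
  obtain \<phi> :: "nat \<Rightarrow> 'a \<Rightarrow> real" where \<phi>: "\<And>n. \<phi> n \<in> Cc_inf \<Omega>" "\<And>n x. 0 \<le> \<phi> n x" "\<And>n x. \<phi> n x \<le> 1"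
    "\<And>x. x \<in> \<Omega> \<Longrightarrow> (\<lambda>n. \<phi> n x) \<longlonglongrightarrow> 1"
    using Cc_inf_cutoffs[OF open_domain domain_nonempty] by blast
  have \<phi>1: "\<bar>\<phi> n x\<bar> \<le> 1" for n x using \<phi>(2,3) by simp
  \<comment> \<open>\<open>Suc (Suc n)\<close> keeps \<delta> below 1 also at n = 0.\<close>
  define \<delta> where "\<delta> n = 1 / real (Suc (Suc n))" for n
  have \<delta>: "0 < \<delta> n" "\<delta> n < 1" for n by (auto simp: \<delta>_def)
  have \<delta>0: "\<delta> \<longlonglongrightarrow> 0"
    unfolding \<delta>_def[abs_def] using LIMSEQ_Suc[OF LIMSEQ_Suc[OF lim_1_over_n]] by simp
  define b where "b n = 4 / (real DIM('a) + 4) * unit_ball_vol (real DIM('a)) / (2 * pi) ^ DIM('a)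
      * ((norm (L2_class (\<phi> n)))\<^sup>2 * (1 - \<delta> n) powr (1 + real DIM('a) / 4))" for n
  have "(\<lambda>n. (1 - \<delta> n) powr (1 + real DIM('a) / 4)) \<longlonglongrightarrow> (1 - 0) powr (1 + real DIM('a) / 4)"
    by (intro tendsto_intros \<delta>0) simp
  then have "b \<longlonglongrightarrow> 4 / (real DIM('a) + 4) * unit_ball_vol (real DIM('a)) / (2 * pi) ^ DIM('a) * (vol * 1)"
    unfolding b_def[abs_def] by (intro tendsto_mult tendsto_const cutoff_norm_tendsto \<phi> \<phi>1) simp_all
  then have "(\<lambda>n. ennreal (b n)) \<longlonglongrightarrow> ennreal weyl_limit"
    by (intro tendsto_ennrealI) (simp add: weyl_limit_def)
  from order_tendstoD(1)[OF this a] obtain n where n: "a < ennreal (b n)"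
    by (auto simp: eventually_sequentially)
  have "\<forall>\<^sub>F z in at_top. ennreal (b n) \<le> riesz_mean z"
    unfolding b_def by (rule weyl_lower[OF \<phi>(1) \<phi>1 \<delta>])
  then show "\<forall>\<^sub>F z in at_top. a < riesz_mean z"
    by eventually_elim (rule order.strict_trans2[OF n])
qed

end

theorem theorem2p2:
  fixes \<Omega> :: "'a::euclidean_space set"
  assumes "open \<Omega>" and "connected \<Omega>" and "\<Omega> \<noteq> {}"
    and "condition_M \<Omega>"
  shows "((\<lambda>z. ennreal (z powr (- 2 - real DIM('a) / 2)) * riesz_sum \<Omega> z) \<longlongrightarrow>
      ennreal (4 / (real DIM('a) + 4) * (2 * pi) powr (- real DIM('a)) *
               measure lebesgue (ball (0::'a) 1) * measure lebesgue \<Omega>)) at_top"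
proof -
  interpret finite_domain \<Omega>
    using assms by unfold_locales (auto simp: condition_M_def)
  have "measure lebesgue (ball (0::'a) 1) = unit_ball_vol (real DIM('a))"
    by (simp add: content_ball)
  moreover have "(2 * pi) powr (- real DIM('a)) = 1 / (2 * pi) ^ DIM('a)"
    by (simp add: powr_minus powr_realpow divide_inverse)
  ultimately have "weyl_limit = 4 / (real DIM('a) + 4) * (2 * pi) powr (- real DIM('a)) *
      measure lebesgue (ball (0::'a) 1) * measure lebesgue \<Omega>"
    by (simp add: weyl_limit_def)
  then show ?thesis using weyl_asymptotics by simp
qed

end
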